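(* Let $(M,g)$ be a connected, oriented and time-oriented $m$-dimensional Lorentzian manifold and let $k\in\{1,\dots,m\}$. Then $Hol(M,g)\subset SO(m-k)$ if and only if $M$ admits an orthonormal system $\{V_1,V_2,\dots,V_k\}$ formed by parallel vector fields on $M$, with $V_1$ timelike.
   Context: $Hol(M,g)$ is the holonomy group of the Levi-Civita connection of $g$ (parallel transports along loops at a point), regarded up to conjugation as a subgroup of the Lorentz group $O_1(m)=O(1,m-1)$ of $\mathbb{R}^m$ with its standard Lorentzian scalar product, whose first coordinate vector is timelike. The inclusion $Hol(M,g)\subset SO(m-k)$ is understood up to conjugation in $O_1(m)$, where $SO(m-k)$ is embedded as the subgroup that fixes the first $k$ standard basis vectors (one timelike, $k-1$ spacelike) and acts as the special orthogonal group on the span of the remaining $m-k$ spacelike ones ($SO(0)$ is the trivial group). A system $\{V_1,\dots,V_k\}$ with $V_1$ timelike is orthonormal if $g(V_1,V_1)=-1$, $g(V_i,V_i)=1$ for $i\ge 2$ and $g(V_i,V_j)=0$ for $i\neq j$. *)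

theory Defs
  imports "HOL-Analysis.Analysis"
begin

section \<open>Smooth maps\<close>

fun ck_on :: "nat \<Rightarrow> 'a::real_normed_vector set \<Rightarrow> ('a \<Rightarrow> 'b::real_normed_vector) \<Rightarrow> bool" where
  "ck_on 0 S f \<longleftrightarrow> continuous_on S f"
| "ck_on (Suc n) S f \<longleftrightarrow>
     (\<forall>x\<in>S. f differentiable (at x)) \<and> (\<forall>v. ck_on n S (\<lambda>x. frechet_derivative f (at x) v))"

text \<open>Meant for open \<open>S\<close>, as \<open>ck_on\<close> uses full (not one-sided) derivatives.\<close>

definition smooth_on :: "'a::real_normed_vector set \<Rightarrow> ('a \<Rightarrow> 'b::real_normed_vector) \<Rightarrow> bool" where
  "smooth_on S f \<longleftrightarrow> (\<forall>n. ck_on n S f)"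

text \<open>Smoothness up to the end points of a compact interval: \<open>D n\<close> is the \<open>n\<close>-th derivative,
  one-sided at the end points.\<close>

definition smooth_on_interval :: "real \<Rightarrow> real \<Rightarrow> (real \<Rightarrow> 'b::real_normed_vector) \<Rightarrow> bool" where
  "smooth_on_interval a b f \<longleftrightarrow>
     (\<exists>D :: nat \<Rightarrow> real \<Rightarrow> 'b. (\<forall>t\<in>{a..b}. D 0 t = f t) \<and>
        (\<forall>n. \<forall>t\<in>{a..b}. (D n has_vector_derivative D (Suc n) t) (at t within {a..b})))"

section \<open>Smooth manifolds\<close>

text \<open>A manifold is a subset \<open>M\<close> of a second countable Hausdorff space, with the subspace topology,
  together with an atlas. Charts take values in \<open>real ^ 'n\<close>, so the dimension is \<open>CARD('n)\<close>.\<close>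

datatype ('a, 'e) chart = Chart (chart_dom: "'a set") (chart_map: "'a \<Rightarrow> 'e")

definition chart_inv :: "('a, 'e) chart \<Rightarrow> 'e \<Rightarrow> 'a" where
  "chart_inv c = inv_into (chart_dom c) (chart_map c)"

definition transition :: "('a, 'e) chart \<Rightarrow> ('a, 'e) chart \<Rightarrow> 'e \<Rightarrow> 'e" where
  "transition c d = chart_map d \<circ> chart_inv c"

definition smooth_atlas ::
  "'a::{t2_space,second_countable_topology} set \<Rightarrow> ('a, real ^ 'n) chart set \<Rightarrow> bool" where
  "smooth_atlas M A \<longleftrightarrow>
     (\<Union>c\<in>A. chart_dom c) = M \<and>
     (\<forall>c\<in>A. openin (top_of_set M) (chart_dom c) \<and>
            open (chart_map c ` chart_dom c) \<and>
            homeomorphism (chart_dom c) (chart_map c ` chart_dom c) (chart_map c) (chart_inv c)) \<and>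
     (\<forall>c\<in>A. \<forall>d\<in>A. smooth_on (chart_map c ` (chart_dom c \<inter> chart_dom d)) (transition c d))"

text \<open>The differential, at the point \<open>p\<close>, of the change of coordinates from \<open>c\<close> to \<open>d\<close>.\<close>

definition d_transition ::
  "('a, real ^ 'n) chart \<Rightarrow> ('a, real ^ 'n) chart \<Rightarrow> 'a \<Rightarrow> real ^ 'n \<Rightarrow> real ^ 'n" where
  "d_transition c d p = frechet_derivative (transition c d) (at (chart_map c p))"

text \<open>An oriented manifold is one whose atlas consists of positively oriented charts.\<close>

definition oriented_atlas :: "('a, real ^ 'n) chart set \<Rightarrow> bool" where
  "oriented_atlas A \<longleftrightarrow>
     (\<forall>c\<in>A. \<forall>d\<in>A. \<forall>p\<in>chart_dom c \<inter> chart_dom d. det (matrix (d_transition c d p)) > 0)"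

section \<open>Tangent vectors and vector fields\<close>

text \<open>A tangent vector at \<open>p\<close> is the family of its coordinate vectors in the charts around \<open>p\<close>,
  related by the differentials of the coordinate changes. The value at all other charts is
  set to \<open>0\<close>, so that equality of tangent vectors is equality of functions.\<close>

type_synonym ('a, 'e) tangent_vector = "('a, 'e) chart \<Rightarrow> 'e"

definition tangent_space ::
  "('a, real ^ 'n) chart set \<Rightarrow> 'a \<Rightarrow> ('a, real ^ 'n) tangent_vector set" where
  "tangent_space A p =
     {v. (\<forall>c\<in>A. \<forall>d\<in>A. p \<in> chart_dom c \<inter> chart_dom d \<longrightarrow> v d = d_transition c d p (v c)) \<and>
         (\<forall>c. \<not> (c \<in> A \<and> p \<in> chart_dom c) \<longrightarrow> v c = 0)}"

text \<open>The tangent vector at \<open>p\<close> whose coordinate vector in the chart \<open>c\<close> is \<open>u\<close>.\<close>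

definition coord_vector ::
  "('a, real ^ 'n) chart set \<Rightarrow> ('a, real ^ 'n) chart \<Rightarrow> 'a \<Rightarrow> real ^ 'n
     \<Rightarrow> ('a, real ^ 'n) tangent_vector" where
  "coord_vector A c p u =
     (\<lambda>d. if d \<in> A \<and> p \<in> chart_dom c \<inter> chart_dom d then d_transition c d p u else 0)"

definition coord_rep :: "('a, real ^ 'n) chart \<Rightarrow> ('a \<Rightarrow> ('a, real ^ 'n) tangent_vector)
     \<Rightarrow> real ^ 'n \<Rightarrow> real ^ 'n" where
  "coord_rep c V = (\<lambda>x. V (chart_inv c x) c)"

definition smooth_vector_field_on ::
  "('a, real ^ 'n) chart set \<Rightarrow> 'a set \<Rightarrow> ('a \<Rightarrow> ('a, real ^ 'n) tangent_vector) \<Rightarrow> bool" where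
  "smooth_vector_field_on A U V \<longleftrightarrow>
     (\<forall>p\<in>U. V p \<in> tangent_space A p) \<and>
     (\<forall>c\<in>A. smooth_on (chart_map c ` (chart_dom c \<inter> U)) (coord_rep c V))"

section \<open>Lorentzian metrics\<close>

text \<open>The index set \<open>'n\<close> is finite and linearly ordered; \<open>idx\<close> numbers it \<open>0, \<dots>, CARD('n) - 1\<close>.
  The coordinate number \<open>0\<close> is the timelike one.\<close>

definition idx :: "'n::{finite,linorder} \<Rightarrow> nat" where
  "idx i = card {..<i}"

definition lorentz_matrix :: "((real, 'n::{finite,linorder}) vec, 'n) vec" where
  "lorentz_matrix = (\<chi> i j. if i \<noteq> j then 0 else if idx i = 0 then -1 else 1)"

definition lorentz_group :: "(((real, 'n::{finite,linorder}) vec, 'n) vec) set" where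
  "lorentz_group = {B. transpose B ** lorentz_matrix ** B = lorentz_matrix}"

type_synonym ('a, 'e) metric =
  "'a \<Rightarrow> ('a, 'e) tangent_vector \<Rightarrow> ('a, 'e) tangent_vector \<Rightarrow> real"

definition orthonormal_frame ::
  "('a, (real, 'n) vec) chart set \<Rightarrow> ('a, (real, 'n) vec) metric \<Rightarrow> 'a
     \<Rightarrow> ('n::{finite,linorder} \<Rightarrow> ('a, (real, 'n) vec) tangent_vector) \<Rightarrow> bool" where
  "orthonormal_frame A g p E \<longleftrightarrow>
     (\<forall>i. E i \<in> tangent_space A p) \<and> (\<forall>i j. g p (E i) (E j) = lorentz_matrix $ i $ j)"

definition metric_comp ::
  "('a, real ^ 'n) chart set \<Rightarrow> ('a, real ^ 'n) metric \<Rightarrow> ('a, real ^ 'n) chart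
     \<Rightarrow> real ^ 'n \<Rightarrow> real ^ 'n ^ 'n" where
  "metric_comp A g c x =
     (let p = chart_inv c x
      in \<chi> i j. g p (coord_vector A c p (axis i 1)) (coord_vector A c p (axis j 1)))"

text \<open>The last-but-one conjunct says that \<open>g p\<close> has signature \<open>(-,+,\<dots>,+)\<close>; an orthonormal
  system of \<open>CARD('n)\<close> vectors is automatically a basis, and \<open>g p\<close> is nondegenerate.\<close>

definition lorentzian_metric ::
  "'a set \<Rightarrow> ('a, (real, 'n::{finite,linorder}) vec) chart set \<Rightarrow> ('a, (real, 'n) vec) metric \<Rightarrow> bool" where
  "lorentzian_metric M A g \<longleftrightarrow>
     (\<forall>p\<in>M. \<forall>u\<in>tangent_space A p. \<forall>v\<in>tangent_space A p. g p u v = g p v u) \<and>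
     (\<forall>p\<in>M. \<forall>u\<in>tangent_space A p. \<forall>v\<in>tangent_space A p. \<forall>w\<in>tangent_space A p. \<forall>a b.
        g p (\<lambda>c. a *\<^sub>R u c + b *\<^sub>R v c) w = a * g p u w + b * g p v w) \<and>
     (\<forall>p\<in>M. \<exists>E. orthonormal_frame A g p E) \<and>
     (\<forall>c\<in>A. smooth_on (chart_map c ` chart_dom c) (metric_comp A g c))"

text \<open>A time orientation selects, smoothly in the point, one of the two timecones in each
  tangent space.\<close>

definition time_orientation ::
  "'a::topological_space set \<Rightarrow> ('a, real ^ 'n) chart set \<Rightarrow> ('a, real ^ 'n) metric
     \<Rightarrow> ('a \<Rightarrow> ('a, real ^ 'n) tangent_vector set) \<Rightarrow> bool" where
  "time_orientation M A g \<tau> \<longleftrightarrow>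
     (\<forall>p\<in>M. \<exists>U T. openin (top_of_set M) U \<and> p \<in> U \<and> smooth_vector_field_on A U T \<and>
        (\<forall>q\<in>U. g q (T q) (T q) < 0 \<and>
           \<tau> q = {v \<in> tangent_space A q. g q v v < 0 \<and> g q (T q) v < 0}))"

section \<open>The Levi-Civita connection\<close>

text \<open>\<open>metric_deriv A g c x i j l\<close> is \<open>\<partial>\<^sub>i g\<^sub>j\<^sub>l\<close>, and \<open>christoffel A g c x k i j\<close> is the Christoffel
  symbol with upper index \<open>k\<close> and lower indices \<open>i\<close>, \<open>j\<close> in the chart \<open>c\<close>, at the coordinate
  point \<open>x\<close>. It is characterised by the lemmas \<open>christoffel_torsion_free\<close> and
  \<open>christoffel_metric\<close> below.\<close>

definition metric_deriv ::
  "('a, real ^ 'n) chart set \<Rightarrow> ('a, real ^ 'n) metric \<Rightarrow> ('a, real ^ 'n) chart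
     \<Rightarrow> real ^ 'n \<Rightarrow> 'n \<Rightarrow> 'n \<Rightarrow> 'n \<Rightarrow> real" where
  "metric_deriv A g c x i j l =
     frechet_derivative (\<lambda>y. metric_comp A g c y $ j $ l) (at x) (axis i 1)"

definition christoffel ::
  "('a, real ^ 'n) chart set \<Rightarrow> ('a, real ^ 'n) metric \<Rightarrow> ('a, real ^ 'n) chart
     \<Rightarrow> real ^ 'n \<Rightarrow> 'n \<Rightarrow> 'n \<Rightarrow> 'n \<Rightarrow> real" where
  "christoffel A g c x k i j =
     (\<Sum>l\<in>UNIV. matrix_inv (metric_comp A g c x) $ k $ l *
        (metric_deriv A g c x i j l + metric_deriv A g c x j i l - metric_deriv A g c x l i j)) / 2"

definition christoffel_map ::
  "('a, real ^ 'n) chart set \<Rightarrow> ('a, real ^ 'n) metric \<Rightarrow> ('a, real ^ 'n) chart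
     \<Rightarrow> real ^ 'n \<Rightarrow> real ^ 'n \<Rightarrow> real ^ 'n \<Rightarrow> real ^ 'n" where
  "christoffel_map A g c x u v =
     (\<chi> k. \<Sum>i\<in>UNIV. \<Sum>j\<in>UNIV. christoffel A g c x k i j * u $ i * v $ j)"

text \<open>The covariant derivative of the vector field \<open>V\<close> at \<open>p\<close> in the direction of the tangent
  vector \<open>u\<close>, again as a tangent vector at \<open>p\<close>.\<close>

definition cov_deriv ::
  "('a, real ^ 'n) chart set \<Rightarrow> ('a, real ^ 'n) metric \<Rightarrow> 'a \<Rightarrow> ('a, real ^ 'n) tangent_vector
     \<Rightarrow> ('a \<Rightarrow> ('a, real ^ 'n) tangent_vector) \<Rightarrow> ('a, real ^ 'n) tangent_vector" where
  "cov_deriv A g p u V =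
     (\<lambda>c. if c \<in> A \<and> p \<in> chart_dom c
          then frechet_derivative (coord_rep c V) (at (chart_map c p)) (u c)
             + christoffel_map A g c (chart_map c p) (u c) (V p c)
          else 0)"

definition parallel_vector_field ::
  "'a set \<Rightarrow> ('a, real ^ 'n) chart set \<Rightarrow> ('a, real ^ 'n) metric
     \<Rightarrow> ('a \<Rightarrow> ('a, real ^ 'n) tangent_vector) \<Rightarrow> bool" where
  "parallel_vector_field M A g V \<longleftrightarrow>
     smooth_vector_field_on A M V \<and>
     (\<forall>p\<in>M. \<forall>u\<in>tangent_space A p. cov_deriv A g p u V = (\<lambda>c. 0))"

subsection \<open>Torsion-freeness and compatibility with the metric\<close>

lemma smooth_atlas_open:
  assumes sm: "smooth_atlas M A" and c: "c \<in> A" and d: "openin (top_of_set M) U"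
  shows "open (chart_map c ` (chart_dom c \<inter> U))"
proof -
  have o: "openin (top_of_set M) (chart_dom c)" "open (chart_map c ` chart_dom c)"
    and h: "homeomorphism (chart_dom c) (chart_map c ` chart_dom c) (chart_map c) (chart_inv c)"
    using sm c unfolding smooth_atlas_def by blast+
  have "openin (top_of_set (chart_dom c)) (chart_dom c \<inter> U)"
  proof -
    obtain T where "open T" "U = M \<inter> T" using d openin_open by blast
    moreover have "chart_dom c \<subseteq> M" using o(1) openin_imp_subset by blast
    ultimately have "chart_dom c \<inter> U = chart_dom c \<inter> T" by blast
    then show ?thesis using \<open>open T\<close> openin_open by blast
  qed
  then have "openin (top_of_set (chart_map c ` chart_dom c)) (chart_map c ` (chart_dom c \<inter> U))"
    using h homeomorphism_imp_open_map by blast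
  then show ?thesis using o(2) openin_open_eq by blast
qed

lemma chart_inv_chart_map:
  assumes "smooth_atlas M A" "c \<in> A" "p \<in> chart_dom c"
  shows "chart_inv c (chart_map c p) = p"
  using assms unfolding smooth_atlas_def homeomorphism_def by blast

lemma smooth_on_differentiable: "smooth_on S f \<Longrightarrow> x \<in> S \<Longrightarrow> f differentiable (at x)"
  unfolding smooth_on_def by (metis ck_on.simps(2))

lemma d_transition_deriv:
  assumes sm: "smooth_atlas M A" and c: "c \<in> A" and d: "d \<in> A" and p: "p \<in> chart_dom c \<inter> chart_dom d"
  shows "(transition c d has_derivative d_transition c d p) (at (chart_map c p))"
proof -
  have "smooth_on (chart_map c ` (chart_dom c \<inter> chart_dom d)) (transition c d)"
    using sm c d unfolding smooth_atlas_def by blast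
  then have "transition c d differentiable (at (chart_map c p))"
    using p by (intro smooth_on_differentiable) auto
  then show ?thesis unfolding d_transition_def using frechet_derivative_works by blast
qed

lemma d_transition_cocycle:
  assumes sm: "smooth_atlas M A" and c: "c \<in> A" and d: "d \<in> A" and e: "e \<in> A"
    and p: "p \<in> chart_dom c" "p \<in> chart_dom d" "p \<in> chart_dom e"
  shows "d_transition d e p (d_transition c d p u) = d_transition c e p u"
proof -
  let ?x = "chart_map c p" and ?S = "chart_map c ` (chart_dom c \<inter> (chart_dom d \<inter> chart_dom e))"
  have tp: "transition c d ?x = chart_map d p"
    unfolding transition_def by (simp add: chart_inv_chart_map[OF sm c p(1)])
  have op: "openin (top_of_set M) (chart_dom d)" "openin (top_of_set M) (chart_dom e)"
    using sm d e unfolding smooth_atlas_def by blast+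
  have "open ?S" using smooth_atlas_open[OF sm c] op by blast
  have 1: "((transition d e \<circ> transition c d) has_derivative (d_transition d e p \<circ> d_transition c d p)) (at ?x)"
    using diff_chain_at[OF d_transition_deriv[OF sm c d], of p "transition d e" "d_transition d e p"]
      d_transition_deriv[OF sm d e, of p] p by (simp add: tp)
  have "transition c e y = (transition d e \<circ> transition c d) y" if "y \<in> ?S" for y
    using that by (auto simp: transition_def chart_inv_chart_map[OF sm c] chart_inv_chart_map[OF sm d])
  then have "(transition c e has_derivative (d_transition d e p \<circ> d_transition c d p)) (at ?x)"
    using p by (intro has_derivative_transform_within_open[OF 1 \<open>open ?S\<close>]) auto
  then have "d_transition c e p = d_transition d e p \<circ> d_transition c d p"
    using d_transition_deriv[OF sm c e, of p] p has_derivative_unique by blast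
  then show ?thesis by simp
qed

lemma coord_vector_tangent:
  assumes sm: "smooth_atlas M A" and c: "c \<in> A" and p: "p \<in> chart_dom c"
  shows "coord_vector A c p u \<in> tangent_space A p"
  unfolding tangent_space_def coord_vector_def
  by (auto simp: p d_transition_cocycle[OF sm c _ _ p])

lemma coord_vector_of_tangent:
  assumes c: "c \<in> A" and p: "p \<in> chart_dom c" and v: "v \<in> tangent_space A p"
  shows "coord_vector A c p (v c) = v"
proof
  fix d
  show "coord_vector A c p (v c) d = v d"
  proof (cases "d \<in> A \<and> p \<in> chart_dom d")
    case True
    then have "v d = d_transition c d p (v c)" using assms unfolding tangent_space_def by blast
    then show ?thesis using True p unfolding coord_vector_def by (metis IntI)
  next
    case False
    then have "v d = 0" using v unfolding tangent_space_def by blast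
    then show ?thesis using False by (auto simp: coord_vector_def)
  qed
qed

lemma metric_comp_sym:
  assumes sm: "smooth_atlas M A" and g: "lorentzian_metric M A g" and c: "c \<in> A"
  shows "metric_comp A g c y $ i $ j = metric_comp A g c y $ j $ i"
proof (cases "chart_inv c y \<in> chart_dom c")
  case True
  then have "chart_inv c y \<in> M" using sm c unfolding smooth_atlas_def by blast
  then have "g (chart_inv c y) u v = g (chart_inv c y) v u"
    if "u \<in> tangent_space A (chart_inv c y)" "v \<in> tangent_space A (chart_inv c y)" for u v
    using g that unfolding lorentzian_metric_def by blast
  from this[OF coord_vector_tangent[OF sm c True] coord_vector_tangent[OF sm c True]]
  show ?thesis unfolding metric_comp_def Let_def vec_lambda_beta .
next
  case False
  then show ?thesis by (simp add: metric_comp_def coord_vector_def Let_def)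
qed

lemma metric_deriv_sym:
  assumes "smooth_atlas M A" "lorentzian_metric M A g" "c \<in> A"
  shows "metric_deriv A g c y i j l = metric_deriv A g c y i l j"
  unfolding metric_deriv_def using metric_comp_sym[OF assms, of _ j l] by simp

lemma metric_sum_left:
  fixes g :: "('a::{t2_space,second_countable_topology}, (real, 'n::{finite,linorder}) vec) metric"
  assumes sm: "smooth_atlas M A" and g: "lorentzian_metric M A g" and c: "c \<in> A"
    and p: "p \<in> chart_dom c" and w: "w \<in> tangent_space A p"
  shows "g p (coord_vector A c p u) w = (\<Sum>i\<in>UNIV. u $ i * g p (coord_vector A c p (axis i 1)) w)"
proof -
  have M: "p \<in> M" using sm c p unfolding smooth_atlas_def by blast
  have lin: "g p (coord_vector A c p (a *\<^sub>R u + b *\<^sub>R v)) w =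
      a * g p (coord_vector A c p u) w + b * g p (coord_vector A c p v) w" for a b u v
  proof -
    have "coord_vector A c p (a *\<^sub>R u + b *\<^sub>R v) =
        (\<lambda>d. a *\<^sub>R coord_vector A c p u d + b *\<^sub>R coord_vector A c p v d)"
    proof
      fix d
      show "coord_vector A c p (a *\<^sub>R u + b *\<^sub>R v) d =
          a *\<^sub>R coord_vector A c p u d + b *\<^sub>R coord_vector A c p v d"
      proof (cases "d \<in> A \<and> p \<in> chart_dom d")
        case True
        then have "linear (d_transition c d p)"
          using d_transition_deriv[OF sm c, of d p] p has_derivative_linear by blast
        then show ?thesis using True p by (simp add: coord_vector_def linear_add linear_scale)
      qed (auto simp: coord_vector_def)
    qed
    then show ?thesis
      using g M w coord_vector_tangent[OF sm c p] unfolding lorentzian_metric_def by simp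
  qed
  have L: "linear (\<lambda>u. g p (coord_vector A c p u) w)"
  proof (rule linearI)
    show "g p (coord_vector A c p (x + y)) w = g p (coord_vector A c p x) w + g p (coord_vector A c p y) w" for x y
      using lin[of 1 x 1 y] by simp
    show "g p (coord_vector A c p (r *\<^sub>R x)) w = r *\<^sub>R g p (coord_vector A c p x) w" for r x
      using lin[of r x 0 0] by simp
  qed
  have "u = (\<Sum>i\<in>UNIV. (u $ i) *\<^sub>R axis i 1)"
    using basis_expansion[of u] by (simp add: scalar_mult_eq_scaleR)
  then have "g p (coord_vector A c p u) w = g p (coord_vector A c p (\<Sum>i\<in>UNIV. (u $ i) *\<^sub>R axis i 1)) w"
    by simp
  also have "\<dots> = (\<Sum>i\<in>UNIV. u $ i * g p (coord_vector A c p (axis i 1)) w)"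
    by (simp add: linear_sum[OF L] linear_scale[OF L])
  finally show ?thesis .
qed

lemma metric_comp_invertible:
  fixes g :: "('a::{t2_space,second_countable_topology}, (real, 'n::{finite,linorder}) vec) metric"
  assumes sm: "smooth_atlas M A" and g: "lorentzian_metric M A g" and c: "c \<in> A"
    and p: "p \<in> chart_dom c"
  shows "invertible (metric_comp A g c (chart_map c p))"
proof -
  let ?x = "chart_map c p"
  let ?G = "metric_comp A g c ?x"
  let ?e = "\<lambda>i. coord_vector A c p (axis i 1)"
  have M: "p \<in> M" using sm c p unfolding smooth_atlas_def by blast
  have G: "?G $ i $ j = g p (?e i) (?e j)" for i j
    by (simp add: metric_comp_def chart_inv_chart_map[OF sm c p])
  note T = coord_vector_tangent[OF sm c p]
  have sym: "g p u v = g p v u" if "u \<in> tangent_space A p" "v \<in> tangent_space A p" for u v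
    using g M that unfolding lorentzian_metric_def by blast
  obtain E where E: "orthonormal_frame A g p E"
    using g M unfolding lorentzian_metric_def by blast
  have ET: "E i \<in> tangent_space A p" for i using E by (simp add: orthonormal_frame_def)
  define P :: "((real, 'n) vec, 'n) vec" where "P = (\<chi> i j. E j c $ i)"
  have "transpose P ** (?G ** P) = lorentz_matrix"
  proof -
    have "(transpose P ** (?G ** P)) $ i $ j = lorentz_matrix $ i $ j" for i j
    proof -
      have "lorentz_matrix $ i $ j = g p (E i) (E j)" using E by (simp add: orthonormal_frame_def)
      also have "\<dots> = g p (coord_vector A c p (E i c)) (E j)"
        using coord_vector_of_tangent[OF c p ET] by simp
      also have "\<dots> = (\<Sum>a\<in>UNIV. E i c $ a * g p (coord_vector A c p (E j c)) (?e a))"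
        by (subst metric_sum_left[OF sm g c p ET])
          (simp only: coord_vector_of_tangent[OF c p ET] sym[OF T ET])
      also have "\<dots> = (\<Sum>a\<in>UNIV. E i c $ a * (\<Sum>b\<in>UNIV. E j c $ b * ?G $ a $ b))"
        by (subst metric_sum_left[OF sm g c p T]) (simp only: G sym[OF T T])
      also have "\<dots> = (transpose P ** (?G ** P)) $ i $ j"
        by (simp add: matrix_matrix_mult_def transpose_def P_def mult.commute)
      finally show ?thesis by simp
    qed
    then show ?thesis by (simp add: vec_eq_iff)
  qed
  moreover have "det (lorentz_matrix :: ((real, 'n) vec, 'n) vec) \<noteq> 0"
    by (subst det_diagonal) (auto simp: lorentz_matrix_def)
  ultimately have "det ?G \<noteq> 0" by (metis det_mul mult_zero_left mult_zero_right)
  then show ?thesis by (simp add: invertible_det_nz)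
qed

lemma christoffel_torsion_free:
  assumes "smooth_atlas M A" and "lorentzian_metric M A g" and "c \<in> A"
  shows "christoffel A g c x k i j = christoffel A g c x k j i"
  unfolding christoffel_def using metric_deriv_sym[OF assms, of x _ i j] by (simp add: algebra_simps)

lemma christoffel_metric:
  fixes g :: "('a::{t2_space,second_countable_topology}, (real, 'n::{finite,linorder}) vec) metric"
  assumes sm: "smooth_atlas M A" and g: "lorentzian_metric M A g" and c: "c \<in> A"
    and p: "p \<in> chart_dom c" and x: "x = chart_map c p"
  shows "metric_deriv A g c x i j l =
    (\<Sum>k\<in>UNIV. christoffel A g c x k i j * metric_comp A g c x $ k $ l) +
    (\<Sum>k\<in>UNIV. christoffel A g c x k i l * metric_comp A g c x $ j $ k)"
proof -
  let ?G = "metric_comp A g c x" and ?D = "metric_deriv A g c x"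
  have inv: "matrix_inv ?G ** ?G = mat 1" "?G ** matrix_inv ?G = mat 1"
    using someI_ex[OF metric_comp_invertible[OF sm g c p, unfolded invertible_def]] x
    unfolding matrix_inv_def by blast+
  have *: "(\<Sum>k\<in>UNIV. christoffel A g c x k i j * ?G $ l $ k) = (?D i j l + ?D j i l - ?D l i j) / 2"
    for i j l
  proof -
    let ?f = "\<lambda>l. (?D i j l + ?D j i l - ?D l i j) / 2"
    have "(\<Sum>k\<in>UNIV. christoffel A g c x k i j * ?G $ l $ k) = (?G *v (matrix_inv ?G *v (\<chi> l. ?f l))) $ l"
      unfolding christoffel_def matrix_vector_mult_def
      by (simp add: sum_divide_distrib mult.commute)
    also have "\<dots> = ?f l" by (simp add: matrix_vector_mul_assoc inv)
    finally show ?thesis .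
  qed
  have s: "?D a b e = ?D a e b" for a b e using metric_deriv_sym[OF sm g c] .
  have "(\<Sum>k\<in>UNIV. christoffel A g c x k i j * ?G $ k $ l) = (?D i j l + ?D j i l - ?D l i j) / 2"
    unfolding *[symmetric] by (rule sum.cong[OF refl]) (metis metric_comp_sym[OF sm g c])
  then show ?thesis using *[of i l j] s[of i l j] s[of j i l] s[of l i j] by (simp add: field_simps)
qed


section \<open>Parallel transport and holonomy\<close>

definition piecewise_smooth_curve ::
  "'a::topological_space set \<Rightarrow> ('a, real ^ 'n) chart set \<Rightarrow> (real \<Rightarrow> 'a) \<Rightarrow> bool" where
  "piecewise_smooth_curve M A \<gamma> \<longleftrightarrow>
     continuous_on {0..1} \<gamma> \<and> \<gamma> ` {0..1} \<subseteq> M \<and>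
     (\<exists>S. finite S \<and>
       (\<forall>c\<in>A. \<forall>a b. 0 \<le> a \<and> a < b \<and> b \<le> 1 \<and> {a<..<b} \<inter> S = {} \<and> \<gamma> ` {a..b} \<subseteq> chart_dom c
          \<longrightarrow> smooth_on_interval a b (chart_map c \<circ> \<gamma>)))"

text \<open>The differential equation is required on every closed interval on which the curve is smooth
  and runs in one chart, with one-sided derivatives at the end points. In particular
  \<open>X\<close> is continuous, also at the break points of \<open>\<gamma>\<close>.\<close>

definition parallel_along ::
  "('a, real ^ 'n) chart set \<Rightarrow> ('a, real ^ 'n) metric \<Rightarrow> (real \<Rightarrow> 'a)
     \<Rightarrow> (real \<Rightarrow> ('a, real ^ 'n) tangent_vector) \<Rightarrow> bool" where
  "parallel_along A g \<gamma> X \<longleftrightarrow>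
     (\<forall>t\<in>{0..1}. X t \<in> tangent_space A (\<gamma> t)) \<and>
     (\<forall>c\<in>A. \<forall>a b. 0 \<le> a \<and> a < b \<and> b \<le> 1 \<and> \<gamma> ` {a..b} \<subseteq> chart_dom c \<and>
        smooth_on_interval a b (chart_map c \<circ> \<gamma>) \<longrightarrow>
        (\<forall>t\<in>{a..b}. ((\<lambda>s. X s c) has_vector_derivative
            - christoffel_map A g c (chart_map c (\<gamma> t))
                (vector_derivative (chart_map c \<circ> \<gamma>) (at t within {a..b})) (X t c))
          (at t within {a..b})))"

definition parallel_transport ::
  "('a, real ^ 'n) chart set \<Rightarrow> ('a, real ^ 'n) metric \<Rightarrow> (real \<Rightarrow> 'a)
     \<Rightarrow> ('a, real ^ 'n) tangent_vector \<Rightarrow> ('a, real ^ 'n) tangent_vector \<Rightarrow> bool" where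
  "parallel_transport A g \<gamma> v w \<longleftrightarrow> (\<exists>X. parallel_along A g \<gamma> X \<and> X 0 = v \<and> X 1 = w)"

text \<open>The frame \<open>E\<close> seen as a linear isomorphism from \<open>real ^ 'n\<close> onto the tangent space.\<close>

definition frame_map ::
  "('n \<Rightarrow> ('a, real ^ 'n) tangent_vector) \<Rightarrow> real ^ 'n \<Rightarrow> ('a, real ^ 'n) tangent_vector" where
  "frame_map E v = (\<lambda>c. \<Sum>i\<in>UNIV. (v $ i) *\<^sub>R E i c)"

text \<open>The holonomy group at \<open>p\<close>, as a group of matrices by means of the frame \<open>E\<close> at \<open>p\<close>.\<close>

definition holonomy_group ::
  "'a::topological_space set \<Rightarrow> ('a, real ^ 'n) chart set \<Rightarrow> ('a, real ^ 'n) metric \<Rightarrow> 'a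
     \<Rightarrow> ('n \<Rightarrow> ('a, real ^ 'n) tangent_vector) \<Rightarrow> (real ^ 'n ^ 'n) set" where
  "holonomy_group M A g p E =
     {B. \<exists>\<gamma>. piecewise_smooth_curve M A \<gamma> \<and> \<gamma> 0 = p \<and> \<gamma> 1 = p \<and>
           (\<forall>v. parallel_transport A g \<gamma> (frame_map E v) (frame_map E (B *v v)))}"

text \<open>\<open>SO_stab k\<close> is \<open>SO(m - k)\<close> inside the matrices of size \<open>m = CARD('n)\<close>. A matrix satisfying the
  first three conditions is block diagonal with an identity block of size \<open>k\<close>, hence its determinant
  is that of its restriction to the span of the remaining basis vectors.\<close>

definition SO_stab :: "nat \<Rightarrow> (((real, 'n::{finite,linorder}) vec, 'n) vec) set" where
  "SO_stab k =
     {B. let W = span {axis i 1 | i. k \<le> idx i} in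
         (\<forall>i. idx i < k \<longrightarrow> B *v axis i 1 = axis i 1) \<and>
         (\<forall>v\<in>W. B *v v \<in> W) \<and>
         (\<forall>v\<in>W. \<forall>w\<in>W. (B *v v) \<bullet> (B *v w) = v \<bullet> w) \<and>
         det B = 1}"

definition conj_included ::
  "(((real, 'n::{finite,linorder}) vec, 'n) vec) set \<Rightarrow> (((real, 'n) vec, 'n) vec) set \<Rightarrow> bool" where
  "conj_included H K \<longleftrightarrow> (\<exists>C\<in>lorentz_group. \<forall>B\<in>H. C ** B ** matrix_inv C \<in> K)"

definition orthonormal_system ::
  "'a set \<Rightarrow> ('a, real ^ 'n) metric \<Rightarrow> nat \<Rightarrow> (nat \<Rightarrow> 'a \<Rightarrow> ('a, real ^ 'n) tangent_vector) \<Rightarrow> bool" where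
  "orthonormal_system M g k V \<longleftrightarrow>
     (\<forall>q\<in>M. \<forall>i\<in>{1..k}. \<forall>j\<in>{1..k}.
        g q (V i q) (V j q) = (if i \<noteq> j then 0 else if i = 1 then -1 else 1))"

end

theory Submission
  imports Defs
begin

text \<open>
  The idea is the holonomy principle: parallel vector fields correspond to the vectors at \<open>p\<close> that are
  fixed by all parallel transports along loops at \<open>p\<close>. A subgroup of the Lorentz group is conjugate into
  \<open>SO(m - k)\<close> if and only if it fixes an orthonormal system of \<open>k\<close> vectors, the first one timelike, and
  its elements have determinant \<open>1\<close>: an orthonormal system that contains a timelike vector extends to a
  Lorentz basis (\<open>lorentz_system_extend\<close>), and on the complement of the system the form is Euclidean
  (\<open>SO_stabI\<close>).

  From a parallel field to a fixed vector: the restriction of the field to a curve is parallel, and the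
  metric product of two parallel fields along a curve is constant (\<open>parallel_preserves_metric\<close>). So the
  holonomy consists of Lorentz matrices, and these fix the components of the field at \<open>p\<close>
  (\<open>holonomy_fixes_parallel_field\<close>). The determinant is positive because the coordinate determinant of
  a transported frame keeps its sign in oriented charts (\<open>frame_transport_orientation\<close>).

  From a fixed vector to a parallel field (\<open>invariant_vector_extends\<close>): parallel transport from \<open>p\<close>
  distributes the vector over the connected manifold, and the result does not depend on the curve,
  because two curves to the same point form a loop. Three facts of analysis are needed. Transport must
  exist; along short coordinate segments this is Banach's fixed point theorem
  (\<open>contraction_ode_solution\<close>), and longer curves are composed of segments. A solution in one chart
  must be a solution in all charts, which is the transformation law of the connection
  (\<open>connection_transformation\<close>); it follows from the uniqueness of a torsion free metric connection
  and the symmetry of second derivatives. Finally the field must be smooth: the transport equation along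
  the rays from a point determines its total derivative there (\<open>has_derivative_of_parallel_rays\<close>), and
  this derivative is a smooth expression in the field, so that differentiability bootstraps
  (\<open>smooth_of_parallel\<close>).
\<close>

section \<open>Closure properties of smooth maps\<close>

lemma ck_on_cong:
  assumes "open S" "\<And>x. x \<in> S \<Longrightarrow> f x = g x" "ck_on n S f"
  shows "ck_on n S g"
  using assms(2,3)
proof (induction n arbitrary: f g)
  case 0
  then show ?case using continuous_on_cong[OF refl, of S f g] by simp
next
  case (Suc n)
  have d: "f differentiable at x" if "x \<in> S" for x using Suc.prems(2) that by simp
  have e: "frechet_derivative f (at x) = frechet_derivative g (at x)" if "x \<in> S" for x
    using frechet_derivative_transform_within_open[OF d[OF that] assms(1) that] Suc.prems(1) by blast
  have "g differentiable at x" if "x \<in> S" for x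
    using d[OF that] has_derivative_transform_within_open[OF _ assms(1) that] Suc.prems(1)
    unfolding differentiable_def by blast
  moreover have "ck_on n S (\<lambda>x. frechet_derivative g (at x) v)" for v
    by (rule Suc.IH[of "\<lambda>x. frechet_derivative f (at x) v"]) (use e Suc.prems(2) in auto)
  ultimately show ?case by simp
qed

lemma ck_on_SucI:
  assumes "open S" "\<And>x. x \<in> S \<Longrightarrow> (f has_derivative f' x) (at x)" "\<And>v. ck_on n S (\<lambda>x. f' x v)"
  shows "ck_on (Suc n) S f"
proof -
  have "ck_on n S (\<lambda>x. frechet_derivative f (at x) v)" for v
    by (rule ck_on_cong[OF assms(1) _ assms(3)[of v]]) (metis assms(2) frechet_derivative_at)
  then show ?thesis using assms(2) by (auto simp: differentiable_def)
qed

lemma ck_on_Suc_has_derivative: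
  "ck_on (Suc n) S f \<Longrightarrow> x \<in> S \<Longrightarrow> (f has_derivative frechet_derivative f (at x)) (at x)"
  by (simp add: frechet_derivative_works[symmetric])

lemma ck_on_SucD: "ck_on (Suc n) S f \<Longrightarrow> ck_on n S f"
proof (induction n arbitrary: f)
  case 0
  then show ?case
    by (auto intro!: continuous_at_imp_continuous_on differentiable_imp_continuous_within)
next
  case (Suc n)
  then show ?case unfolding ck_on.simps by blast
qed

lemma ck_on_const: "open S \<Longrightarrow> ck_on n S (\<lambda>x. c)"
  by (induction n arbitrary: c) (simp, rule ck_on_SucI[where f' = "\<lambda>_ _. 0"], auto)

lemma ck_on_add:
  assumes "open S" "ck_on n S f" "ck_on n S g" shows "ck_on n S (\<lambda>x. f x + g x)"
  using assms(2,3)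
proof (induction n arbitrary: f g)
  case 0 then show ?case by (simp add: continuous_on_add)
next
  case (Suc n)
  show ?case
  proof (rule ck_on_SucI[OF assms(1)])
    show "((\<lambda>x. f x + g x) has_derivative
        (\<lambda>v. frechet_derivative f (at x) v + frechet_derivative g (at x) v)) (at x)" if "x \<in> S" for x
      using Suc.prems that by (intro has_derivative_add ck_on_Suc_has_derivative)
  qed (use Suc in auto)
qed

lemma ck_on_linear:
  assumes L: "bounded_linear L" and "open S" "ck_on n S f" shows "ck_on n S (\<lambda>x. L (f x))"
  using assms(3)
proof (induction n arbitrary: f)
  case 0 then show ?case using L by (simp add: bounded_linear.continuous_on)
next
  case (Suc n)
  show ?case
  proof (rule ck_on_SucI[OF assms(2)])
    show "((\<lambda>x. L (f x)) has_derivative (\<lambda>v. L (frechet_derivative f (at x) v))) (at x)" if "x \<in> S" for x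
      using Suc.prems that by (intro bounded_linear.has_derivative[OF L] ck_on_Suc_has_derivative)
  qed (use Suc in auto)
qed

lemma ck_on_mult:
  fixes f g :: "'a::real_normed_vector \<Rightarrow> real"
  assumes "open S" "ck_on n S f" "ck_on n S g" shows "ck_on n S (\<lambda>x. f x * g x)"
  using assms(2,3)
proof (induction n arbitrary: f g)
  case 0 then show ?case by (simp add: continuous_on_mult)
next
  case (Suc n)
  show ?case
  proof (rule ck_on_SucI[OF assms(1)])
    show "((\<lambda>x. f x * g x) has_derivative
        (\<lambda>v. f x * frechet_derivative g (at x) v + frechet_derivative f (at x) v * g x)) (at x)"
      if "x \<in> S" for x
      using Suc.prems that by (intro has_derivative_mult ck_on_Suc_has_derivative)
    fix v
    show "ck_on n S (\<lambda>x. f x * frechet_derivative g (at x) v + frechet_derivative f (at x) v * g x)"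
      using Suc.prems by (intro ck_on_add[OF assms(1)] Suc.IH) (auto intro: ck_on_SucD simp del: ck_on.simps simp: ck_on.simps(2))
  qed
qed

lemma ck_on_inverse:
  fixes f :: "'a::real_normed_vector \<Rightarrow> real"
  assumes "open S" "ck_on n S f" "\<And>x. x \<in> S \<Longrightarrow> f x \<noteq> 0" shows "ck_on n S (\<lambda>x. inverse (f x))"
  using assms(2)
proof (induction n)
  case 0 then show ?case using assms(3) by (simp add: continuous_on_inverse)
next
  case (Suc n)
  have i: "ck_on n S (\<lambda>x. inverse (f x))" using Suc ck_on_SucD by blast
  show ?case
  proof (rule ck_on_SucI[OF assms(1)])
    show "((\<lambda>x. inverse (f x)) has_derivative
        (\<lambda>v. - (inverse (f x) * frechet_derivative f (at x) v * inverse (f x)))) (at x)" if "x \<in> S" for x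
      using Suc.prems that assms(3) by (intro Deriv.has_derivative_inverse ck_on_Suc_has_derivative)
    fix v
    have "ck_on n S (\<lambda>x. (inverse (f x) * frechet_derivative f (at x) v * inverse (f x)))"
      using Suc.prems by (intro ck_on_mult[OF assms(1)] i) auto
    from ck_on_linear[OF bounded_linear_minus[OF bounded_linear_ident] assms(1) this]
    show "ck_on n S (\<lambda>x. - (inverse (f x) * frechet_derivative f (at x) v * inverse (f x)))" .
  qed
qed

lemma ck_on_sum:
  assumes "open S" "\<And>i. i \<in> I \<Longrightarrow> ck_on n S (f i)" shows "ck_on n S (\<lambda>x. \<Sum>i\<in>I. f i x)"
  using assms(2) by (induction I rule: infinite_finite_induct) (auto intro: ck_on_const ck_on_add assms(1))

lemma ck_on_prod:
  fixes f :: "'i \<Rightarrow> 'a::real_normed_vector \<Rightarrow> real"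
  assumes "open S" "\<And>i. i \<in> I \<Longrightarrow> ck_on n S (f i)" shows "ck_on n S (\<lambda>x. \<Prod>i\<in>I. f i x)"
  using assms(2) by (induction I rule: infinite_finite_induct) (auto intro: ck_on_const ck_on_mult assms(1))

lemma ck_on_component:
  fixes f :: "'a::real_normed_vector \<Rightarrow> 'b::real_normed_vector ^ 'n"
  assumes "open S" "ck_on n S f" shows "ck_on n S (\<lambda>x. f x $ i)"
  by (rule ck_on_linear[OF bounded_linear_vec_nth assms])

lemma ck_on_vecI:
  fixes f :: "'a::real_normed_vector \<Rightarrow> real ^ 'n"
  assumes "open S" "\<And>i. ck_on n S (\<lambda>x. f x $ i)" shows "ck_on n S f"
proof (rule ck_on_cong[OF assms(1)])
  show "(\<Sum>i\<in>UNIV. (f x $ i) *\<^sub>R axis i 1) = f x" for x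
    using basis_expansion[of "f x"] by (simp add: scalar_mult_eq_scaleR)
  show "ck_on n S (\<lambda>x. \<Sum>i\<in>UNIV. (f x $ i) *\<^sub>R axis i 1)"
    by (intro ck_on_sum ck_on_linear[OF bounded_linear_scaleR_left assms(1)] assms)
qed

lemma ck_on_det:
  fixes F :: "'a::real_normed_vector \<Rightarrow> real ^ 'n ^ 'n"
  assumes "open S" "\<And>i j. ck_on n S (\<lambda>x. F x $ i $ j)" shows "ck_on n S (\<lambda>x. det (F x))"
  unfolding det_def by (intro ck_on_sum ck_on_mult ck_on_const ck_on_prod assms)

lemma matrix_inv_inverse:
  assumes "invertible (B :: real ^ 'n ^ 'n)"
  shows "matrix_inv B ** B = mat 1" "B ** matrix_inv B = mat 1"
  using someI_ex[OF assms[unfolded invertible_def]] unfolding matrix_inv_def by blast+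

text \<open>By Cramer's rule the entries of the inverse matrix are rational functions of the entries.\<close>

lemma ck_on_matrix_inv:
  fixes F :: "'a::real_normed_vector \<Rightarrow> real ^ 'n ^ 'n"
  assumes S: "open S" and F: "\<And>i j. ck_on n S (\<lambda>x. F x $ i $ j)"
    and inv: "\<And>x. x \<in> S \<Longrightarrow> invertible (F x)"
  shows "ck_on n S (\<lambda>x. matrix_inv (F x) $ i $ j)"
proof (rule ck_on_cong[OF S])
  let ?R = "\<lambda>x. (\<chi> a b. if b = i then axis j 1 $ a else F x $ a $ b) :: real ^ 'n ^ 'n"
  show "det (?R x) * inverse (det (F x)) = matrix_inv (F x) $ i $ j" if "x \<in> S" for x
  proof -
    have "F x *v (matrix_inv (F x) *v axis j 1) = axis j 1"
      by (simp add: matrix_vector_mul_assoc matrix_inv_inverse[OF inv[OF that]])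
    moreover have "det (F x) \<noteq> 0" using inv[OF that] by (simp add: invertible_det_nz)
    ultimately have "matrix_inv (F x) *v axis j 1 =
        (\<chi> k. det (\<chi> a b. if b = k then axis j 1 $ a else F x $ a $ b) / det (F x))"
      using cramer by blast
    then have "(matrix_inv (F x) *v axis j 1) $ i = det (?R x) / det (F x)" by simp
    then show ?thesis by (simp add: matrix_vector_mul_component inner_axis divide_inverse)
  qed
  have "ck_on n S (\<lambda>x. ?R x $ a $ b)" for a b
    using F S by (cases "b = i") (auto intro: ck_on_const)
  then show "ck_on n S (\<lambda>x. det (?R x) * inverse (det (F x)))"
    by (intro ck_on_mult ck_on_inverse ck_on_det S F) (use inv invertible_det_nz in blast)+
qed

section \<open>Symmetry of second derivatives\<close>

text \<open>The mean value theorem, applied twice to the second difference of \<open>f\<close> along \<open>u\<close> and \<open>v\<close>, expresses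
  this difference by either mixed derivative.\<close>

lemma second_derivative_symmetric_real:
  fixes f :: "'a::real_normed_vector \<Rightarrow> real"
  assumes "open S" "x \<in> S" and f: "ck_on 2 S f"
  shows "frechet_derivative (\<lambda>y. frechet_derivative f (at y) u) (at x) v =
         frechet_derivative (\<lambda>y. frechet_derivative f (at y) v) (at x) u"
proof -
  define D where "D u y = frechet_derivative f (at y) u" for u y
  define D2 where "D2 u v y = frechet_derivative (D u) (at y) v" for u v y
  have f2: "ck_on (Suc (Suc 0)) S f" using f by (simp only: numeral_2_eq_2)
  have Df: "(f has_derivative (\<lambda>v. D v y)) (at y)" if "y \<in> S" for y
    unfolding D_def using ck_on_Suc_has_derivative[OF f2 that] .
  have D1: "ck_on (Suc 0) S (D u)" for u using f2 unfolding D_def by (metis ck_on.simps(2))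
  have DD: "(D u has_derivative (\<lambda>v. D2 u v y)) (at y)" if "y \<in> S" for y u
    unfolding D2_def using ck_on_Suc_has_derivative[OF D1 that] .
  have cont: "continuous_on S (D2 u v)" for u v
    using D1[of u] unfolding D2_def by (metis ck_on.simps)
  \<comment> \<open>The left-hand side is symmetric in \<open>u\<close> and \<open>v\<close> up to the order of its terms.\<close>
  have diff: "\<exists>a\<in>{0..s}. \<exists>b\<in>{0..s}. f (x + s *\<^sub>R u + s *\<^sub>R v) - f (x + s *\<^sub>R u) - f (x + s *\<^sub>R v) + f x
       = s * s * D2 u v (x + a *\<^sub>R u + b *\<^sub>R v)"
    if s: "s > 0" and B: "\<And>a b. a \<in> {0..s} \<Longrightarrow> b \<in> {0..s} \<Longrightarrow> x + a *\<^sub>R u + b *\<^sub>R v \<in> S" for s u v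
  proof -
    define h where "h a = f (x + a *\<^sub>R u + s *\<^sub>R v) - f (x + a *\<^sub>R u)" for a
    have "(h has_derivative (\<lambda>r. r * (D u (x + a *\<^sub>R u + s *\<^sub>R v) - D u (x + a *\<^sub>R u)))) (at a within {0..s})"
      if a: "a \<in> {0..s}" for a
    proof -
      have e: "((\<lambda>a. f (x + a *\<^sub>R u + w)) has_derivative (\<lambda>r. r * D u (x + a *\<^sub>R u + w))) (at a within {0..s})"
        if "x + a *\<^sub>R u + w \<in> S" for w
      proof -
        have "((\<lambda>a. x + a *\<^sub>R u + w) has_derivative (\<lambda>r. r *\<^sub>R u)) (at a within {0..s})"
          by (auto intro!: derivative_eq_intros)
        from has_derivative_compose[OF this Df[OF that]]
        have "((\<lambda>a. f (x + a *\<^sub>R u + w)) has_derivative (\<lambda>r. D (r *\<^sub>R u) (x + a *\<^sub>R u + w))) (at a within {0..s})" .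
        moreover have "D (r *\<^sub>R u) (x + a *\<^sub>R u + w) = r * D u (x + a *\<^sub>R u + w)" for r
          using linear_scale[OF has_derivative_linear[OF Df[OF that]]] by simp
        ultimately show ?thesis by simp
      qed
      show ?thesis unfolding h_def
        using has_derivative_diff[OF e[OF B[OF a, of s]] e[of 0]] B[OF a, of 0] s
        by (simp add: algebra_simps)
    qed
    then obtain a where a: "a \<in> {0..s}"
      and ha: "h s - h 0 = s * (D u (x + a *\<^sub>R u + s *\<^sub>R v) - D u (x + a *\<^sub>R u))"
      using mvt_very_simple[of 0 s h "\<lambda>a r. r * (D u (x + a *\<^sub>R u + s *\<^sub>R v) - D u (x + a *\<^sub>R u))"] s
      by auto
    have "((\<lambda>b. D u (x + a *\<^sub>R u + b *\<^sub>R v)) has_derivative (\<lambda>r. r * D2 u v (x + a *\<^sub>R u + b *\<^sub>R v)))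
        (at b within {0..s})" if b: "b \<in> {0..s}" for b
    proof -
      have "((\<lambda>b. x + a *\<^sub>R u + b *\<^sub>R v) has_derivative (\<lambda>r. r *\<^sub>R v)) (at b within {0..s})"
        by (auto intro!: derivative_eq_intros)
      from has_derivative_compose[OF this DD[OF B[OF a b]]]
      have "((\<lambda>b. D u (x + a *\<^sub>R u + b *\<^sub>R v)) has_derivative (\<lambda>r. D2 u (r *\<^sub>R v) (x + a *\<^sub>R u + b *\<^sub>R v)))
          (at b within {0..s})" .
      moreover have "D2 u (r *\<^sub>R v) (x + a *\<^sub>R u + b *\<^sub>R v) = r * D2 u v (x + a *\<^sub>R u + b *\<^sub>R v)" for r
        using linear_scale[OF has_derivative_linear[OF DD[OF B[OF a b]]]] by simp
      ultimately show ?thesis by simp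
    qed
    then obtain b where b: "b \<in> {0..s}"
      and hb: "D u (x + a *\<^sub>R u + s *\<^sub>R v) - D u (x + a *\<^sub>R u) = s * D2 u v (x + a *\<^sub>R u + b *\<^sub>R v)"
      using mvt_very_simple[of 0 s "\<lambda>b. D u (x + a *\<^sub>R u + b *\<^sub>R v)" "\<lambda>b r. r * D2 u v (x + a *\<^sub>R u + b *\<^sub>R v)"] s
      by auto
    have "f (x + s *\<^sub>R u + s *\<^sub>R v) - f (x + s *\<^sub>R u) - f (x + s *\<^sub>R v) + f x = h s - h 0"
      by (simp add: h_def)
    then show ?thesis using a b ha hb by (metis mult.assoc)
  qed
  have "D2 u v x = D2 v u x"
  proof (rule ccontr)
    define e where "e = \<bar>D2 u v x - D2 v u x\<bar> / 2"
    assume "D2 u v x \<noteq> D2 v u x"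
    then have e: "e > 0" by (simp add: e_def)
    have near: "\<exists>d>0. \<forall>y. dist y x < d \<longrightarrow> y \<in> S \<and> \<bar>D2 u v y - D2 u v x\<bar> < e" for u v
    proof -
      have "isCont (D2 u v) x" using cont assms(1,2) continuous_on_eq_continuous_at by blast
      then obtain d1 where "d1 > 0" "\<forall>y. dist y x < d1 \<longrightarrow> dist (D2 u v y) (D2 u v x) < e"
        using e unfolding continuous_at_eps_delta by blast
      moreover obtain d2 where "d2 > 0" "\<forall>y. dist y x < d2 \<longrightarrow> y \<in> S"
        using assms(1,2) open_dist by metis
      ultimately show ?thesis by (intro exI[of _ "min d1 d2"]) (auto simp: dist_real_def)
    qed
    obtain d1 d2 where d: "d1 > 0" "d2 > 0"
      and n1: "\<And>y. dist y x < d1 \<Longrightarrow> y \<in> S \<and> \<bar>D2 u v y - D2 u v x\<bar> < e"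
      and n2: "\<And>y. dist y x < d2 \<Longrightarrow> y \<in> S \<and> \<bar>D2 v u y - D2 v u x\<bar> < e"
      using near[of u v] near[of v u] by blast
    define s where "s = min d1 d2 / (norm u + norm v + 1)"
    have pos: "norm u + norm v + 1 > 0" by (simp add: add_nonneg_pos)
    have s: "s > 0" using d pos by (simp add: s_def)
    have close: "dist (x + a *\<^sub>R u + b *\<^sub>R v) x < min d1 d2" if "a \<in> {0..s}" "b \<in> {0..s}" for a b
    proof -
      have "dist (x + a *\<^sub>R u + b *\<^sub>R v) x \<le> a * norm u + b * norm v"
        using norm_triangle_ineq[of "a *\<^sub>R u" "b *\<^sub>R v"] that by (simp add: dist_norm)
      also have "\<dots> \<le> s * norm u + s * norm v"
        using that by (intro add_mono mult_right_mono) auto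
      also have "\<dots> < s * (norm u + norm v + 1)" using s by (simp add: algebra_simps)
      also have "\<dots> = min d1 d2" using pos by (simp add: s_def)
      finally show ?thesis .
    qed
    obtain a b where ab: "a \<in> {0..s}" "b \<in> {0..s}" and
      1: "f (x + s *\<^sub>R u + s *\<^sub>R v) - f (x + s *\<^sub>R u) - f (x + s *\<^sub>R v) + f x = s * s * D2 u v (x + a *\<^sub>R u + b *\<^sub>R v)"
      using diff[OF s, of u v] close n1 by force
    have swap: "x + p *\<^sub>R v + q *\<^sub>R u = x + q *\<^sub>R u + p *\<^sub>R v" for p q by simp
    obtain a' b' where ab': "a' \<in> {0..s}" "b' \<in> {0..s}" and
      2: "f (x + s *\<^sub>R v + s *\<^sub>R u) - f (x + s *\<^sub>R v) - f (x + s *\<^sub>R u) + f x = s * s * D2 v u (x + a' *\<^sub>R v + b' *\<^sub>R u)"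
      using diff[OF s, of v u] close n1 unfolding swap by force
    have "s * s * D2 u v (x + a *\<^sub>R u + b *\<^sub>R v) = s * s * D2 v u (x + b' *\<^sub>R u + a' *\<^sub>R v)"
      using 1 2 unfolding swap by linarith
    then have "D2 u v (x + a *\<^sub>R u + b *\<^sub>R v) = D2 v u (x + b' *\<^sub>R u + a' *\<^sub>R v)" using s by simp
    moreover have "\<bar>D2 u v (x + a *\<^sub>R u + b *\<^sub>R v) - D2 u v x\<bar> < e" using n1 close ab by force
    moreover have "\<bar>D2 v u (x + b' *\<^sub>R u + a' *\<^sub>R v) - D2 v u x\<bar> < e" using n2 close ab' by force
    ultimately show False unfolding e_def by (auto simp: abs_if split: if_splits)
  qed
  then show ?thesis unfolding D2_def D_def[abs_def] .
qed

lemma second_derivative_symmetric: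
  fixes f :: "'a::real_normed_vector \<Rightarrow> real ^ 'n"
  assumes "open S" "x \<in> S" and f: "ck_on 2 S f"
  shows "frechet_derivative (\<lambda>y. frechet_derivative f (at y) u) (at x) v =
         frechet_derivative (\<lambda>y. frechet_derivative f (at y) v) (at x) u"
proof -
  have f2: "ck_on (Suc (Suc 0)) S f" using f by (simp only: numeral_2_eq_2)
  have comp: "frechet_derivative (\<lambda>y. frechet_derivative f (at y) u) (at x) v $ k =
      frechet_derivative (\<lambda>y. frechet_derivative (\<lambda>z. f z $ k) (at y) u) (at x) v" for u v k
  proof -
    have 1: "frechet_derivative (\<lambda>z. f z $ k) (at y) u = frechet_derivative f (at y) u $ k" if "y \<in> S" for y
      using frechet_derivative_at[OF bounded_linear.has_derivative[OF bounded_linear_vec_nth ck_on_Suc_has_derivative[OF f2 that]], of k]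
      by (metis)
    have "ck_on (Suc 0) S (\<lambda>y. frechet_derivative f (at y) u)" using f2 by (metis ck_on.simps(2))
    from bounded_linear.has_derivative[OF bounded_linear_vec_nth ck_on_Suc_has_derivative[OF this assms(2)], of k]
    have "((\<lambda>y. frechet_derivative (\<lambda>z. f z $ k) (at y) u) has_derivative
        (\<lambda>v. frechet_derivative (\<lambda>y. frechet_derivative f (at y) u) (at x) v $ k)) (at x)"
      by (rule has_derivative_transform_within_open[OF _ assms(1,2)]) (use 1 in auto)
    from frechet_derivative_at[OF this] show ?thesis by metis
  qed
  have "ck_on 2 S (\<lambda>z. f z $ k)" for k using ck_on_component[OF assms(1) f] .
  from second_derivative_symmetric_real[OF assms(1,2) this] show ?thesis
    unfolding vec_eq_iff comp by blast
qed

section \<open>Linear transport equations\<close>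

text \<open>The Lipschitz constant \<open>1/2\<close> on the unit time interval makes the integral operator a contraction
  in the supremum norm, so that Banach's fixed point theorem yields a solution on the whole interval
  at once. The transport equation along a sufficiently short coordinate segment has this form.\<close>

lemma contraction_ode_solution:
  fixes F :: "real \<Rightarrow> 'b::euclidean_space \<Rightarrow> 'b"
  assumes cont: "\<And>x. continuous_on {0..1} x \<Longrightarrow> continuous_on {0..1} (\<lambda>t. F t (x t))"
    and lip: "\<And>t v w. t \<in> {0..1} \<Longrightarrow> norm (F t v - F t w) \<le> 1/2 * norm (v - w)"
  obtains x where "x 0 = v0"
    "\<And>t. t \<in> {0..1} \<Longrightarrow> (x has_vector_derivative F t (x t)) (at t within {0..1})"
proof -
  define I where "I x t = v0 + integral {0..t} (\<lambda>s. F s (x s))" for x t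
  have cF: "continuous_on {0..1} (\<lambda>s. F s (x s))" for x :: "real \<Rightarrow>\<^sub>C 'b"
    by (rule cont) simp
  have iF: "(\<lambda>s. F s (x s)) integrable_on {0..t}" if "t \<in> {0..1}" for x :: "real \<Rightarrow>\<^sub>C 'b" and t
    using that by (intro integrable_continuous_real continuous_on_subset[OF cF]) auto
  have "\<exists>h :: real \<Rightarrow>\<^sub>C 'b. \<forall>t. h t = I x (clamp 0 1 t)" for x :: "real \<Rightarrow>\<^sub>C 'b"
  proof -
    have "continuous_on (cbox 0 1) (I x)"
      unfolding I_def cbox_interval
      by (intro continuous_intros indefinite_integral_continuous_1 integrable_continuous_real cF)
    then show ?thesis by (rule continuous_on_cbox_bcontfunE) metis
  qed
  then obtain \<Phi> :: "(real \<Rightarrow>\<^sub>C 'b) \<Rightarrow> (real \<Rightarrow>\<^sub>C 'b)" where \<Phi>: "\<And>x t. \<Phi> x t = I x (clamp 0 1 t)" by metis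
  have "dist (\<Phi> x) (\<Phi> y) \<le> 1/2 * dist x y" for x y
  proof (rule dist_bound)
    fix s :: real
    define t where "t = clamp 0 1 s"
    have t: "t \<in> {0..1}" unfolding t_def using clamp_in_interval[of 0 1 s] by simp
    have "dist (\<Phi> x s) (\<Phi> y s) = norm (integral {0..t} (\<lambda>s. F s (x s) - F s (y s)))"
      unfolding \<Phi> I_def t_def[symmetric] dist_norm by (simp add: integral_diff[OF iF[OF t] iF[OF t]])
    also have "\<dots> \<le> (1/2 * dist x y) * (t - 0)"
    proof (rule integral_bound)
      show "continuous_on {0..t} (\<lambda>s. F s (x s) - F s (y s))"
        using t by (intro continuous_on_diff continuous_on_subset[OF cF]) auto
      show "norm (F r (x r) - F r (y r)) \<le> 1/2 * dist x y" if "r \<in> {0..t}" for r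
        using lip[of r "x r" "y r"] that t dist_bounded[of x r y] by (auto simp: dist_norm)
    qed (use t in auto)
    also have "\<dots> \<le> (1/2 * dist x y) * 1" using t by (intro mult_left_mono) auto
    finally show "dist (\<Phi> x s) (\<Phi> y s) \<le> 1/2 * dist x y" by simp
  qed
  then obtain x where x: "\<Phi> x = x" using banach_fix_type[of "1/2" \<Phi>] by auto
  have xI: "x t = I x t" if "t \<in> {0..1}" for t
    using \<Phi>[of x t] that x by (metis cbox_interval clamp_cancel_cbox)
  show thesis
  proof
    show "x 0 = v0" using xI[of 0] by (simp add: I_def)
    show "(x has_vector_derivative F t (x t)) (at t within {0..1})" if t: "t \<in> {0..1}" for t
    proof (rule has_vector_derivative_transform[OF t])
      show "(I x has_vector_derivative F t (x t)) (at t within {0..1})"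
        unfolding I_def
        by (rule derivative_eq_intros refl integral_has_vector_derivative cF t | simp)+
    qed (use xI in auto)
  qed
qed

text \<open>The coefficients are an argument separate from the base point, so that connections at two
  different points can be subtracted and estimated by the size of their coefficients.\<close>

definition conn :: "('n \<Rightarrow> 'n \<Rightarrow> 'n \<Rightarrow> real) \<Rightarrow> real ^ 'n \<Rightarrow> real ^ 'n \<Rightarrow> real ^ 'n" where
  "conn c u v = (\<chi> k. \<Sum>i\<in>UNIV. \<Sum>j\<in>UNIV. c k i j * u $ i * v $ j)"

definition coeff_norm :: "('n::finite \<Rightarrow> 'n \<Rightarrow> 'n \<Rightarrow> real) \<Rightarrow> real" where
  "coeff_norm c = (\<Sum>k\<in>UNIV. \<Sum>i\<in>UNIV. \<Sum>j\<in>UNIV. \<bar>c k i j\<bar>)"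

lemma christoffel_map_conn: "christoffel_map A g c x = conn (christoffel A g c x)"
  by (intro ext) (simp add: christoffel_map_def conn_def)

lemma coeff_norm_nonneg: "0 \<le> coeff_norm c"
  unfolding coeff_norm_def by (intro sum_nonneg) auto

lemma norm_conn_le: "norm (conn c u v) \<le> coeff_norm c * norm u * norm v"
proof -
  have "norm (conn c u v) \<le> (\<Sum>k\<in>UNIV. \<bar>conn c u v $ k\<bar>)" by (rule norm_le_l1_cart)
  also have "\<dots> \<le> (\<Sum>k\<in>UNIV. \<Sum>i\<in>UNIV. \<Sum>j\<in>UNIV. \<bar>c k i j\<bar> * norm u * norm v)"
  proof (rule sum_mono)
    fix k
    have "\<bar>conn c u v $ k\<bar> \<le> (\<Sum>i\<in>UNIV. \<bar>\<Sum>j\<in>UNIV. c k i j * u $ i * v $ j\<bar>)"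
      unfolding conn_def vec_lambda_beta by (rule sum_abs)
    also have "\<dots> \<le> (\<Sum>i\<in>UNIV. \<Sum>j\<in>UNIV. \<bar>c k i j * u $ i * v $ j\<bar>)"
      by (intro sum_mono sum_abs)
    also have "\<dots> \<le> (\<Sum>i\<in>UNIV. \<Sum>j\<in>UNIV. \<bar>c k i j\<bar> * norm u * norm v)"
      unfolding abs_mult by (intro sum_mono mult_mono component_le_norm_cart) auto
    finally show "\<bar>conn c u v $ k\<bar> \<le> \<dots>" .
  qed
  also have "\<dots> = coeff_norm c * norm u * norm v"
    by (simp add: coeff_norm_def sum_distrib_right)
  finally show ?thesis .
qed

lemma linear_conn_left: "linear (\<lambda>u. conn c u v)"
  by (rule linearI)
    (simp_all add: conn_def vec_eq_iff algebra_simps sum.distrib sum_distrib_left)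

lemma linear_conn_right: "linear (conn c u)"
  by (rule linearI)
    (simp_all add: conn_def vec_eq_iff algebra_simps sum.distrib sum_distrib_left)

lemma conn_diff_coeff: "conn c u v - conn c' u v = conn (\<lambda>k i j. c k i j - c' k i j) u v"
  by (simp add: conn_def vec_eq_iff sum_subtractf algebra_simps)

lemma conn_symmetric: "(\<And>k i j. c k i j = c k j i) \<Longrightarrow> conn c u v = conn c v u"
  unfolding conn_def vec_eq_iff vec_lambda_beta
  by (intro allI, subst sum.swap) (simp add: algebra_simps)

lemma continuous_on_conn:
  assumes "\<And>k i j. continuous_on S (\<lambda>x. c x k i j)" "continuous_on S u" "continuous_on S v"
  shows "continuous_on S (\<lambda>x. conn (c x) (u x) (v x))"
  unfolding conn_def by (intro continuous_intros assms)

lemma continuous_on_coeff_norm: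
  assumes "\<And>k i j. continuous_on S (\<lambda>x. c x k i j)"
  shows "continuous_on S (\<lambda>x. coeff_norm (c x))"
  unfolding coeff_norm_def by (intro continuous_intros assms)

lemma ck_on_conn:
  assumes "open S" "\<And>k i j. ck_on n S (\<lambda>x. c x k i j)" "ck_on n S u" "ck_on n S v"
  shows "ck_on n S (\<lambda>x. conn (c x) (u x) (v x))"
proof (rule ck_on_vecI[OF assms(1)])
  show "ck_on n S (\<lambda>x. conn (c x) (u x) (v x) $ k)" for k
    unfolding conn_def vec_lambda_beta
    by (intro ck_on_sum ck_on_mult ck_on_component assms)
qed

text \<open>A field that is parallel along the straight rays from \<open>x\<close> is continuous at \<open>x\<close>, because on
  a short ray its values are bounded by twice its value at \<open>x\<close>; then the equation along the rays
  gives the total derivative at \<open>x\<close>.\<close>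

lemma has_derivative_of_parallel_rays:
  fixes f :: "real ^ 'n \<Rightarrow> real ^ 'n"
  assumes "open S" "x \<in> S" and c: "\<And>k i j. continuous_on S (\<lambda>y. c y k i j)"
    and ball: "r > 0" "ball x r \<subseteq> S"
    and ode: "\<And>h t. norm h < r \<Longrightarrow> t \<in> {0..1} \<Longrightarrow> ((\<lambda>t. f (x + t *\<^sub>R h)) has_vector_derivative
        - conn (c (x + t *\<^sub>R h)) h (f (x + t *\<^sub>R h))) (at t within {0..1})"
  shows "(f has_derivative (\<lambda>h. - conn (c x) h (f x))) (at x)"
proof -
  define K where "K = coeff_norm (c x) + 1"
  have K: "K > 0" unfolding K_def by (simp add: coeff_norm_nonneg add_nonneg_pos)
  have near: "\<exists>d>0. \<forall>y. dist y x < d \<longrightarrow> y \<in> S \<and> m y < e"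
    if m: "continuous_on S m" "m x < e" for m :: "real ^ 'n \<Rightarrow> real" and e
  proof -
    have "isCont m x" using m assms(1,2) continuous_on_eq_continuous_at by blast
    then obtain d where "d > 0" "\<forall>y. dist y x < d \<longrightarrow> dist (m y) (m x) < e - m x"
      using m(2) unfolding continuous_at_eps_delta by (metis diff_gt_0_iff_gt)
    moreover obtain d' where "d' > 0" "\<forall>y. dist y x < d' \<longrightarrow> y \<in> S"
      using assms(1,2) open_dist by metis
    ultimately show ?thesis by (intro exI[of _ "min d d'"]) (auto simp: dist_real_def)
  qed
  obtain d0 where d0: "d0 > 0" and K0: "\<And>y. dist y x < d0 \<Longrightarrow> coeff_norm (c y) < K"
    using near[OF continuous_on_coeff_norm[of S c], OF c, of K] by (auto simp: K_def)
  have main: "norm (f (x + h) - f x - - conn (c x) h (f x)) \<le> (2 * e + 2 * K * K * norm h) * norm (f x) * norm h"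
    if h: "norm h < r" "norm h < d0" "K * norm h \<le> 1/2"
      and e: "\<And>t. t \<in> {0..1} \<Longrightarrow> coeff_norm (\<lambda>k i j. c (x + t *\<^sub>R h) k i j - c x k i j) \<le> e" for h e
  proof -
    define \<phi> where "\<phi> t = f (x + t *\<^sub>R h)" for t
    define \<psi> where "\<psi> t = - conn (c (x + t *\<^sub>R h)) h (\<phi> t)" for t
    have d\<phi>: "(\<phi> has_vector_derivative \<psi> t) (at t within {0..1})" if "t \<in> {0..1}" for t
      using ode[OF h(1) that] unfolding \<phi>_def \<psi>_def .
    have "continuous_on {0..1} (\<lambda>t. norm (\<phi> t))"
      using d\<phi> by (intro continuous_on_norm continuous_on_vector_derivative) blast
    then obtain s where s: "s \<in> {0..1}" "\<And>t. t \<in> {0..1} \<Longrightarrow> norm (\<phi> t) \<le> norm (\<phi> s)"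
      using continuous_attains_sup[of "{0..1}" "\<lambda>t. norm (\<phi> t)"] by auto
    have close: "dist (x + t *\<^sub>R h) x < d0" if "t \<in> {0..1}" for t
      using mult_right_mono[of t 1 "norm h"] that h by (auto simp: dist_norm)
    have b\<psi>: "norm (\<psi> t) \<le> K * norm h * norm (\<phi> s)" if "t \<in> {0..1}" for t
    proof -
      have "norm (\<psi> t) \<le> coeff_norm (c (x + t *\<^sub>R h)) * norm h * norm (\<phi> t)"
        unfolding \<psi>_def norm_minus_cancel by (rule norm_conn_le)
      also have "\<dots> \<le> K * norm h * norm (\<phi> s)"
        using K0[OF close[OF that]] s(2)[OF that] K by (intro mult_mono) auto
      finally show ?thesis .
    qed
    have inc: "norm (\<phi> t - \<phi> 0) \<le> K * norm h * norm (\<phi> s)" if t: "t \<in> {0..1}" for t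
    proof -
      have "norm (\<phi> t - \<phi> 0) \<le> K * norm h * norm (\<phi> s) * norm (t - 0)"
      proof (rule differentiable_bound[of "{0..1}" \<phi> "\<lambda>t s. s *\<^sub>R \<psi> t"])
        show "onorm (\<lambda>s. s *\<^sub>R \<psi> t) \<le> K * norm h * norm (\<phi> s)" if "t \<in> {0..1}" for t
          by (rule onorm_le) (use b\<psi>[OF that] in \<open>auto simp: mult.commute intro!: mult_left_mono\<close>)
      qed (use d\<phi> t in \<open>auto simp: has_vector_derivative_def\<close>)
      also have "\<dots> \<le> K * norm h * norm (\<phi> s) * 1" using t K by (intro mult_left_mono) auto
      finally show ?thesis by simp
    qed
    have "norm (\<phi> s) \<le> norm (\<phi> 0) + norm (\<phi> s - \<phi> 0)" by (metis norm_triangle_sub)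
    also have "\<dots> \<le> norm (\<phi> 0) + 1/2 * norm (\<phi> s)"
      using inc[OF s(1)] mult_right_mono[OF h(3), of "norm (\<phi> s)"] by simp
    finally have s2: "norm (\<phi> s) \<le> 2 * norm (f x)" by (simp add: \<phi>_def)
    let ?E = "(2 * e + 2 * K * K * norm h) * norm (f x) * norm h"
    have err: "norm (\<psi> t - \<psi> 0) \<le> ?E" if t: "t \<in> {0..1}" for t
    proof -
      have "\<psi> t - \<psi> 0 = - (conn (\<lambda>k i j. c (x + t *\<^sub>R h) k i j - c x k i j) h (\<phi> t)
          + conn (c x) h (\<phi> t - \<phi> 0))"
        unfolding conn_diff_coeff[symmetric] linear_diff[OF linear_conn_right]
        by (simp add: \<psi>_def)
      then have "norm (\<psi> t - \<psi> 0) \<le> norm (conn (\<lambda>k i j. c (x + t *\<^sub>R h) k i j - c x k i j) h (\<phi> t))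
          + norm (conn (c x) h (\<phi> t - \<phi> 0))"
        by (simp only: norm_minus_cancel norm_triangle_ineq)
      also have "\<dots> \<le> e * norm h * (2 * norm (f x)) + K * norm h * (K * norm h * (2 * norm (f x)))"
      proof (rule add_mono)
        have e0: "0 \<le> e" using e[OF t] coeff_norm_nonneg order_trans by blast
        show "norm (conn (\<lambda>k i j. c (x + t *\<^sub>R h) k i j - c x k i j) h (\<phi> t)) \<le> e * norm h * (2 * norm (f x))"
          by (rule order_trans[OF norm_conn_le])
            (use e[OF t] e0 s(2)[OF t] s2 in \<open>auto intro!: mult_mono\<close>)
        have "norm (\<phi> t - \<phi> 0) \<le> K * norm h * (2 * norm (f x))"
          by (rule order_trans[OF inc[OF t]]) (use s2 K in \<open>auto intro!: mult_left_mono\<close>)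
        then show "norm (conn (c x) h (\<phi> t - \<phi> 0)) \<le> K * norm h * (K * norm h * (2 * norm (f x)))"
          by (intro order_trans[OF norm_conn_le] mult_mono) (use K in \<open>auto simp: K_def\<close>)
      qed
      finally show ?thesis by (simp add: algebra_simps)
    qed
    have "norm ((\<phi> 1 - 1 *\<^sub>R \<psi> 0) - (\<phi> 0 - 0 *\<^sub>R \<psi> 0)) \<le> ?E * norm (1 - 0 :: real)"
    proof (rule differentiable_bound[of "{0..1}" "\<lambda>t. \<phi> t - t *\<^sub>R \<psi> 0" "\<lambda>t s. s *\<^sub>R (\<psi> t - \<psi> 0)"])
      show "((\<lambda>t. \<phi> t - t *\<^sub>R \<psi> 0) has_derivative (\<lambda>s. s *\<^sub>R (\<psi> t - \<psi> 0))) (at t within {0..1})"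
        if "t \<in> {0..1}" for t
        using d\<phi>[OF that] unfolding has_vector_derivative_def
        by (auto intro!: derivative_eq_intros simp: algebra_simps)
      show "onorm (\<lambda>s. s *\<^sub>R (\<psi> t - \<psi> 0)) \<le> ?E" if "t \<in> {0..1}" for t
        by (rule onorm_le) (use err[OF that] in \<open>auto simp: mult.commute intro!: mult_left_mono\<close>)
    qed auto
    then show ?thesis by (simp add: diff_add_eq \<phi>_def \<psi>_def)
  qed
  show ?thesis
    unfolding has_derivative_at_alt
  proof (intro conjI allI impI)
    show "bounded_linear (\<lambda>h. - conn (c x) h (f x))"
      by (intro bounded_linear_minus linear_conn_left[THEN linear_conv_bounded_linear[THEN iffD1]])
    fix \<epsilon> :: real assume \<epsilon>: "\<epsilon> > 0"
    define N where "N = norm (f x) + 1"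
    have N: "N > 0" "norm (f x) \<le> N" unfolding N_def by (simp_all add: add_nonneg_pos)
    define e where "e = \<epsilon> / (4 * N)"
    have e: "e > 0" using \<epsilon> N by (simp add: e_def)
    have "continuous_on S (\<lambda>y. coeff_norm (\<lambda>k i j. c y k i j - c x k i j))"
      by (intro continuous_on_coeff_norm continuous_intros c)
    from near[OF this, of e] e obtain d1 where d1: "d1 > 0"
      and c1: "\<And>y. dist y x < d1 \<Longrightarrow> coeff_norm (\<lambda>k i j. c y k i j - c x k i j) < e"
      by (auto simp: coeff_norm_def)
    define d where "d = Min {r, d0, d1, 1 / (2 * K), e / (K * K)}"
    have "d > 0" using ball d0 d1 K e by (simp add: d_def)
    moreover have "norm (f y - f x - - conn (c x) (y - x) (f x)) \<le> \<epsilon> * norm (y - x)"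
      if "norm (y - x) < d" for y
    proof -
      define h where "h = y - x"
      have h: "norm h < r" "norm h < d0" "norm h < d1" "norm h < 1 / (2 * K)" "norm h < e / (K * K)"
        using that by (simp_all add: h_def d_def)
      have 1: "coeff_norm (\<lambda>k i j. c (x + t *\<^sub>R h) k i j - c x k i j) \<le> e" if "t \<in> {0..1}" for t
        using c1[of "x + t *\<^sub>R h"] mult_right_mono[of t 1 "norm h"] that h by (auto simp: dist_norm)
      have "K * norm h \<le> 1/2" using h(4) K by (simp add: field_simps)
      from main[OF h(1,2) this 1]
      have "norm (f (x + h) - f x - - conn (c x) h (f x)) \<le> (2 * e + 2 * K * K * norm h) * norm (f x) * norm h" .
      also have "\<dots> \<le> (4 * e) * N * norm h"
      proof (intro mult_right_mono mult_mono)
        show "2 * e + 2 * K * K * norm h \<le> 4 * e" using h(5) K by (simp add: field_simps)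
      qed (use e N in auto)
      also have "\<dots> = \<epsilon> * norm h" using N by (simp add: e_def)
      finally show ?thesis by (simp add: h_def)
    qed
    ultimately show "\<exists>d>0. \<forall>y. norm (y - x) < d \<longrightarrow>
        norm (f y - f x - - conn (c x) (y - x) (f x)) \<le> \<epsilon> * norm (y - x)" by blast
  qed
qed

text \<open>The equation expresses the derivative of \<open>f\<close> through \<open>f\<close> itself, hence \<open>f\<close> is always once more
  differentiable than it is known to be.\<close>

lemma smooth_of_parallel:
  fixes f :: "real ^ 'n \<Rightarrow> real ^ 'n"
  assumes S: "open S" and c: "\<And>k i j n. ck_on n S (\<lambda>x. c x k i j)"
    and f: "\<And>x. x \<in> S \<Longrightarrow> (f has_derivative (\<lambda>h. - conn (c x) h (f x))) (at x)"
  shows "smooth_on S f"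
  unfolding smooth_on_def
proof
  fix n show "ck_on n S f"
  proof (induction n)
    case 0
    have "continuous_on S f"
      by (intro continuous_at_imp_continuous_on) (use f has_derivative_continuous in blast)
    then show ?case by simp
  next
    case (Suc n)
    show ?case
    proof (rule ck_on_SucI[OF S f])
      fix v
      have "ck_on n S (\<lambda>x. conn (c x) v (f x))"
        by (intro ck_on_conn S c ck_on_const Suc.IH)
      from ck_on_linear[OF bounded_linear_minus[OF bounded_linear_ident] S this]
      show "ck_on n S (\<lambda>x. - conn (c x) v (f x))" .
    qed
  qed
qed

section \<open>Linear algebra of the Lorentz group\<close>

lemma idx_less_iff: "idx (i :: 'n::{finite,linorder}) < idx j \<longleftrightarrow> i < j"
proof -
  have "idx i < idx j" if "i < j" for i j :: 'n
    unfolding idx_def by (rule psubset_card_mono) (use that in auto)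
  then show ?thesis by (metis linorder_neqE not_less_iff_gr_or_eq)
qed

lemma idx_inj: "idx (i :: 'n::{finite,linorder}) = idx j \<longleftrightarrow> i = j"
  by (metis idx_less_iff less_irrefl linorder_neqE)

lemma idx_bij: "bij_betw (idx :: 'n::{finite,linorder} \<Rightarrow> nat) UNIV {..<CARD('n)}"
proof -
  have "idx i < CARD('n)" for i :: 'n
    unfolding idx_def by (rule psubset_card_mono) auto
  moreover have "inj (idx :: 'n \<Rightarrow> nat)" by (simp add: inj_def idx_inj)
  ultimately have "range (idx :: 'n \<Rightarrow> nat) = {..<CARD('n)}"
    by (intro card_subset_eq) (auto simp: card_image)
  then show ?thesis using \<open>inj idx\<close> by (simp add: bij_betw_def)
qed

lemma idx_less_card: "idx (i :: 'n::{finite,linorder}) < CARD('n)"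
  using idx_bij[where 'n='n] bij_betwE by blast

definition lorentz_form :: "(real, 'n) vec \<Rightarrow> (real, 'n::{finite,linorder}) vec \<Rightarrow> real" where
  "lorentz_form u v = u \<bullet> (lorentz_matrix *v v)"

lemma lorentz_matrix_mult: "(lorentz_matrix *v v) $ i = (if idx i = 0 then - v $ i else v $ i)"
proof -
  have "(lorentz_matrix *v v) $ i = (\<Sum>j\<in>UNIV. if j = i then (if idx i = 0 then - v $ i else v $ i) else 0)"
    unfolding matrix_vector_mult_def vec_lambda_beta
    by (rule sum.cong) (auto simp: lorentz_matrix_def)
  then show ?thesis by simp
qed

lemma lorentz_form_sum: "lorentz_form u v = (\<Sum>i\<in>UNIV. (if idx i = 0 then -1 else 1) * u $ i * v $ i)"
  unfolding lorentz_form_def inner_vec_def lorentz_matrix_mult by (rule sum.cong) auto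

lemma lorentz_form_commute: "lorentz_form u v = lorentz_form v u"
  unfolding lorentz_form_sum by (rule sum.cong) auto

lemma lorentz_form_linear: "linear (lorentz_form u)"
  unfolding lorentz_form_def
  by (intro linearI) (simp_all add: matrix_vector_right_distrib inner_add_right linear_scale[OF matrix_vector_mul_linear])

lemma lorentz_form_scale: "lorentz_form (r *\<^sub>R u) (s *\<^sub>R v) = r * s * lorentz_form u v"
  using linear_scale[OF lorentz_form_linear, of "r *\<^sub>R u" s v]
    linear_scale[OF lorentz_form_linear, of v r u] by (simp add: lorentz_form_commute)

lemma lorentz_form_axis_left: "lorentz_form (axis i 1) v = (if idx i = 0 then - v $ i else v $ i)"
  unfolding lorentz_form_def by (simp add: inner_axis' lorentz_matrix_mult)

lemma lorentz_form_axis_axis: "lorentz_form (axis i 1) (axis j 1) = lorentz_matrix $ i $ j"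
  unfolding lorentz_form_axis_left by (auto simp: lorentz_matrix_def axis_def)

lemma lorentz_form_nondegenerate: "(\<And>w. lorentz_form w u = lorentz_form w v) \<Longrightarrow> u = v"
  by (metis (no_types) lorentz_form_axis_left neg_equal_iff_equal vec_eq_iff)

lemma lorentz_form_mult:
  "lorentz_form (B *v u) (B *v v) = u \<bullet> ((transpose B ** lorentz_matrix ** B) *v v)"
  by (simp add: lorentz_form_def matrix_vector_mul_assoc[symmetric] transpose_matrix_vector
      dot_lmul_matrix inner_commute[of "B *v u"] inner_commute[of u])

lemma lorentz_group_iff:
  "B \<in> lorentz_group \<longleftrightarrow> (\<forall>u v. lorentz_form (B *v u) (B *v v) = lorentz_form u v)"
proof -
  have "(\<forall>u v. lorentz_form (B *v u) (B *v v) = lorentz_form u v) \<longleftrightarrow>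
      (\<forall>v. (transpose B ** lorentz_matrix ** B) *v v = lorentz_matrix *v v)"
    unfolding vector_eq_ldot[of "(transpose B ** lorentz_matrix ** B) *v v" "lorentz_matrix *v v" for v, symmetric]
    unfolding lorentz_form_mult unfolding lorentz_form_def by blast
  then show ?thesis unfolding lorentz_group_def mem_Collect_eq matrix_eq by blast
qed

lemma lorentz_groupI_axis:
  assumes "\<And>i j. lorentz_form (B *v axis i 1) (B *v axis j 1) = lorentz_matrix $ i $ j"
  shows "B \<in> lorentz_group"
proof -
  have "(transpose B ** lorentz_matrix ** B) $ i $ j = lorentz_matrix $ i $ j" for i j
    using assms[of i j] unfolding lorentz_form_mult
    by (simp add: inner_axis' matrix_vector_mul_component inner_axis)
  then show ?thesis by (simp add: lorentz_group_def vec_eq_iff)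
qed

lemma lorentz_group_det: 
  fixes B :: "((real, 'n::{finite,linorder}) vec, 'n) vec"
  assumes "B \<in> lorentz_group" shows "det B * det B = 1"
proof -
  have "det (lorentz_matrix :: ((real, 'n) vec, 'n) vec) \<noteq> 0"
    by (subst det_diagonal) (auto simp: lorentz_matrix_def)
  moreover have "det (transpose B ** lorentz_matrix ** B) = det (lorentz_matrix :: ((real, 'n) vec, 'n) vec)"
    using assms by (simp add: lorentz_group_def)
  ultimately show ?thesis by (simp add: det_mul)
qed

lemma lorentz_group_invertible: "B \<in> lorentz_group \<Longrightarrow> invertible B"
  using lorentz_group_det[of B] by (auto simp: invertible_det_nz)

lemma lorentz_group_inv: "B \<in> lorentz_group \<Longrightarrow> matrix_inv B \<in> lorentz_group"
  unfolding lorentz_group_iff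
  by (metis lorentz_group_iff lorentz_group_invertible matrix_inv_inverse(2) matrix_vector_mul_assoc matrix_vector_mul_lid)

lemma lorentz_group_mult: "B \<in> lorentz_group \<Longrightarrow> C \<in> lorentz_group \<Longrightarrow> B ** C \<in> lorentz_group"
  unfolding lorentz_group_iff by (metis matrix_vector_mul_assoc)

lemma matrix_inv_inv:
  fixes B :: "real ^ 'n ^ 'n"
  assumes "invertible B" shows "matrix_inv (matrix_inv B) = B"
proof -
  have "invertible (matrix_inv B)" using matrix_inv_inverse[OF assms] invertible_def by blast
  then show ?thesis
    using matrix_inv_inverse[OF assms] matrix_inv_inverse(1)[of "matrix_inv B"]
    by (metis matrix_mul_assoc matrix_mul_lid matrix_mul_rid)
qed

text \<open>The orthogonal complement of a timelike vector is positive definite: this is the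
  Cauchy-Schwarz inequality for the spatial parts.\<close>

lemma lorentz_form_pos:
  fixes u v :: "(real, 'n::{finite,linorder}) vec"
  assumes v: "lorentz_form v v < 0" and uv: "lorentz_form v u = 0" and u: "u \<noteq> 0"
  shows "lorentz_form u u > 0"
proof -
  obtain o' :: 'n where o': "idx o' = 0"
    using idx_bij[where 'n='n] by (metis UNIV_I bij_betw_iff_bijections lessThan_iff zero_less_card_finite)
  have o0: "idx i = 0 \<longleftrightarrow> i = o'" for i using o' idx_inj by metis
  let ?S = "UNIV - {o'}"
  have split: "lorentz_form a b = - (a $ o' * b $ o') + (\<Sum>i\<in>?S. a $ i * b $ i)" for a b
    unfolding lorentz_form_sum o0 by (subst sum.remove[of _ o']) auto
  let ?uu = "\<Sum>i\<in>?S. u $ i * u $ i" and ?vv = "\<Sum>i\<in>?S. v $ i * v $ i"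
  have CS: "(v $ o' * u $ o')\<^sup>2 \<le> ?vv * ?uu"
    using Cauchy_Schwarz_ineq_sum[of "\<lambda>i. v $ i" "\<lambda>i. u $ i" ?S] uv
    unfolding split power2_eq_square by simp
  have vpos: "?vv < v $ o' * v $ o'" and v0: "v $ o' \<noteq> 0"
  proof -
    show l: "?vv < v $ o' * v $ o'" using v unfolding split by simp
    have "?vv \<ge> 0" by (intro sum_nonneg) auto
    then show "v $ o' \<noteq> 0" using l by force
  qed
  have "?uu > 0"
  proof (rule ccontr)
    assume "\<not> ?uu > 0"
    moreover have "?uu \<ge> 0" by (intro sum_nonneg) auto
    ultimately have 0: "?uu = 0" by simp
    then have z: "u $ i = 0" if "i \<noteq> o'" for i
      using sum_nonneg_eq_0_iff[of ?S "\<lambda>i. u $ i * u $ i"] that by auto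
    have "u $ o' = 0" using CS 0 v0 by simp
    then have "u = 0" using z by (metis vec_eq_iff zero_index)
    then show False using u by simp
  qed
  then have "?vv * ?uu < v $ o' * v $ o' * ?uu" using vpos by simp
  then have "(v $ o' * v $ o') * (u $ o' * u $ o') < (v $ o' * v $ o') * ?uu"
    using CS by (simp add: power2_eq_square algebra_simps)
  then have "u $ o' * u $ o' < ?uu" using mult_less_cancel_left_pos[of "v $ o' * v $ o'"] v0
    by (metis not_real_square_gt_zero)
  then show ?thesis unfolding split by simp
qed

text \<open>A nonzero vector orthogonal to the system is spacelike, because the system contains a timelike
  vector. It can therefore be normalised and added to the system.\<close>

lemma lorentz_system_extend:
  fixes v :: "nat \<Rightarrow> (real, 'n::{finite,linorder}) vec"
  assumes "1 \<le> k" "k \<le> CARD('n)"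
    and "\<And>i j. i < k \<Longrightarrow> j < k \<Longrightarrow> lorentz_form (v i) (v j) = (if i \<noteq> j then 0 else if i = 0 then -1 else 1)"
  obtains w where "\<And>i. i < k \<Longrightarrow> w i = v i"
    "\<And>i j. i < CARD('n) \<Longrightarrow> j < CARD('n) \<Longrightarrow>
        lorentz_form (w i) (w j) = (if i \<noteq> j then 0 else if i = 0 then -1 else 1)"
proof -
  let ?on = "\<lambda>k w. \<forall>i j. i < k \<longrightarrow> j < k \<longrightarrow>
      lorentz_form (w i) (w j) = (if i \<noteq> j then 0 else if i = 0 then -1 else 1)"
  have "\<exists>w. (\<forall>i<k. w i = v i) \<and> ?on l w" if "k \<le> l" "l \<le> CARD('n)" for l
    using that
  proof (induction l rule: dec_induct)
    case base
    then show ?case using assms(3) by blast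
  next
    case (step l)
    then obtain w where w: "\<forall>i<k. w i = v i" "?on l w" by auto
    let ?X = "(\<lambda>i. lorentz_matrix *v w i) ` {..<l}"
    have "dim ?X \<le> card ?X" by (rule dim_le_card') simp
    also have "\<dots> \<le> l" using card_image_le[of "{..<l}"] by simp
    also have "\<dots> < DIM((real, 'n) vec)" using step by simp
    finally obtain u where u: "u \<noteq> 0" "\<And>y. y \<in> span ?X \<Longrightarrow> orthogonal u y"
      using orthogonal_to_subspace_exists by metis
    have orth: "lorentz_form u (w i) = 0" if "i < l" for i
      using u(2)[of "lorentz_matrix *v w i"] that
      by (auto simp: orthogonal_def lorentz_form_def intro: span_base)
    have "lorentz_form (w 0) (w 0) < 0" using w(2) step assms(1) by simp
    then have pos: "lorentz_form u u > 0"
      using lorentz_form_pos[OF _ _ u(1)] orth[of 0] step assms(1) by (simp add: lorentz_form_commute)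
    define e where "e = (1 / sqrt (lorentz_form u u)) *\<^sub>R u"
    have e1: "lorentz_form e e = 1" using pos by (simp add: e_def lorentz_form_scale)
    have e0: "lorentz_form e (w i) = 0" "lorentz_form (w i) e = 0" if "i < l" for i
      using lorentz_form_scale[of _ u 1 "w i"] orth[OF that] by (simp_all add: e_def lorentz_form_commute)
    have "?on (Suc l) (w(l := e))"
      using w(2) e0 e1 step assms(1) by (auto simp: less_Suc_eq)
    moreover have "\<forall>i<k. (w(l := e)) i = v i" using w(1) step by auto
    ultimately show ?case by blast
  qed
  from this[OF assms(2) order.refl] show thesis using that by blast
qed

lemma lorentz_system_as_columns:
  fixes v :: "nat \<Rightarrow> (real, 'n::{finite,linorder}) vec"
  assumes "1 \<le> k" "k \<le> CARD('n)"
    and "\<And>i j. i < k \<Longrightarrow> j < k \<Longrightarrow> lorentz_form (v i) (v j) = (if i \<noteq> j then 0 else if i = 0 then -1 else 1)"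
  obtains P where "P \<in> lorentz_group" "\<And>j. idx j < k \<Longrightarrow> P *v axis j 1 = v (idx j)"
proof -
  obtain w where w: "\<And>i. i < k \<Longrightarrow> w i = v i"
    "\<And>i j. i < CARD('n) \<Longrightarrow> j < CARD('n) \<Longrightarrow>
        lorentz_form (w i) (w j) = (if i \<noteq> j then 0 else if i = 0 then -1 else 1)"
    using lorentz_system_extend[of k v thesis] assms that by blast
  define P :: "((real, 'n) vec, 'n) vec" where "P = (\<chi> a j. w (idx j) $ a)"
  have P: "P *v axis j 1 = w (idx j)" for j
    unfolding vec_eq_iff by (simp add: P_def matrix_vector_mul_component inner_axis)
  show thesis
  proof
    show "P \<in> lorentz_group"
      by (rule lorentz_groupI_axis) (simp add: P w(2) idx_less_card idx_inj lorentz_matrix_def)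
  qed (simp add: P w(1))
qed

lemma span_axis_iff:
  "v \<in> span {axis i 1 | i. k \<le> idx i} \<longleftrightarrow> (\<forall>i :: 'n::{finite,linorder}. idx i < k \<longrightarrow> (v :: (real, 'n) vec) $ i = 0)"
proof
  assume "v \<in> span {axis i 1 | i :: 'n. k \<le> idx i}"
  then show "\<forall>i. idx i < k \<longrightarrow> v $ i = 0"
  proof (induction rule: span_induct)
    case base
    show ?case by (intro subspaceI) auto
  next
    case (step x)
    then show ?case by (auto simp: axis_def)
  qed
next
  assume 0: "\<forall>i. idx i < k \<longrightarrow> v $ i = 0"
  have "v = (\<Sum>i\<in>UNIV. (v $ i) *\<^sub>R axis i 1)"
    using basis_expansion[of v] by (simp add: scalar_mult_eq_scaleR)
  also have "\<dots> \<in> span {axis i 1 | i :: 'n. k \<le> idx i}"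
  proof (rule span_sum)
    fix i
    show "(v $ i) *\<^sub>R axis i 1 \<in> span {axis i 1 | i :: 'n. k \<le> idx i}"
    proof (cases "idx i < k")
      case False
      then show ?thesis by (intro span_scale span_base) auto
    qed (use 0 in \<open>simp add: span_zero\<close>)
  qed
  finally show "v \<in> span {axis i 1 | i. k \<le> idx i}" .
qed

text \<open>The span of the last basis vectors is the Lorentz orthogonal complement of the fixed ones, hence
  invariant. The timelike basis vector is among the fixed ones, so on this span the Lorentz form
  is the Euclidean scalar product.\<close>

lemma SO_stabI:
  fixes B :: "((real, 'n::{finite,linorder}) vec, 'n) vec"
  assumes k: "1 \<le> k" and B: "B \<in> lorentz_group" "det B = 1"
    and fixed: "\<And>i. idx i < k \<Longrightarrow> B *v axis i 1 = axis i 1"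
  shows "B \<in> SO_stab k"
proof -
  define W :: "(real, 'n) vec set" where "W = span {axis i 1 | i :: 'n. k \<le> idx i}"
  have form: "lorentz_form (B *v u) (B *v v) = lorentz_form u v" for u v
    using B by (simp add: lorentz_group_iff)
  have inv: "B *v v \<in> W" if "v \<in> W" for v
  proof -
    have "(B *v v) $ i = 0" if i: "idx i < k" for i
      using form[of "axis i 1" v] \<open>v \<in> W\<close> i
      unfolding fixed[OF i] lorentz_form_axis_left W_def span_axis_iff by (auto split: if_splits)
    then show ?thesis by (simp add: W_def span_axis_iff)
  qed
  have euclid: "lorentz_form u v = u \<bullet> v" if "u \<in> W" for u v
  proof -
    have "u $ i = 0" if "idx i = 0" for i using that \<open>u \<in> W\<close> k by (simp add: W_def span_axis_iff)
    then show ?thesis unfolding lorentz_form_sum inner_vec_def by (intro sum.cong) auto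
  qed
  have "(B *v v) \<bullet> (B *v w) = v \<bullet> w" if "v \<in> W" for v w
    using form[of v w] euclid[OF that] euclid[OF inv[OF that]] by simp
  then show ?thesis
    unfolding SO_stab_def Let_def W_def[symmetric] using fixed inv B by blast
qed

section \<open>Charts, tangent vectors and the metric in coordinates\<close>

locale lorentz_manifold =
  fixes M :: "'a::{t2_space,second_countable_topology} set"
    and A :: "('a, (real, 'n::{finite,linorder}) vec) chart set"
    and g :: "('a, (real, 'n) vec) metric"
  assumes atlas: "smooth_atlas M A" and metric: "lorentzian_metric M A g"
begin

abbreviation img :: "('a, (real, 'n) vec) chart \<Rightarrow> (real, 'n) vec set" where
  "img c \<equiv> chart_map c ` chart_dom c"

lemma chart_inv_map [simp]: "c \<in> A \<Longrightarrow> q \<in> chart_dom c \<Longrightarrow> chart_inv c (chart_map c q) = q"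
  by (rule chart_inv_chart_map[OF atlas])

lemma chart_inv_dom: "c \<in> A \<Longrightarrow> x \<in> img c \<Longrightarrow> chart_inv c x \<in> chart_dom c"
  by auto

lemma chart_map_inv: "c \<in> A \<Longrightarrow> x \<in> img c \<Longrightarrow> chart_map c (chart_inv c x) = x"
  by auto

lemma chart_dom_M: "c \<in> A \<Longrightarrow> q \<in> chart_dom c \<Longrightarrow> q \<in> M"
  using atlas unfolding smooth_atlas_def by blast

lemma chart_around: "q \<in> M \<Longrightarrow> \<exists>c\<in>A. q \<in> chart_dom c"
  using atlas unfolding smooth_atlas_def by blast

lemma openin_chart_dom: "c \<in> A \<Longrightarrow> openin (top_of_set M) (chart_dom c)"
  using atlas unfolding smooth_atlas_def by blast

lemma open_img: "c \<in> A \<Longrightarrow> open (img c)"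
  using atlas unfolding smooth_atlas_def by blast

lemma open_overlap: "c \<in> A \<Longrightarrow> d \<in> A \<Longrightarrow> open (chart_map c ` (chart_dom c \<inter> chart_dom d))"
  by (rule smooth_atlas_open[OF atlas _ openin_chart_dom])

lemma chart_homeomorphism: "c \<in> A \<Longrightarrow> homeomorphism (chart_dom c) (img c) (chart_map c) (chart_inv c)"
  using atlas unfolding smooth_atlas_def by blast

lemma transition_smooth:
  "c \<in> A \<Longrightarrow> d \<in> A \<Longrightarrow> ck_on n (chart_map c ` (chart_dom c \<inter> chart_dom d)) (transition c d)"
  using atlas unfolding smooth_atlas_def smooth_on_def by blast

lemma transition_chart_map: "c \<in> A \<Longrightarrow> q \<in> chart_dom c \<Longrightarrow> transition c d (chart_map c q) = chart_map d q"
  by (simp add: transition_def)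

lemma transition_has_derivative:
  "c \<in> A \<Longrightarrow> d \<in> A \<Longrightarrow> q \<in> chart_dom c \<Longrightarrow> q \<in> chart_dom d \<Longrightarrow>
    (transition c d has_derivative d_transition c d q) (at (chart_map c q))"
  using d_transition_deriv[OF atlas, of c d q] by simp

lemma d_transition_self: "c \<in> A \<Longrightarrow> q \<in> chart_dom c \<Longrightarrow> d_transition c c q u = u"
proof -
  assume c: "c \<in> A" and q: "q \<in> chart_dom c"
  have "(transition c c has_derivative (\<lambda>u. u)) (at (chart_map c q))"
    by (rule has_derivative_transform_within_open[OF has_derivative_ident open_img[OF c]])
      (use c q in \<open>auto simp: transition_chart_map\<close>)
  then show ?thesis
    using transition_has_derivative[OF c c q q] has_derivative_unique by metis
qed

lemma coord_vector_same: "c \<in> A \<Longrightarrow> q \<in> chart_dom c \<Longrightarrow> coord_vector A c q u c = u"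
  by (simp add: coord_vector_def d_transition_self)

lemmas coord_vector_tangent = coord_vector_tangent[OF atlas]

lemma tangent_transition:
  "v \<in> tangent_space A q \<Longrightarrow> c \<in> A \<Longrightarrow> d \<in> A \<Longrightarrow> q \<in> chart_dom c \<Longrightarrow> q \<in> chart_dom d \<Longrightarrow>
    v d = d_transition c d q (v c)"
  unfolding tangent_space_def by blast

lemma tangent_eqI:
  "u \<in> tangent_space A q \<Longrightarrow> v \<in> tangent_space A q \<Longrightarrow> c \<in> A \<Longrightarrow> q \<in> chart_dom c \<Longrightarrow> u c = v c \<Longrightarrow> u = v"
  by (metis coord_vector_of_tangent)

lemma d_transition_linear:
  "c \<in> A \<Longrightarrow> d \<in> A \<Longrightarrow> q \<in> chart_dom c \<Longrightarrow> q \<in> chart_dom d \<Longrightarrow> linear (d_transition c d q)"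
  using transition_has_derivative has_derivative_linear by blast

lemma d_transition_inverse:
  "c \<in> A \<Longrightarrow> d \<in> A \<Longrightarrow> q \<in> chart_dom c \<Longrightarrow> q \<in> chart_dom d \<Longrightarrow>
    d_transition c d q (d_transition d c q u) = u"
  using d_transition_cocycle[OF atlas] d_transition_self by metis

lemma tangent_space_sum:
  assumes "\<And>i. i \<in> I \<Longrightarrow> V i \<in> tangent_space A q"
  shows "(\<lambda>c. \<Sum>i\<in>I. a i *\<^sub>R V i c) \<in> tangent_space A q"
proof -
  have "(\<Sum>i\<in>I. a i *\<^sub>R V i d) = d_transition c d q (\<Sum>i\<in>I. a i *\<^sub>R V i c)"
    if "c \<in> A" "d \<in> A" "q \<in> chart_dom c" "q \<in> chart_dom d" for c d
    unfolding linear_sum[OF d_transition_linear[OF that]] linear_scale[OF d_transition_linear[OF that]]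
    by (intro sum.cong refl arg_cong[where f = "scaleR (a _)"] tangent_transition assms that)
  moreover have "(\<Sum>i\<in>I. a i *\<^sub>R V i c) = 0" if "\<not> (c \<in> A \<and> q \<in> chart_dom c)" for c
    by (intro sum.neutral) (use assms that in \<open>auto simp: tangent_space_def\<close>)
  ultimately show ?thesis unfolding tangent_space_def mem_Collect_eq Int_iff by blast
qed

lemma frame_map_tangent: "(\<And>i. E i \<in> tangent_space A q) \<Longrightarrow> frame_map E v \<in> tangent_space A q"
  unfolding frame_map_def by (rule tangent_space_sum)

definition coord_metric :: "('a, (real, 'n) vec) chart \<Rightarrow> (real, 'n) vec \<Rightarrow> (real, 'n) vec \<Rightarrow> (real, 'n) vec \<Rightarrow> real" where
  "coord_metric c x u v = u \<bullet> (metric_comp A g c x *v v)"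

lemma coord_metric_sum: "coord_metric c x u v = (\<Sum>i\<in>UNIV. \<Sum>j\<in>UNIV. u $ i * (metric_comp A g c x $ i $ j * v $ j))"
  by (simp add: coord_metric_def inner_vec_def matrix_vector_mult_def sum_distrib_left)

lemma coord_metric_commute: "c \<in> A \<Longrightarrow> coord_metric c x u v = coord_metric c x v u"
  unfolding coord_metric_sum
  by (subst sum.swap, intro sum.cong refl)
    (use metric_comp_sym[OF atlas metric] in \<open>simp add: algebra_simps\<close>)

lemma coord_metric_linear_right: "linear (coord_metric c x u)"
  unfolding coord_metric_def
  by (intro linearI)
    (simp_all add: matrix_vector_right_distrib inner_add_right linear_scale[OF matrix_vector_mul_linear])

lemma coord_metric_linear_left: "linear (\<lambda>u. coord_metric c x u v)"
  unfolding coord_metric_def by (intro linearI) (simp_all add: inner_add_left)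

lemma g_commute: "q \<in> M \<Longrightarrow> u \<in> tangent_space A q \<Longrightarrow> v \<in> tangent_space A q \<Longrightarrow> g q u v = g q v u"
  using metric unfolding lorentzian_metric_def by blast

lemma g_coords:
  assumes c: "c \<in> A" and q: "q \<in> chart_dom c" and u: "u \<in> tangent_space A q" and v: "v \<in> tangent_space A q"
  shows "g q u v = coord_metric c (chart_map c q) (u c) (v c)"
proof -
  let ?e = "\<lambda>i. coord_vector A c q (axis i 1)"
  note T = coord_vector_tangent[OF c q] and M = chart_dom_M[OF c q]
  have "g q u v = g q (coord_vector A c q (u c)) v"
    by (simp add: coord_vector_of_tangent[OF c q u])
  also have "\<dots> = (\<Sum>i\<in>UNIV. u c $ i * g q (?e i) v)"
    by (rule metric_sum_left[OF atlas metric c q v])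
  also have "\<dots> = (\<Sum>i\<in>UNIV. u c $ i * g q (coord_vector A c q (v c)) (?e i))"
    by (simp only: coord_vector_of_tangent[OF c q v] g_commute[OF M T v])
  also have "\<dots> = (\<Sum>i\<in>UNIV. u c $ i * (\<Sum>j\<in>UNIV. v c $ j * g q (?e i) (?e j)))"
    by (subst metric_sum_left[OF atlas metric c q T]) (simp only: g_commute[OF M T T])
  also have "\<dots> = coord_metric c (chart_map c q) (u c) (v c)"
    unfolding coord_metric_sum metric_comp_def using c q
    by (simp add: sum_distrib_left mult.commute mult.left_commute)
  finally show ?thesis .
qed

lemma g_sum_left:
  assumes "q \<in> M" "\<And>i. i \<in> I \<Longrightarrow> V i \<in> tangent_space A q" "w \<in> tangent_space A q"
  shows "g q (\<lambda>c. \<Sum>i\<in>I. a i *\<^sub>R V i c) w = (\<Sum>i\<in>I. a i * g q (V i) w)"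
proof -
  obtain c where c: "c \<in> A" "q \<in> chart_dom c" using chart_around assms(1) by blast
  show ?thesis
    by (simp add: g_coords[OF c] assms tangent_space_sum linear_sum[OF coord_metric_linear_left]
        linear_scale[OF coord_metric_linear_left])
qed

lemma coord_metric_nondegenerate:
  assumes c: "c \<in> A" and x: "x \<in> img c" and 0: "\<And>v. coord_metric c x u v = 0"
  shows "u = 0"
proof -
  have "invertible (metric_comp A g c x)" using metric_comp_invertible[OF atlas metric c] x by auto
  then have "metric_comp A g c x *v (matrix_inv (metric_comp A g c x) *v u) = u"
    by (simp add: matrix_vector_mul_assoc matrix_inv_inverse)
  then have "u \<bullet> u = 0" using 0[of "matrix_inv (metric_comp A g c x) *v u"] by (simp add: coord_metric_def)
  then show ?thesis by simp
qed

abbreviation Gam :: "('a, (real, 'n) vec) chart \<Rightarrow> (real, 'n) vec \<Rightarrow> (real, 'n) vec \<Rightarrow> (real, 'n) vec \<Rightarrow> (real, 'n) vec" where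
  "Gam c x \<equiv> conn (christoffel A g c x)"

lemma metric_comp_smooth: "c \<in> A \<Longrightarrow> ck_on n (img c) (\<lambda>x. metric_comp A g c x $ i $ j)"
  using metric unfolding lorentzian_metric_def smooth_on_def
  by (intro ck_on_component open_img) auto

lemma christoffel_smooth:
  assumes c: "c \<in> A" shows "ck_on n (img c) (\<lambda>x. christoffel A g c x k i j)"
proof -
  have d: "ck_on n (img c) (\<lambda>x. metric_deriv A g c x a b e)" for a b e
    using metric_comp_smooth[OF c, of "Suc n" b e] unfolding metric_deriv_def by (metis ck_on.simps(2))
  have "ck_on n (img c) (\<lambda>x. matrix_inv (metric_comp A g c x) $ k $ l)" for l
    by (rule ck_on_matrix_inv[OF open_img[OF c] metric_comp_smooth[OF c]])
      (use metric_comp_invertible[OF atlas metric c] in auto)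
  then have "ck_on n (img c) (\<lambda>x. (\<Sum>l\<in>UNIV. matrix_inv (metric_comp A g c x) $ k $ l *
      (metric_deriv A g c x i j l + metric_deriv A g c x j i l + (-1) * metric_deriv A g c x l i j)) * (1/2))"
    by (intro ck_on_mult ck_on_sum ck_on_add ck_on_const open_img[OF c] d)
  then show ?thesis unfolding christoffel_def by simp
qed

lemma christoffel_continuous: "c \<in> A \<Longrightarrow> continuous_on (img c) (\<lambda>x. christoffel A g c x k i j)"
  using christoffel_smooth[of c 0] by simp

lemma Gam_commute: "c \<in> A \<Longrightarrow> Gam c x u v = Gam c x v u"
  by (rule conn_symmetric) (rule christoffel_torsion_free[OF atlas metric])

text \<open>Contracting the index identity \<open>christoffel_metric\<close> with three vectors turns it into the
  invariant form of metric compatibility.\<close>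

lemma metric_comp_derivative_sum:
  assumes c: "c \<in> A" and x: "x \<in> img c"
  shows "(\<Sum>i\<in>UNIV. \<Sum>j\<in>UNIV. u $ i * (frechet_derivative (\<lambda>y. metric_comp A g c y $ i $ j) (at x) w * v $ j))
    = coord_metric c x (Gam c x w u) v + coord_metric c x u (Gam c x w v)"
proof -
  let ?G = "metric_comp A g c x" and ?C = "christoffel A g c x"
  have fd: "frechet_derivative (\<lambda>y. metric_comp A g c y $ i $ j) (at x) w =
      (\<Sum>a\<in>UNIV. w $ a * ((\<Sum>k\<in>UNIV. ?C k a i * ?G $ k $ j) + (\<Sum>k\<in>UNIV. ?C k a j * ?G $ i $ k)))" for i j
  proof -
    let ?D = "frechet_derivative (\<lambda>y. metric_comp A g c y $ i $ j) (at x)"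
    have L: "linear ?D"
      using ck_on_Suc_has_derivative[OF metric_comp_smooth[OF c, of "Suc 0"] x] has_derivative_linear by blast
    obtain q where q: "q \<in> chart_dom c" "x = chart_map c q" using x by blast
    have "?D w = ?D (\<Sum>a\<in>UNIV. (w $ a) *\<^sub>R axis a 1)"
      using basis_expansion[of w] by (simp add: scalar_mult_eq_scaleR)
    also have "\<dots> = (\<Sum>a\<in>UNIV. w $ a * metric_deriv A g c x a i j)"
      unfolding linear_sum[OF L] linear_scale[OF L] metric_deriv_def by simp
    finally show ?thesis unfolding christoffel_metric[OF atlas metric c q] .
  qed
  have 1: "(\<Sum>i\<in>UNIV. \<Sum>j\<in>UNIV. u $ i * ((\<Sum>a\<in>UNIV. w $ a * (\<Sum>k\<in>UNIV. ?C k a i * ?G $ k $ j)) * v $ j))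
      = coord_metric c x (Gam c x w u) v"
    unfolding coord_metric_sum conn_def vec_lambda_beta
    apply (simp add: sum_distrib_left sum_distrib_right sum.cartesian_product)
    apply (rule sum.reindex_bij_witness[of _ "\<lambda>(k,j,a,i). (i,j,a,k)" "\<lambda>(i,j,a,k). (k,j,a,i)"])
    by (auto simp: algebra_simps)
  have 2: "(\<Sum>i\<in>UNIV. \<Sum>j\<in>UNIV. u $ i * ((\<Sum>a\<in>UNIV. w $ a * (\<Sum>k\<in>UNIV. ?C k a j * ?G $ i $ k)) * v $ j))
      = coord_metric c x u (Gam c x w v)"
    unfolding coord_metric_sum conn_def vec_lambda_beta
    apply (simp add: sum_distrib_left sum_distrib_right sum.cartesian_product)
    apply (rule sum.reindex_bij_witness[of _ "\<lambda>(i,k,a,j). (i,j,a,k)" "\<lambda>(i,j,a,k). (i,k,a,j)"])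
    by (auto simp: algebra_simps)
  show ?thesis unfolding fd 1[symmetric] 2[symmetric]
    by (simp add: distrib_left distrib_right sum.distrib)
qed

text \<open>The derivatives of the metric components are absorbed into the covariant derivatives
  \<open>X' + \<Gamma>(x', X)\<close> and \<open>Y' + \<Gamma>(x', Y)\<close>. The map \<open>x\<close> may be a curve or a change of coordinates.\<close>

lemma coord_metric_has_derivative:
  assumes c: "c \<in> A" and x: "x t \<in> img c"
    and dx: "(x has_derivative x') (at t within I)"
    and dX: "(X has_derivative X') (at t within I)" and dY: "(Y has_derivative Y') (at t within I)"
  shows "((\<lambda>t. coord_metric c (x t) (X t) (Y t)) has_derivative
      (\<lambda>s. coord_metric c (x t) (X' s + Gam c (x t) (x' s) (X t)) (Y t)
         + coord_metric c (x t) (X t) (Y' s + Gam c (x t) (x' s) (Y t)))) (at t within I)"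
proof -
  let ?D = "\<lambda>i j. frechet_derivative (\<lambda>y. metric_comp A g c y $ i $ j) (at (x t))"
  have dG: "((\<lambda>t. metric_comp A g c (x t) $ i $ j) has_derivative (\<lambda>s. ?D i j (x' s))) (at t within I)" for i j
    by (rule has_derivative_compose[OF dx ck_on_Suc_has_derivative[OF metric_comp_smooth[OF c, of "Suc 0"] x]])
  have dc: "((\<lambda>t. X t $ i) has_derivative (\<lambda>s. X' s $ i)) (at t within I)"
    "((\<lambda>t. Y t $ i) has_derivative (\<lambda>s. Y' s $ i)) (at t within I)" for i
    by (intro bounded_linear.has_derivative[OF bounded_linear_vec_nth] dX dY)+
  have "((\<lambda>t. coord_metric c (x t) (X t) (Y t)) has_derivative
      (\<lambda>s. \<Sum>i\<in>UNIV. \<Sum>j\<in>UNIV. X t $ i * (metric_comp A g c (x t) $ i $ j * Y' s $ j + ?D i j (x' s) * Y t $ j)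
         + X' s $ i * (metric_comp A g c (x t) $ i $ j * Y t $ j))) (at t within I)"
    unfolding coord_metric_sum by (intro has_derivative_sum has_derivative_mult dG dc)
  moreover have "(\<Sum>i\<in>UNIV. \<Sum>j\<in>UNIV. X t $ i * (metric_comp A g c (x t) $ i $ j * Y' s $ j + ?D i j (x' s) * Y t $ j)
         + X' s $ i * (metric_comp A g c (x t) $ i $ j * Y t $ j))
      = coord_metric c (x t) (X' s + Gam c (x t) (x' s) (X t)) (Y t)
         + coord_metric c (x t) (X t) (Y' s + Gam c (x t) (x' s) (Y t))" for s
    unfolding linear_add[OF coord_metric_linear_right] linear_add[OF coord_metric_linear_left]
    using metric_comp_derivative_sum[OF c x, of "X t" "x' s" "Y t"]
    by (simp add: coord_metric_sum[of c "x t" "X t" "Y' s"] coord_metric_sum[of c "x t" "X' s"] distrib_left sum.distrib)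
  ultimately show ?thesis by simp
qed

section \<open>The transformation law of the connection\<close>

abbreviation hess :: "('a, (real, 'n) vec) chart \<Rightarrow> ('a, (real, 'n) vec) chart \<Rightarrow> (real, 'n) vec
    \<Rightarrow> (real, 'n) vec \<Rightarrow> (real, 'n) vec \<Rightarrow> (real, 'n) vec" where
  "hess c d x w u \<equiv> frechet_derivative (\<lambda>y. frechet_derivative (transition c d) (at y) u) (at x) w"

lemma hess_has_derivative:
  assumes "c \<in> A" "d \<in> A" "q \<in> chart_dom c" "q \<in> chart_dom d"
  shows "((\<lambda>y. frechet_derivative (transition c d) (at y) u) has_derivative
      (\<lambda>w. hess c d (chart_map c q) w u)) (at (chart_map c q))"
proof (rule ck_on_Suc_has_derivative)
  show "ck_on (Suc 0) (chart_map c ` (chart_dom c \<inter> chart_dom d))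
      (\<lambda>y. frechet_derivative (transition c d) (at y) u)"
    using transition_smooth[OF assms(1,2), of "Suc (Suc 0)"] by (metis ck_on.simps(2))
qed (use assms in auto)

text \<open>The defect \<open>T\<close> of the transformation law is symmetric, as both connections are torsion free
  and second derivatives commute, and skew with respect to the metric, as both connections are metric.
  A trilinear form that is symmetric in the first and skew in the last two arguments vanishes.\<close>

lemma connection_transformation:
  assumes c: "c \<in> A" and d: "d \<in> A" and q: "q \<in> chart_dom c" "q \<in> chart_dom d"
  shows "d_transition c d q (Gam c (chart_map c q) w u) =
    Gam d (chart_map d q) (d_transition c d q w) (d_transition c d q u) + hess c d (chart_map c q) w u"
proof -
  let ?x = "chart_map c q" and ?y = "chart_map d q" and ?P = "d_transition c d q"
  let ?S = "chart_map c ` (chart_dom c \<inter> chart_dom d)"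
  let ?F = "\<lambda>y. frechet_derivative (transition c d) (at y)"
  have xS: "?x \<in> ?S" using q by auto
  note oS = open_overlap[OF c d]
  have P: "?F ?x = ?P" by (simp add: d_transition_def)
  note LP = d_transition_linear[OF c d q]
  have tx: "transition c d ?x = ?y" by (simp add: transition_chart_map c q)
  have pull: "coord_metric c y u v = coord_metric d (transition c d y) (?F y u) (?F y v)" if y: "y \<in> ?S" for y u v
  proof -
    obtain r where r: "r \<in> chart_dom c" "r \<in> chart_dom d" "y = chart_map c r" using y by blast
    note T = coord_vector_tangent[OF c r(1)]
    have "coord_metric c y u v = g r (coord_vector A c r u) (coord_vector A c r v)"
      using g_coords[OF c r(1) T T, of u v] by (simp add: coord_vector_same c r)
    also have "\<dots> = coord_metric d (chart_map d r) (coord_vector A c r u d) (coord_vector A c r v d)"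
      by (rule g_coords[OF d r(2) T T])
    also have "\<dots> = coord_metric d (transition c d y) (?F y u) (?F y v)"
      using r c d by (simp add: coord_vector_def d_transition_def transition_chart_map)
    finally show ?thesis .
  qed
  define T where "T w u = ?P (Gam c ?x w u) - Gam d ?y (?P w) (?P u) - hess c d ?x w u" for w u
  have skew: "coord_metric d ?y (T w u) (?P v) + coord_metric d ?y (?P u) (T w v) = 0" for w u v
  proof -
    have 1: "((\<lambda>y. coord_metric c y u v) has_derivative
        (\<lambda>w. coord_metric c ?x (0 + Gam c ?x w u) v + coord_metric c ?x u (0 + Gam c ?x w v))) (at ?x)"
      by (rule coord_metric_has_derivative[OF c]) (use q in \<open>auto intro!: derivative_eq_intros\<close>)
    have 2: "((\<lambda>y. coord_metric d (transition c d y) (?F y u) (?F y v)) has_derivative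
        (\<lambda>w. coord_metric d (transition c d ?x) (hess c d ?x w u + Gam d (transition c d ?x) (?P w) (?F ?x u)) (?F ?x v)
           + coord_metric d (transition c d ?x) (?F ?x u) (hess c d ?x w v + Gam d (transition c d ?x) (?P w) (?F ?x v)))) (at ?x)"
      by (rule coord_metric_has_derivative[OF d])
        (use q in \<open>auto simp: tx intro!: transition_has_derivative hess_has_derivative c d\<close>)
    have "((\<lambda>y. coord_metric c y u v) has_derivative
        (\<lambda>w. coord_metric d ?y (hess c d ?x w u + Gam d ?y (?P w) (?P u)) (?P v)
           + coord_metric d ?y (?P u) (hess c d ?x w v + Gam d ?y (?P w) (?P v)))) (at ?x)"
      by (rule has_derivative_transform_within_open[OF 2[unfolded tx P] oS xS]) (simp add: pull)
    from has_derivative_unique[OF 1 this]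
    have "coord_metric c ?x (Gam c ?x w u) v + coord_metric c ?x u (Gam c ?x w v) =
        coord_metric d ?y (hess c d ?x w u + Gam d ?y (?P w) (?P u)) (?P v)
           + coord_metric d ?y (?P u) (hess c d ?x w v + Gam d ?y (?P w) (?P v))"
      by (simp add: fun_eq_iff)
    moreover have "coord_metric c ?x a b = coord_metric d ?y (?P a) (?P b)" for a b
      using pull[OF xS] by (simp add: tx P)
    ultimately show ?thesis
      unfolding T_def
      by (simp add: linear_diff[OF coord_metric_linear_left] linear_diff[OF coord_metric_linear_right]
          linear_add[OF coord_metric_linear_left] linear_add[OF coord_metric_linear_right])
  qed
  have sym: "T w u = T u w" for w u
    unfolding T_def Gam_commute[OF c, of ?x w] Gam_commute[OF d, of ?y "?P w"]
    using second_derivative_symmetric[OF oS xS transition_smooth[OF c d]] by simp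
  define t where "t w u v = coord_metric d ?y (T w u) (?P v)" for w u v
  have t1: "t w u v = t u w v" for w u v unfolding t_def sym[of w] ..
  have t2: "t w u v = - t w v u" for w u v
    using skew[of w u v] unfolding t_def coord_metric_commute[OF d, of ?y "?P u"] by simp
  have "t w u v = 0" for w u v
  proof -
    have "t w u v = - t w v u" by (rule t2)
    also have "\<dots> = - t v w u" by (simp only: t1)
    also have "\<dots> = t v u w" using t2[of v w u] by simp
    also have "\<dots> = t u v w" by (rule t1)
    also have "\<dots> = - t u w v" by (rule t2)
    also have "\<dots> = - t w u v" by (simp only: t1)
    finally show ?thesis by simp
  qed
  then have "coord_metric d ?y (T w u) v = 0" for v
    unfolding t_def using d_transition_inverse[OF c d q, of v] by metis
  then have "T w u = 0" using coord_metric_nondegenerate[OF d] q by auto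
  then show ?thesis unfolding T_def by (simp add: algebra_simps)
qed

end

section \<open>Curves on intervals and their affine reparametrisation\<close>

lemma has_vector_derivative_Un:
  assumes "(f has_vector_derivative f') (at x within S)" "(f has_vector_derivative f') (at x within T)"
  shows "(f has_vector_derivative f') (at x within (S \<union> T))"
  using assms unfolding has_vector_derivative_def has_derivative_within
  by (auto simp: at_within_union intro: filterlim_sup)

text \<open>At a parameter outside one half of an interval, the derivative within that half is arbitrary, so
  the two halves can be treated alike at every parameter.\<close>

lemma has_vector_derivative_within_outside:
  assumes "closed S" "x \<notin> S" shows "(f has_vector_derivative f') (at x within S)"
proof -
  have "at x within S = bot"
    using assms by (metis closed_limpt trivial_limit_within)
  then show ?thesis unfolding has_vector_derivative_def has_derivative_def
    by (auto intro: bounded_linear_scaleR_left)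
qed

lemma smooth_on_interval_subset:
  assumes "smooth_on_interval a b f" "a \<le> l" "r \<le> b" shows "smooth_on_interval l r f"
proof -
  obtain D where D: "\<forall>t\<in>{a..b}. D 0 t = f t"
    "\<forall>n. \<forall>t\<in>{a..b}. (D n has_vector_derivative D (Suc n) t) (at t within {a..b})"
    using assms(1) unfolding smooth_on_interval_def by blast
  have sub: "{l..r} \<subseteq> {a..b}" using assms(2,3) by auto
  have "(D n has_vector_derivative D (Suc n) t) (at t within {l..r})" if "t \<in> {l..r}" for n t
    using has_vector_derivative_within_subset[OF _ sub] D(2) that sub by blast
  then show ?thesis unfolding smooth_on_interval_def using D(1) sub by blast
qed

lemma smooth_on_interval_cong:
  "smooth_on_interval a b f \<Longrightarrow> (\<And>t. t \<in> {a..b} \<Longrightarrow> f t = h t) \<Longrightarrow> smooth_on_interval a b h"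
  unfolding smooth_on_interval_def by metis

lemma smooth_on_interval_derivative:
  assumes "smooth_on_interval a b f" "t \<in> {a..b}"
  obtains w where "(f has_vector_derivative w) (at t within {a..b})"
proof -
  obtain D :: "nat \<Rightarrow> real \<Rightarrow> _" where D: "\<forall>t\<in>{a..b}. D 0 t = f t"
    "\<forall>n. \<forall>t\<in>{a..b}. (D n has_vector_derivative D (Suc n) t) (at t within {a..b})"
    using assms unfolding smooth_on_interval_def by blast
  then have "(f has_vector_derivative D 1 t) (at t within {a..b})"
    using has_vector_derivative_transform[OF assms(2), of f "D 0"] assms(2) by force
  then show thesis by (rule that)
qed

lemma affine_has_vector_derivative: "((\<lambda>t. m * t + k) has_vector_derivative (m :: real)) (at t within S)"
  by (auto intro!: derivative_eq_intros simp: has_vector_derivative_def)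

lemma affine_chain:
  assumes "(f has_vector_derivative w) (at (m * t + k :: real) within (\<lambda>t. m * t + k) ` S)"
  shows "((\<lambda>t. f (m * t + k)) has_vector_derivative m *\<^sub>R w) (at t within S)"
  using vector_diff_chain_within[OF affine_has_vector_derivative, of f w m t k S] assms by (simp add: o_def)

lemma smooth_on_interval_affine:
  assumes f: "smooth_on_interval l' r' f" and im: "(\<lambda>t. m * t + k) ` {l..r} = {l'..r'}"
  shows "smooth_on_interval l r (\<lambda>t. f (m * t + k))"
proof -
  obtain D where D: "\<And>t. t \<in> {l'..r'} \<Longrightarrow> D 0 t = f t"
    "\<And>n t. t \<in> {l'..r'} \<Longrightarrow> (D n has_vector_derivative D (Suc n) t) (at t within {l'..r'})"
    using f unfolding smooth_on_interval_def by blast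
  have mem: "m * t + k \<in> {l'..r'}" if "t \<in> {l..r}" for t using that im by blast
  have "((\<lambda>t. m ^ n *\<^sub>R D n (m * t + k)) has_vector_derivative m ^ Suc n *\<^sub>R D (Suc n) (m * t + k))
      (at t within {l..r})" if "t \<in> {l..r}" for n t
  proof -
    have "((\<lambda>t. D n (m * t + k)) has_vector_derivative m *\<^sub>R D (Suc n) (m * t + k)) (at t within {l..r})"
      by (rule affine_chain) (simp only: im D(2)[OF mem[OF that]])
    from bounded_linear.has_vector_derivative[OF bounded_linear_scaleR_right this, of "m ^ n"]
    show ?thesis by (simp add: mult.commute)
  qed
  then show ?thesis unfolding smooth_on_interval_def
    by (intro exI[of _ "\<lambda>n t. m ^ n *\<^sub>R D n (m * t + k)"]) (use D(1) mem in auto)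
qed

text \<open>For \<open>m < 0\<close> the image interval is traversed backwards, so reparametrisations include the
  reversal of a curve.\<close>

lemma affine_image:
  assumes "m \<noteq> 0" "l \<le> r"
  obtains l' r' :: real where "(\<lambda>t. m * t + k) ` {l..r} = {l'..r'}" "l' \<le> r'" "l < r \<Longrightarrow> l' < r'"
    "(\<lambda>t. m * t + k) ` {l<..<r} = {l'<..<r'}"
    "(\<lambda>t. inverse m * t + (- k / m)) ` {l'..r'} = {l..r}"
proof -
  have inv: "inverse m * (m * t + k) + (- k / m) = t" "m * (inverse m * t + (- k / m)) + k = t" for t
    using assms(1) by (simp_all add: field_simps)
  define l' where "l' = (if m > 0 then m * l + k else m * r + k)"
  define r' where "r' = (if m > 0 then m * r + k else m * l + k)"
  have mem: "m * t + k \<in> {l'..r'} \<longleftrightarrow> t \<in> {l..r}" "m * t + k \<in> {l'<..<r'} \<longleftrightarrow> t \<in> {l<..<r}" for t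
    using assms(1) by (auto simp: l'_def r'_def)
  have 1: "(\<lambda>t. m * t + k) ` {l..r} = {l'..r'}"
    using mem(1) inv by (metis (no_types, lifting) image_iff set_eqI)
  have 2: "(\<lambda>t. m * t + k) ` {l<..<r} = {l'<..<r'}"
    using mem(2) inv by (metis (no_types, lifting) image_iff set_eqI)
  have 3: "(\<lambda>t. inverse m * t + (- k / m)) ` {l'..r'} = {l..r}"
    unfolding 1[symmetric] image_image inv by simp
  have "l' \<le> r'" "l < r \<Longrightarrow> l' < r'" using assms by (auto simp: l'_def r'_def mult_left_mono mult_left_mono_neg)
  with 1 2 3 show thesis using that by blast
qed

lemma smooth_on_interval_along_line:
  assumes f: "\<And>n. ck_on n S f" and S: "\<And>t. t \<in> {l..r} \<Longrightarrow> x + t *\<^sub>R h \<in> S"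
  shows "smooth_on_interval l r (\<lambda>t. f (x + t *\<^sub>R h))"
proof -
  define D where "D n = ((\<lambda>f y. frechet_derivative f (at y) h) ^^ n) f" for n
  have DS: "D (Suc n) = (\<lambda>y. frechet_derivative (D n) (at y) h)" for n by (simp add: D_def)
  have ck: "ck_on m S (D n)" for m n
  proof (induction n arbitrary: m)
    case 0 then show ?case using f by (simp add: D_def)
  next
    case (Suc n)
    show ?case using Suc.IH[of "Suc m"] unfolding DS by (metis ck_on.simps(2))
  qed
  have "((\<lambda>t. D n (x + t *\<^sub>R h)) has_vector_derivative D (Suc n) (x + t *\<^sub>R h)) (at t within {l..r})"
    if t: "t \<in> {l..r}" for n t
  proof -
    note D = ck_on_Suc_has_derivative[OF ck[of "Suc 0" n] S[OF t]]
    have "((\<lambda>t. x + t *\<^sub>R h) has_derivative (\<lambda>s. s *\<^sub>R h)) (at t within {l..r})"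
      by (auto intro!: derivative_eq_intros)
    from has_derivative_compose[OF this D]
    show ?thesis unfolding has_vector_derivative_def
      by (simp add: linear_scale[OF has_derivative_linear[OF D]] DS)
  qed
  then show ?thesis unfolding smooth_on_interval_def
    by (intro exI[of _ "\<lambda>n t. D n (x + t *\<^sub>R h)"]) (auto simp: D_def)
qed

context lorentz_manifold
begin

section \<open>Parallel fields along curves\<close>

text \<open>Smooth curves and parallel fields are considered on arbitrary intervals, which allows curves to be
  cut into pieces and joined.\<close>

definition smooth_curve_on :: "(real \<Rightarrow> 'a) \<Rightarrow> real \<Rightarrow> real \<Rightarrow> bool" where
  "smooth_curve_on \<gamma> a b \<longleftrightarrow> continuous_on {a..b} \<gamma> \<and> \<gamma> ` {a..b} \<subseteq> M \<and>
     (\<exists>S. finite S \<and> (\<forall>c\<in>A. \<forall>l r. a \<le> l \<and> l < r \<and> r \<le> b \<and> {l<..<r} \<inter> S = {} \<and>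
        \<gamma> ` {l..r} \<subseteq> chart_dom c \<longrightarrow> smooth_on_interval l r (chart_map c \<circ> \<gamma>)))"

lemma smooth_curve_onE:
  assumes "smooth_curve_on \<gamma> a b"
  obtains S where "finite S" "\<And>c l r. c \<in> A \<Longrightarrow> a \<le> l \<Longrightarrow> l < r \<Longrightarrow> r \<le> b \<Longrightarrow> {l<..<r} \<inter> S = {} \<Longrightarrow>
      \<gamma> ` {l..r} \<subseteq> chart_dom c \<Longrightarrow> smooth_on_interval l r (chart_map c \<circ> \<gamma>)"
proof -
  have "\<exists>S. finite S \<and> (\<forall>c\<in>A. \<forall>l r. a \<le> l \<and> l < r \<and> r \<le> b \<and> {l<..<r} \<inter> S = {} \<and>
        \<gamma> ` {l..r} \<subseteq> chart_dom c \<longrightarrow> smooth_on_interval l r (chart_map c \<circ> \<gamma>))"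
    using assms unfolding smooth_curve_on_def by (elim conjE)
  then obtain S where S: "finite S" "\<forall>c\<in>A. \<forall>l r. a \<le> l \<and> l < r \<and> r \<le> b \<and> {l<..<r} \<inter> S = {} \<and>
        \<gamma> ` {l..r} \<subseteq> chart_dom c \<longrightarrow> smooth_on_interval l r (chart_map c \<circ> \<gamma>)" by (elim exE conjE)
  show thesis by (rule that[OF S(1)]) (simp add: S(2))
qed

lemma smooth_curve_onI:
  assumes "continuous_on {a..b} \<gamma>" "\<gamma> ` {a..b} \<subseteq> M" "finite S"
    "\<And>c l r. c \<in> A \<Longrightarrow> a \<le> l \<Longrightarrow> l < r \<Longrightarrow> r \<le> b \<Longrightarrow> {l<..<r} \<inter> S = {} \<Longrightarrow>
      \<gamma> ` {l..r} \<subseteq> chart_dom c \<Longrightarrow> smooth_on_interval l r (chart_map c \<circ> \<gamma>)"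
  shows "smooth_curve_on \<gamma> a b"
  unfolding smooth_curve_on_def by (intro conjI assms(1,2) exI[of _ S] assms(3) ballI allI impI) (simp add: assms(4))

text \<open>The velocity \<open>w\<close> is quantified instead of being a \<open>vector_derivative\<close>: a derivative within an
  interval is also one within each subinterval, so the equation passes to pieces of a curve.\<close>

definition solves_on ::
  "('a, (real, 'n) vec) chart \<Rightarrow> (real \<Rightarrow> 'a) \<Rightarrow> (real \<Rightarrow> ('a, (real, 'n) vec) tangent_vector) \<Rightarrow> real set \<Rightarrow> bool" where
  "solves_on c \<gamma> X I \<longleftrightarrow> (\<forall>t\<in>I. \<forall>w. ((chart_map c \<circ> \<gamma>) has_vector_derivative w) (at t within I) \<longrightarrow>
     ((\<lambda>s. X s c) has_vector_derivative - Gam c (chart_map c (\<gamma> t)) w (X t c)) (at t within I))"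

definition parallel_on :: "(real \<Rightarrow> 'a) \<Rightarrow> (real \<Rightarrow> ('a, (real, 'n) vec) tangent_vector) \<Rightarrow> real \<Rightarrow> real \<Rightarrow> bool" where
  "parallel_on \<gamma> X a b \<longleftrightarrow> (\<forall>t\<in>{a..b}. X t \<in> tangent_space A (\<gamma> t)) \<and>
     (\<forall>c\<in>A. \<forall>l r. a \<le> l \<and> l < r \<and> r \<le> b \<and> \<gamma> ` {l..r} \<subseteq> chart_dom c \<and>
        smooth_on_interval l r (chart_map c \<circ> \<gamma>) \<longrightarrow> solves_on c \<gamma> X {l..r})"

lemma piecewise_smooth_curve_iff: "piecewise_smooth_curve M A \<gamma> \<longleftrightarrow> smooth_curve_on \<gamma> 0 1"
  unfolding piecewise_smooth_curve_def smooth_curve_on_def by simp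

lemma parallel_along_iff: "parallel_along A g \<gamma> X \<longleftrightarrow> parallel_on \<gamma> X 0 1"
proof -
  have "solves_on c \<gamma> X {l..r} \<longleftrightarrow> (\<forall>t\<in>{l..r}. ((\<lambda>s. X s c) has_vector_derivative
            - christoffel_map A g c (chart_map c (\<gamma> t))
                (vector_derivative (chart_map c \<circ> \<gamma>) (at t within {l..r})) (X t c))
          (at t within {l..r}))"
    if "l < r" "smooth_on_interval l r (chart_map c \<circ> \<gamma>)" for c l r
  proof -
    have "((chart_map c \<circ> \<gamma>) has_vector_derivative w) (at t within {l..r}) \<longleftrightarrow>
        w = vector_derivative (chart_map c \<circ> \<gamma>) (at t within {l..r})" if t: "t \<in> {l..r}" for t w
    proof -
      obtain v where v: "((chart_map c \<circ> \<gamma>) has_vector_derivative v) (at t within {l..r})"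
        using smooth_on_interval_derivative[OF \<open>smooth_on_interval l r _\<close> t] by blast
      have "w = vector_derivative (chart_map c \<circ> \<gamma>) (at t within {l..r})"
        if "((chart_map c \<circ> \<gamma>) has_vector_derivative w) (at t within {l..r})" for w
        using vector_derivative_within_cbox[of l r t "chart_map c \<circ> \<gamma>" w] \<open>l < r\<close> t that
        by (simp add: cbox_interval)
      with v show ?thesis by metis
    qed
    then show ?thesis unfolding solves_on_def christoffel_map_conn by simp
  qed
  then show ?thesis unfolding parallel_along_def parallel_on_def
    by (intro arg_cong2[where f = "(\<and>)"] ball_cong refl all_cong1 imp_cong) auto
qed

lemma smooth_curve_on_affine:
  assumes \<gamma>: "smooth_curve_on \<gamma> a' b'" and m: "m \<noteq> 0" and im: "(\<lambda>t. m * t + k) ` {a..b} = {a'..b'}"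
  shows "smooth_curve_on (\<lambda>t. \<gamma> (m * t + k)) a b"
proof -
  let ?\<sigma> = "\<lambda>t. m * t + k"
  have cont: "continuous_on {a'..b'} \<gamma>" and M: "\<gamma> ` {a'..b'} \<subseteq> M"
    using \<gamma> unfolding smooth_curve_on_def by auto
  have cont': "continuous_on {a..b} (\<lambda>t. \<gamma> (m * t + k))"
    by (rule continuous_on_compose2[OF cont]) (use im in \<open>auto intro!: continuous_intros simp del: image_affinity_atLeastAtMost\<close>)
  have M': "(\<lambda>t. \<gamma> (m * t + k)) ` {a..b} \<subseteq> M" using M im by blast
  obtain S where S: "finite S" "\<And>c l r. c \<in> A \<Longrightarrow> a' \<le> l \<Longrightarrow> l < r \<Longrightarrow> r \<le> b' \<Longrightarrow> {l<..<r} \<inter> S = {} \<Longrightarrow>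
      \<gamma> ` {l..r} \<subseteq> chart_dom c \<Longrightarrow> smooth_on_interval l r (chart_map c \<circ> \<gamma>)"
    by (rule smooth_curve_onE[OF \<gamma>]) (rule that)
  let ?S = "?\<sigma> -` S"
  have fin: "finite ?S" by (rule finite_vimageI[OF S(1)]) (use m in \<open>auto simp: inj_def\<close>)
  have "smooth_on_interval l r (chart_map c \<circ> (\<lambda>t. \<gamma> (m * t + k)))"
    if c: "c \<in> A" "a \<le> l" "l < r" "r \<le> b" "{l<..<r} \<inter> ?S = {}" "(\<lambda>t. \<gamma> (m * t + k)) ` {l..r} \<subseteq> chart_dom c" for c l r
  proof -
    obtain l' r' where lr: "?\<sigma> ` {l..r} = {l'..r'}" "l' < r'" "?\<sigma> ` {l<..<r} = {l'<..<r'}"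
      using affine_image[OF m, of l r k] c(3) by (metis less_imp_le)
    have "{l'..r'} \<subseteq> {a'..b'}" unfolding lr(1)[symmetric] im[symmetric] using c by (intro image_mono) auto
    moreover have "{l'<..<r'} \<inter> S = {}" unfolding lr(3)[symmetric] using c(5) by auto
    moreover have "\<gamma> ` {l'..r'} \<subseteq> chart_dom c" unfolding lr(1)[symmetric] using c(6) by blast
    ultimately have "smooth_on_interval l' r' (chart_map c \<circ> \<gamma>)" using S(2)[OF c(1), of l' r'] lr(2) by auto
    from smooth_on_interval_affine[OF this lr(1)] show ?thesis by (simp add: o_def)
  qed
  then show ?thesis by (rule smooth_curve_onI[OF cont' M' fin])
qed

lemma parallel_on_affine:
  assumes X: "parallel_on \<gamma> X a' b'" and m: "m \<noteq> 0" and im: "(\<lambda>t. m * t + k) ` {a..b} = {a'..b'}"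
  shows "parallel_on (\<lambda>t. \<gamma> (m * t + k)) (\<lambda>t. X (m * t + k)) a b"
  unfolding parallel_on_def
proof (intro conjI ballI allI impI)
  let ?\<sigma> = "\<lambda>t. m * t + k"
  show "X (m * t + k) \<in> tangent_space A (\<gamma> (m * t + k))" if "t \<in> {a..b}" for t
    using X im that unfolding parallel_on_def by blast
  fix c l r
  assume c: "c \<in> A" and "a \<le> l \<and> l < r \<and> r \<le> b \<and> (\<lambda>t. \<gamma> (m * t + k)) ` {l..r} \<subseteq> chart_dom c \<and>
        smooth_on_interval l r (chart_map c \<circ> (\<lambda>t. \<gamma> (m * t + k)))"
  then have h: "a \<le> l" "l < r" "r \<le> b" "(\<lambda>t. \<gamma> (m * t + k)) ` {l..r} \<subseteq> chart_dom c"
    "smooth_on_interval l r (chart_map c \<circ> (\<lambda>t. \<gamma> (m * t + k)))" by auto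
  obtain l' r' where lr: "?\<sigma> ` {l..r} = {l'..r'}" "l' < r'"
    and inv: "(\<lambda>t. inverse m * t + (- k / m)) ` {l'..r'} = {l..r}"
    using affine_image[OF m, of l r k] h(2) by (metis less_imp_le)
  have i: "m * (inverse m * t + - k / m) + k = t" "inverse m * (m * t + k) + - k / m = t" for t
    using m by (simp_all add: field_simps)
  have "{l'..r'} \<subseteq> {a'..b'}" unfolding lr(1)[symmetric] im[symmetric] using h by (intro image_mono) auto
  moreover have "\<gamma> ` {l'..r'} \<subseteq> chart_dom c" unfolding lr(1)[symmetric] using h(4) by blast
  moreover have "smooth_on_interval l' r' (chart_map c \<circ> \<gamma>)"
    using smooth_on_interval_affine[OF h(5) inv] unfolding o_def i .
  ultimately have sol: "solves_on c \<gamma> X {l'..r'}" using X c lr(2) unfolding parallel_on_def by auto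
  show "solves_on c (\<lambda>t. \<gamma> (m * t + k)) (\<lambda>t. X (m * t + k)) {l..r}"
    unfolding solves_on_def
  proof (intro ballI allI impI)
    fix t w
    assume t: "t \<in> {l..r}" and w: "((chart_map c \<circ> (\<lambda>t. \<gamma> (m * t + k))) has_vector_derivative w) (at t within {l..r})"
    have t': "m * t + k \<in> {l'..r'}" using t lr(1) by blast
    have "((chart_map c \<circ> \<gamma>) has_vector_derivative inverse m *\<^sub>R w) (at (m * t + k) within {l'..r'})"
      using affine_chain[of "chart_map c \<circ> (\<lambda>t. \<gamma> (m * t + k))" w "inverse m" "m * t + k" "- k / m" "{l'..r'}"]
        w unfolding i inv o_def by simp
    then have "((\<lambda>s. X s c) has_vector_derivative
        - Gam c (chart_map c (\<gamma> (m * t + k))) (inverse m *\<^sub>R w) (X (m * t + k) c)) (at (m * t + k) within {l'..r'})"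
      using sol t' unfolding solves_on_def by blast
    from affine_chain[OF this[folded lr(1)]] m
    show "((\<lambda>s. X (m * s + k) c) has_vector_derivative
        - Gam c (chart_map c (\<gamma> (m * t + k))) w (X (m * t + k) c)) (at t within {l..r})"
      by (simp add: linear_scale[OF linear_conn_left])
  qed
qed

lemma smooth_curve_on_cong:
  assumes \<gamma>: "smooth_curve_on \<gamma> a b" and eq: "\<And>t. t \<in> {a..b} \<Longrightarrow> \<gamma> t = \<gamma>' t"
  shows "smooth_curve_on \<gamma>' a b"
proof -
  have im: "\<gamma>' ` {l..r} = \<gamma> ` {l..r}" if "a \<le> l" "r \<le> b" for l r
    using eq that by (intro image_cong refl) auto
  have "continuous_on {a..b} \<gamma>'"
    using \<gamma> continuous_on_cong[OF refl, of "{a..b}" \<gamma> \<gamma>'] eq unfolding smooth_curve_on_def by blast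
  moreover have "smooth_on_interval l r (chart_map c \<circ> \<gamma>')"
    if "smooth_on_interval l r (chart_map c \<circ> \<gamma>)" "a \<le> l" "r \<le> b" for c l r
    by (rule smooth_on_interval_cong[OF that(1)]) (use eq that in auto)
  ultimately show ?thesis using \<gamma> im unfolding smooth_curve_on_def by (metis (no_types, lifting) order.refl)
qed

lemma parallel_on_cong:
  assumes X: "parallel_on \<gamma> X a b" and eq: "\<And>t. t \<in> {a..b} \<Longrightarrow> \<gamma> t = \<gamma>' t" "\<And>t. t \<in> {a..b} \<Longrightarrow> X t = X' t"
  shows "parallel_on \<gamma>' X' a b"
  unfolding parallel_on_def
proof (intro conjI ballI allI impI)
  show "X' t \<in> tangent_space A (\<gamma>' t)" if "t \<in> {a..b}" for t
    using X that unfolding parallel_on_def eq(1)[OF that, symmetric] eq(2)[OF that, symmetric] by blast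
  fix c l r
  assume c: "c \<in> A" and h: "a \<le> l \<and> l < r \<and> r \<le> b \<and> \<gamma>' ` {l..r} \<subseteq> chart_dom c \<and>
        smooth_on_interval l r (chart_map c \<circ> \<gamma>')"
  have e: "\<gamma> t = \<gamma>' t" "X t = X' t" if "t \<in> {l..r}" for t using eq[of t] that h by auto
  have "\<gamma> ` {l..r} = \<gamma>' ` {l..r}" using e by (intro image_cong refl) auto
  moreover have "smooth_on_interval l r (chart_map c \<circ> \<gamma>)"
    using h smooth_on_interval_cong[of l r "chart_map c \<circ> \<gamma>'"] e by simp
  ultimately have s: "solves_on c \<gamma> X {l..r}" using X c h unfolding parallel_on_def by auto
  show "solves_on c \<gamma>' X' {l..r}"
    unfolding solves_on_def
  proof (intro ballI allI impI)
    fix t w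
    assume t: "t \<in> {l..r}" and w: "((chart_map c \<circ> \<gamma>') has_vector_derivative w) (at t within {l..r})"
    have "((chart_map c \<circ> \<gamma>) has_vector_derivative w) (at t within {l..r})"
      by (rule has_vector_derivative_transform[OF t _ w]) (simp add: e)
    then have "((\<lambda>s. X s c) has_vector_derivative - Gam c (chart_map c (\<gamma> t)) w (X t c)) (at t within {l..r})"
      using s t unfolding solves_on_def by blast
    then have "((\<lambda>s. X' s c) has_vector_derivative - Gam c (chart_map c (\<gamma> t)) w (X t c)) (at t within {l..r})"
      by (rule has_vector_derivative_transform[OF t, rotated]) (simp add: e)
    then show "((\<lambda>s. X' s c) has_vector_derivative - Gam c (chart_map c (\<gamma>' t)) w (X' t c)) (at t within {l..r})"
      by (simp add: e[OF t])
  qed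
qed

lemma smooth_curve_on_join:
  assumes "a \<le> b" "b \<le> e" "smooth_curve_on \<gamma> a b" "smooth_curve_on \<gamma> b e"
  shows "smooth_curve_on \<gamma> a e"
proof -
  obtain S where S: "finite S" "\<And>c l r. c \<in> A \<Longrightarrow> a \<le> l \<Longrightarrow> l < r \<Longrightarrow> r \<le> b \<Longrightarrow> {l<..<r} \<inter> S = {} \<Longrightarrow>
      \<gamma> ` {l..r} \<subseteq> chart_dom c \<Longrightarrow> smooth_on_interval l r (chart_map c \<circ> \<gamma>)"
    by (rule smooth_curve_onE[OF assms(3)]) (rule that)
  obtain S' where S': "finite S'" "\<And>c l r. c \<in> A \<Longrightarrow> b \<le> l \<Longrightarrow> l < r \<Longrightarrow> r \<le> e \<Longrightarrow> {l<..<r} \<inter> S' = {} \<Longrightarrow>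
      \<gamma> ` {l..r} \<subseteq> chart_dom c \<Longrightarrow> smooth_on_interval l r (chart_map c \<circ> \<gamma>)"
    by (rule smooth_curve_onE[OF assms(4)]) (rule that)
  have ab: "{a..e} = {a..b} \<union> {b..e}" using assms by auto
  have cont: "continuous_on {a..e} \<gamma>"
    unfolding ab using assms(3,4) by (intro continuous_on_closed_Un) (auto simp: smooth_curve_on_def)
  have im: "\<gamma> ` {a..e} \<subseteq> M" unfolding ab using assms(3,4) by (auto simp: smooth_curve_on_def)
  have fin: "finite (S \<union> S' \<union> {b})" using S(1) S'(1) by simp
  have "smooth_on_interval l r (chart_map c \<circ> \<gamma>)"
    if h: "c \<in> A" "a \<le> l" "l < r" "r \<le> e" "{l<..<r} \<inter> (S \<union> S' \<union> {b}) = {}" "\<gamma> ` {l..r} \<subseteq> chart_dom c" for c l r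
  proof (cases "r \<le> b")
    case True
    then show ?thesis using S(2)[of c l r] h by blast
  next
    case False
    then have "b \<le> l" using h(3,5) by (force simp: not_le)
    then show ?thesis using S'(2)[of c l r] h by blast
  qed
  then show ?thesis by (rule smooth_curve_onI[OF cont im fin])
qed

text \<open>On an interval across \<open>b\<close> the equation holds on both sides with the same velocity, and the two
  one-sided derivatives combine.\<close>

lemma parallel_on_join:
  assumes "a \<le> b" "b \<le> e" "parallel_on \<gamma> X a b" "parallel_on \<gamma> X b e"
  shows "parallel_on \<gamma> X a e"
  unfolding parallel_on_def
proof (intro conjI ballI allI impI)
  show "X t \<in> tangent_space A (\<gamma> t)" if "t \<in> {a..e}" for t
    using assms that unfolding parallel_on_def by (cases "t \<le> b") auto
  fix c l r
  assume c: "c \<in> A" and "a \<le> l \<and> l < r \<and> r \<le> e \<and> \<gamma> ` {l..r} \<subseteq> chart_dom c \<and>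
        smooth_on_interval l r (chart_map c \<circ> \<gamma>)"
  then have h: "a \<le> l" "l < r" "r \<le> e" "\<gamma> ` {l..r} \<subseteq> chart_dom c" "smooth_on_interval l r (chart_map c \<circ> \<gamma>)" by auto
  consider "r \<le> b" | "b \<le> l" | "l < b" "b < r" by linarith
  then show "solves_on c \<gamma> X {l..r}"
  proof cases
    case 1
    then show ?thesis using assms(3) c h unfolding parallel_on_def by blast
  next
    case 2
    then show ?thesis using assms(4) c h unfolding parallel_on_def by blast
  next
    case 3
    have "smooth_on_interval l b (chart_map c \<circ> \<gamma>)" "smooth_on_interval b r (chart_map c \<circ> \<gamma>)"
      using smooth_on_interval_subset[OF h(5)] 3 by auto
    moreover have "\<gamma> ` {l..b} \<subseteq> chart_dom c" "\<gamma> ` {b..r} \<subseteq> chart_dom c" using h(4) 3 by auto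
    ultimately have s: "solves_on c \<gamma> X {l..b}" "solves_on c \<gamma> X {b..r}"
      using assms(3,4) c h 3 unfolding parallel_on_def by blast+
    show ?thesis unfolding solves_on_def
    proof (intro ballI allI impI)
      fix t w
      assume w: "((chart_map c \<circ> \<gamma>) has_vector_derivative w) (at t within {l..r})"
      let ?Y = "\<lambda>I. ((\<lambda>s. X s c) has_vector_derivative - Gam c (chart_map c (\<gamma> t)) w (X t c)) (at t within I)"
      have part: "?Y I" if "solves_on c \<gamma> X I" "closed I" "I \<subseteq> {l..r}" for I
        using that has_vector_derivative_within_subset[OF w that(3)] has_vector_derivative_within_outside[OF that(2)]
        unfolding solves_on_def by (cases "t \<in> I") auto
      have "?Y ({l..b} \<union> {b..r})"
        by (intro has_vector_derivative_Un part s) (use 3 in auto)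
      moreover have "{l..b} \<union> {b..r} = {l..r}" using 3 by auto
      ultimately show "?Y {l..r}" by simp
    qed
  qed
qed

lemma parallel_on_sum:
  assumes "\<And>i. i \<in> I \<Longrightarrow> parallel_on \<gamma> (X i) a b"
  shows "parallel_on \<gamma> (\<lambda>t c. \<Sum>i\<in>I. u i *\<^sub>R X i t c) a b"
  unfolding parallel_on_def
proof (intro conjI ballI allI impI)
  show "(\<lambda>c. \<Sum>i\<in>I. u i *\<^sub>R X i t c) \<in> tangent_space A (\<gamma> t)" if "t \<in> {a..b}" for t
    using assms that by (intro tangent_space_sum) (auto simp: parallel_on_def)
  fix c l r
  assume c: "c \<in> A" and h: "a \<le> l \<and> l < r \<and> r \<le> b \<and> \<gamma> ` {l..r} \<subseteq> chart_dom c \<and>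
        smooth_on_interval l r (chart_map c \<circ> \<gamma>)"
  have s: "solves_on c \<gamma> (X i) {l..r}" if "i \<in> I" for i
    using assms[OF that] c h unfolding parallel_on_def by blast
  show "solves_on c \<gamma> (\<lambda>t c. \<Sum>i\<in>I. u i *\<^sub>R X i t c) {l..r}"
    unfolding solves_on_def
  proof (intro ballI allI impI)
    fix t w
    assume t: "t \<in> {l..r}" "((chart_map c \<circ> \<gamma>) has_vector_derivative w) (at t within {l..r})"
    have "((\<lambda>s. \<Sum>i\<in>I. u i *\<^sub>R X i s c) has_vector_derivative
        (\<Sum>i\<in>I. u i *\<^sub>R (- Gam c (chart_map c (\<gamma> t)) w (X i t c)))) (at t within {l..r})"
      using s t unfolding solves_on_def
      by (intro has_vector_derivative_sum bounded_linear.has_vector_derivative[OF bounded_linear_scaleR_right]) blast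
    then show "((\<lambda>s. \<Sum>i\<in>I. u i *\<^sub>R X i s c) has_vector_derivative
        - Gam c (chart_map c (\<gamma> t)) w (\<Sum>i\<in>I. u i *\<^sub>R X i t c)) (at t within {l..r})"
      by (simp add: linear_sum[OF linear_conn_right] linear_scale[OF linear_conn_right] sum_negf)
  qed
qed

text \<open>Each parameter has, on either side, a neighbourhood on which the curve is smooth and stays in
  one chart; the equivalence classes of \<open>R\<close> are therefore open in the connected unit interval.\<close>

lemma along_smooth_curve:
  assumes \<gamma>: "smooth_curve_on \<gamma> 0 1"
    and R: "\<And>s. s \<in> {0..1} \<Longrightarrow> R s s"
      "\<And>s t. R s t \<Longrightarrow> s \<in> {0..1} \<Longrightarrow> t \<in> {0..1} \<Longrightarrow> R t s"
      "\<And>s t u. R s t \<Longrightarrow> R t u \<Longrightarrow> s \<in> {0..1} \<Longrightarrow> t \<in> {0..1} \<Longrightarrow> u \<in> {0..1} \<Longrightarrow> R s u"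
    and piece: "\<And>c l r. c \<in> A \<Longrightarrow> 0 \<le> l \<Longrightarrow> l < r \<Longrightarrow> r \<le> 1 \<Longrightarrow> \<gamma> ` {l..r} \<subseteq> chart_dom c \<Longrightarrow>
      smooth_on_interval l r (chart_map c \<circ> \<gamma>) \<Longrightarrow> R l r"
    and ab: "a \<in> {0..1}" "b \<in> {0..1}"
  shows "R a b"
proof (rule connected_equivalence_relation[of "{0..1::real}"])
  fix t :: real assume t: "t \<in> {0..1}"
  obtain S where S: "finite S" "\<And>c l r. c \<in> A \<Longrightarrow> 0 \<le> l \<Longrightarrow> l < r \<Longrightarrow> r \<le> 1 \<Longrightarrow> {l<..<r} \<inter> S = {} \<Longrightarrow>
      \<gamma> ` {l..r} \<subseteq> chart_dom c \<Longrightarrow> smooth_on_interval l r (chart_map c \<circ> \<gamma>)"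
    by (rule smooth_curve_onE[OF \<gamma>]) (rule that)
  have cont: "continuous_on {0..1} \<gamma>" and M: "\<gamma> ` {0..1} \<subseteq> M"
    using \<gamma> unfolding smooth_curve_on_def by auto
  obtain c where c: "c \<in> A" "\<gamma> t \<in> chart_dom c" using chart_around M t by blast
  have "openin (top_of_set {0..1}) ({0..1} \<inter> \<gamma> -` chart_dom c)"
    using continuous_openin_preimage[OF cont _ openin_chart_dom[OF c(1)]] M by auto
  then have "\<exists>e>0. \<forall>s\<in>{0..1}. dist s t < e \<longrightarrow> s \<in> {0..1} \<inter> \<gamma> -` chart_dom c"
    using c t unfolding openin_euclidean_subtopology_iff by blast
  then obtain d1 where d1: "d1 > 0" "\<And>s. s \<in> {0..1} \<Longrightarrow> dist s t < d1 \<Longrightarrow> \<gamma> s \<in> chart_dom c"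
    by blast
  obtain d2 where d2: "d2 > 0" "\<And>s. s \<in> S \<Longrightarrow> s \<noteq> t \<Longrightarrow> d2 \<le> dist t s"
    using finite_set_avoid[OF S(1), of t] by blast
  define d where "d = min d1 d2"
  have "R t s" if s: "s \<in> {0..1}" "dist s t < d" for s
  proof (cases "s = t")
    case False
    define l where "l = min s t"
    define r where "r = max s t"
    have lr: "0 \<le> l" "l < r" "r \<le> 1" using s t False by (auto simp: l_def r_def)
    have near: "u \<in> {0..1} \<and> dist u t < d" if "u \<in> {l..r}" for u
      using s(2) lr that by (auto simp: l_def r_def dist_real_def)
    have "\<gamma> ` {l..r} \<subseteq> chart_dom c"
      using d1(2) near by (auto simp: d_def)
    moreover have "u \<notin> S" if "u \<in> {l<..<r}" for u
      using d2(2)[of u] near[of u] that by (auto simp: d_def l_def r_def dist_commute min_less_iff_disj less_max_iff_disj)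
    then have "{l<..<r} \<inter> S = {}" by blast
    ultimately have "R l r"
      using piece[OF c(1) lr] S(2)[OF c(1) lr] by blast
    then show ?thesis using R(2)[of s t] s t by (cases "s < t") (auto simp: l_def r_def)
  qed (use R(1) t in simp)
  moreover have "d > 0" using d1 d2 by (simp add: d_def)
  ultimately show "\<exists>T. openin (top_of_set {0..1}) T \<and> t \<in> T \<and> (\<forall>s\<in>T. R t s)"
    using t by (intro exI[of _ "{0..1} \<inter> ball t d"]) (auto simp: dist_commute openin_open)
qed (simp, rule ab, rule ab, erule R(2), assumption+, erule R(3), assumption+)

text \<open>In a chart the derivative of the product is a sum of two terms, one with the covariant derivative
  of \<open>X\<close> along the curve and one with that of \<open>Y\<close>, and both vanish.\<close>

lemma parallel_preserves_metric:
  assumes \<gamma>: "smooth_curve_on \<gamma> 0 1" and X: "parallel_on \<gamma> X 0 1" and Y: "parallel_on \<gamma> Y 0 1"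
    and ab: "a \<in> {0..1}" "b \<in> {0..1}"
  shows "g (\<gamma> a) (X a) (Y a) = g (\<gamma> b) (X b) (Y b)"
proof (rule along_smooth_curve[OF \<gamma>, of "\<lambda>s t. g (\<gamma> s) (X s) (Y s) = g (\<gamma> t) (X t) (Y t)"])
  fix c l r
  assume c: "c \<in> A" and lr: "0 \<le> l" "l < r" "r \<le> 1" and dom: "\<gamma> ` {l..r} \<subseteq> chart_dom c"
    and sm: "smooth_on_interval l r (chart_map c \<circ> \<gamma>)"
  define h where "h t = coord_metric c (chart_map c (\<gamma> t)) (X t c) (Y t c)" for t
  have gh: "g (\<gamma> t) (X t) (Y t) = h t" if "t \<in> {l..r}" for t
    unfolding h_def using that X Y dom lr by (intro g_coords[OF c]) (auto simp: parallel_on_def)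
  have "(h has_derivative (\<lambda>s. 0)) (at t within {l..r})" if t: "t \<in> {l..r}" for t
  proof -
    obtain w where w: "((chart_map c \<circ> \<gamma>) has_vector_derivative w) (at t within {l..r})"
      using smooth_on_interval_derivative[OF sm t] by blast
    have sol: "((\<lambda>s. X s c) has_vector_derivative - Gam c (chart_map c (\<gamma> t)) w (X t c)) (at t within {l..r})"
      "((\<lambda>s. Y s c) has_vector_derivative - Gam c (chart_map c (\<gamma> t)) w (Y t c)) (at t within {l..r})"
      using X Y c lr dom sm t w unfolding parallel_on_def solves_on_def by blast+
    have "chart_map c (\<gamma> t) \<in> img c" using dom t by blast
    from coord_metric_has_derivative[OF c, of "chart_map c \<circ> \<gamma>" t, unfolded o_def, OF this
        w[unfolded has_vector_derivative_def o_def] sol[unfolded has_vector_derivative_def]]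
    show ?thesis
      unfolding h_def by (simp add: linear_scale[OF linear_conn_left] linear_0[OF coord_metric_linear_left] linear_0[OF coord_metric_linear_right])
  qed
  then obtain k where "\<And>t. t \<in> {l..r} \<Longrightarrow> h t = k"
    using has_derivative_zero_constant[of "{l..r}" h] by auto
  then show "g (\<gamma> l) (X l) (Y l) = g (\<gamma> r) (X r) (Y r)" using gh lr by simp
qed (use ab in auto)

section \<open>Parallel transport along coordinate segments\<close>

text \<open>The radius is such that the length of every segment in the ball, times a bound \<open>K\<close> for the
  connection coefficients, is at most \<open>1/2\<close>.\<close>

lemma segment_equation_solvable:
  assumes c: "c \<in> A" and x: "x \<in> img c"
  obtains r where "r > 0" "ball x r \<subseteq> img c"
    "\<And>y z v. y \<in> ball x r \<Longrightarrow> z \<in> ball x r \<Longrightarrow> \<exists>Y. Y 0 = v \<and> (\<forall>t\<in>{0..1}. (Y has_vector_derivative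
        - Gam c (y + t *\<^sub>R (z - y)) (z - y) (Y t)) (at t within {0..1}))"
proof -
  let ?N = "\<lambda>y. coeff_norm (christoffel A g c y)"
  define K where "K = ?N x + 1"
  have K: "K > 0" unfolding K_def by (simp add: coeff_norm_nonneg add_nonneg_pos)
  have "continuous_on (img c) ?N"
    by (intro continuous_on_coeff_norm christoffel_continuous c)
  then have "isCont ?N x" using open_img[OF c] x continuous_on_eq_continuous_at by blast
  then obtain d1 where d1: "d1 > 0" "\<And>y. dist y x < d1 \<Longrightarrow> dist (?N y) (?N x) < 1"
    unfolding continuous_at_eps_delta using zero_less_one by blast
  obtain d2 where d2: "d2 > 0" "ball x d2 \<subseteq> img c" using open_img[OF c] x open_contains_ball by blast
  define r where "r = Min {d1, d2, 1 / (4 * K)}"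
  have r: "r > 0" "r \<le> d1" "r \<le> d2" "r \<le> 1 / (4 * K)" using d1 d2 K by (auto simp: r_def)
  show thesis
  proof
    show "r > 0" by (rule r)
    show sub: "ball x r \<subseteq> img c" using d2 r by auto
    fix y z v assume y: "y \<in> ball x r" and z: "z \<in> ball x r"
    define h where "h = z - y"
    have line: "y + t *\<^sub>R h \<in> ball x r" if "t \<in> {0..1}" for t
    proof -
      have "(1 - t) *\<^sub>R y + t *\<^sub>R z \<in> ball x r"
        using convexD[OF convex_ball y z, of "1 - t" t] that by auto
      then show ?thesis by (simp add: h_def algebra_simps)
    qed
    have "norm h \<le> dist z x + dist x y" unfolding h_def dist_norm[symmetric] by (rule dist_triangle)
    also have "\<dots> \<le> 2 * (1 / (4 * K))" using y z r by (simp add: dist_commute)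
    finally have h: "K * norm h \<le> 1/2" using K by (simp add: field_simps)
    obtain Y where "Y 0 = v" "\<And>t. t \<in> {0..1} \<Longrightarrow> (Y has_vector_derivative
        - Gam c (y + t *\<^sub>R h) h (Y t)) (at t within {0..1})"
    proof (rule contraction_ode_solution[of "\<lambda>t u. - Gam c (y + t *\<^sub>R h) h u" v])
      fix X :: "real \<Rightarrow> (real, 'n) vec" assume X: "continuous_on {0..1} X"
      have "continuous_on {0..1} (\<lambda>t. christoffel A g c (y + t *\<^sub>R h) k i j)" for k i j
        by (rule continuous_on_compose2[OF christoffel_continuous[OF c]])
          (use line sub in \<open>auto intro!: continuous_intros\<close>)
      then show "continuous_on {0..1} (\<lambda>t. - Gam c (y + t *\<^sub>R h) h (X t))"
        by (intro continuous_on_minus continuous_on_conn X continuous_on_const)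
    next
      fix t u w assume t: "t \<in> {0..1::real}"
      have "?N (y + t *\<^sub>R h) \<le> K"
        using d1(2)[of "y + t *\<^sub>R h"] line[OF t] r by (auto simp: K_def dist_real_def dist_commute)
      have "norm (- Gam c (y + t *\<^sub>R h) h u - - Gam c (y + t *\<^sub>R h) h w) = norm (Gam c (y + t *\<^sub>R h) h (w - u))"
        by (simp add: linear_diff[OF linear_conn_right])
      also have "\<dots> \<le> ?N (y + t *\<^sub>R h) * norm h * norm (w - u)" by (rule norm_conn_le)
      also have "\<dots> \<le> K * norm h * norm (w - u)"
        using \<open>?N (y + t *\<^sub>R h) \<le> K\<close> by (intro mult_right_mono) auto
      also have "\<dots> \<le> 1/2 * norm (w - u)" using h by (intro mult_right_mono) auto
      finally show "norm (- Gam c (y + t *\<^sub>R h) h u - - Gam c (y + t *\<^sub>R h) h w) \<le> 1/2 * norm (u - w)"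
        by (simp add: norm_minus_commute)
    qed (rule that)
    then show "\<exists>Y. Y 0 = v \<and> (\<forall>t\<in>{0..1}. (Y has_vector_derivative
        - Gam c (y + t *\<^sub>R (z - y)) (z - y) (Y t)) (at t within {0..1}))"
      unfolding h_def by blast
  qed
qed

lemma segment_smooth_on_interval:
  assumes c: "c \<in> A" and d: "d \<in> A" and img: "\<And>t. t \<in> {l..r} \<Longrightarrow> x + t *\<^sub>R h \<in> img c"
    and dom: "(\<lambda>t. chart_inv c (x + t *\<^sub>R h)) ` {l..r} \<subseteq> chart_dom d"
  shows "smooth_on_interval l r (chart_map d \<circ> (\<lambda>t. chart_inv c (x + t *\<^sub>R h)))"
proof -
  have "x + t *\<^sub>R h \<in> chart_map c ` (chart_dom c \<inter> chart_dom d)" if "t \<in> {l..r}" for t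
  proof (rule image_eqI)
    show "x + t *\<^sub>R h = chart_map c (chart_inv c (x + t *\<^sub>R h))" using chart_map_inv[OF c img[OF that]] by simp
    show "chart_inv c (x + t *\<^sub>R h) \<in> chart_dom c \<inter> chart_dom d"
      using chart_inv_dom[OF c img[OF that]] dom that by blast
  qed
  from smooth_on_interval_along_line[OF transition_smooth[OF c d] this]
  show ?thesis by (simp add: transition_def o_def)
qed

text \<open>The equation is solved in the chart \<open>c\<close>, but a parallel field has to satisfy it in every chart
  \<open>d\<close>. Differentiating the coordinate change of the solution produces the second derivative of the
  transition map, which the transformation law of the connection cancels.\<close>

lemma segment_parallel:
  assumes c: "c \<in> A" and img: "\<And>t. t \<in> {0..1} \<Longrightarrow> x + t *\<^sub>R h \<in> img c"
    and Y: "\<And>t. t \<in> {0..1} \<Longrightarrow> (Y has_vector_derivative - Gam c (x + t *\<^sub>R h) h (Y t)) (at t within {0..1})"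
  shows "smooth_curve_on (\<lambda>t. chart_inv c (x + t *\<^sub>R h)) 0 1"
    and "parallel_on (\<lambda>t. chart_inv c (x + t *\<^sub>R h)) (\<lambda>t. coord_vector A c (chart_inv c (x + t *\<^sub>R h)) (Y t)) 0 1"
proof -
  define \<gamma> where "\<gamma> t = chart_inv c (x + t *\<^sub>R h)" for t
  have dom: "\<gamma> t \<in> chart_dom c" and map: "chart_map c (\<gamma> t) = x + t *\<^sub>R h" if "t \<in> {0..1}" for t
    using chart_inv_dom[OF c img[OF that]] chart_map_inv[OF c img[OF that]] by (simp_all add: \<gamma>_def)
  have sm: "smooth_on_interval l r (chart_map d \<circ> \<gamma>)"
    if "d \<in> A" "0 \<le> l" "r \<le> 1" "\<gamma> ` {l..r} \<subseteq> chart_dom d" for d l r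
    using segment_smooth_on_interval[OF c that(1), of l r x h] img that unfolding \<gamma>_def by auto
  have "smooth_curve_on \<gamma> 0 1"
  proof (rule smooth_curve_onI[of 0 1 \<gamma> "{}"])
    have "continuous_on (img c) (chart_inv c)"
      using chart_homeomorphism[OF c] homeomorphism_cont2 by blast
    then show "continuous_on {0..1} \<gamma>"
      unfolding \<gamma>_def by (rule continuous_on_compose2) (use img in \<open>auto intro!: continuous_intros\<close>)
    show "\<gamma> ` {0..1} \<subseteq> M" using dom chart_dom_M[OF c] by blast
  qed (use sm in auto)
  then show "smooth_curve_on (\<lambda>t. chart_inv c (x + t *\<^sub>R h)) 0 1" unfolding \<gamma>_def .
  have "parallel_on \<gamma> (\<lambda>t. coord_vector A c (\<gamma> t) (Y t)) 0 1"
    unfolding parallel_on_def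
  proof (intro conjI ballI allI impI)
    show "coord_vector A c (\<gamma> t) (Y t) \<in> tangent_space A (\<gamma> t)" if "t \<in> {0..1}" for t
      by (rule coord_vector_tangent[OF c dom[OF that]])
    fix d l r
    assume d: "d \<in> A" and "0 \<le> l \<and> l < r \<and> r \<le> 1 \<and> \<gamma> ` {l..r} \<subseteq> chart_dom d \<and>
        smooth_on_interval l r (chart_map d \<circ> \<gamma>)"
    then have lr: "0 \<le> l" "l < r" "r \<le> 1" and dd: "\<gamma> ` {l..r} \<subseteq> chart_dom d" by auto
    let ?F = "\<lambda>y. frechet_derivative (transition c d) (at y)"
    show "solves_on d \<gamma> (\<lambda>t. coord_vector A c (\<gamma> t) (Y t)) {l..r}"
      unfolding solves_on_def
    proof (intro ballI allI impI)
      fix t w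
      assume t: "t \<in> {l..r}" and w: "((chart_map d \<circ> \<gamma>) has_vector_derivative w) (at t within {l..r})"
      have t01: "t \<in> {0..1}" using t lr by auto
      have q: "\<gamma> t \<in> chart_dom c" "\<gamma> t \<in> chart_dom d" using dom[OF t01] dd t by auto
      let ?P = "d_transition c d (\<gamma> t)"
      note LP = d_transition_linear[OF c d q]
      have line: "((\<lambda>t. x + t *\<^sub>R h) has_derivative (\<lambda>s. s *\<^sub>R h)) (at t within {l..r})"
        by (auto intro!: derivative_eq_intros)
      have wP: "w = ?P h"
      proof -
        have "((\<lambda>s. transition c d (x + s *\<^sub>R h)) has_derivative (\<lambda>s. ?P (s *\<^sub>R h))) (at t within {l..r})"
          using has_derivative_compose[OF line transition_has_derivative[OF c d q, unfolded map[OF t01]]] .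
        then have "((\<lambda>s. transition c d (x + s *\<^sub>R h)) has_vector_derivative ?P h) (at t within {l..r})"
          unfolding has_vector_derivative_def by (simp add: linear_scale[OF LP])
        then have "((chart_map d \<circ> \<gamma>) has_vector_derivative ?P h) (at t within {l..r})"
          by (simp add: transition_def \<gamma>_def o_def)
        then show ?thesis
          using vector_derivative_unique_within_closed_interval[of l r t "chart_map d \<circ> \<gamma>" w "?P h"]
            lr t w by (simp add: cbox_interval)
      qed
      have dY: "(Y has_vector_derivative - Gam c (x + t *\<^sub>R h) h (Y t)) (at t within {l..r})"
        by (rule has_vector_derivative_within_subset[OF Y[OF t01]]) (use lr in auto)
      have comp: "((\<lambda>s. (Y s $ i) *\<^sub>R ?F (x + s *\<^sub>R h) (axis i 1)) has_vector_derivative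
          (Y t $ i) *\<^sub>R hess c d (x + t *\<^sub>R h) h (axis i 1) + ((- Gam c (x + t *\<^sub>R h) h (Y t)) $ i) *\<^sub>R ?P (axis i 1))
          (at t within {l..r})" for i
      proof -
        note H = hess_has_derivative[OF c d q, of "axis i 1", unfolded map[OF t01]]
        from has_derivative_compose[OF line H]
        have 1: "((\<lambda>s. ?F (x + s *\<^sub>R h) (axis i 1)) has_derivative (\<lambda>s. s *\<^sub>R hess c d (x + t *\<^sub>R h) h (axis i 1)))
            (at t within {l..r})" by (simp add: linear_scale[OF has_derivative_linear[OF H]])
        have 2: "((\<lambda>s. Y s $ i) has_derivative (\<lambda>s. s *\<^sub>R ((- Gam c (x + t *\<^sub>R h) h (Y t)) $ i))) (at t within {l..r})"
          using bounded_linear.has_vector_derivative[OF bounded_linear_vec_nth dY, of i]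
          unfolding has_vector_derivative_def .
        have "?F (x + t *\<^sub>R h) = ?P" by (simp add: d_transition_def map[OF t01])
        with has_derivative_scaleR[OF 2 1] show ?thesis
          unfolding has_vector_derivative_def by (simp add: scaleR_right_diff_distrib mult.commute)
      qed
      have expand: "coord_vector A c (\<gamma> s) (Y s) d = (\<Sum>i\<in>UNIV. (Y s $ i) *\<^sub>R ?F (x + s *\<^sub>R h) (axis i 1))"
        if s: "s \<in> {l..r}" for s
      proof -
        have s01: "s \<in> {0..1}" using s lr by auto
        have qs: "\<gamma> s \<in> chart_dom c" "\<gamma> s \<in> chart_dom d" using dom[OF s01] dd s by auto
        have e: "(\<Sum>i\<in>UNIV. (Y s $ i) *\<^sub>R axis i 1) = Y s"
          using basis_expansion[of "Y s"] by (simp add: scalar_mult_eq_scaleR)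
        have "coord_vector A c (\<gamma> s) (Y s) d = d_transition c d (\<gamma> s) (\<Sum>i\<in>UNIV. (Y s $ i) *\<^sub>R axis i 1)"
          using qs d by (simp add: coord_vector_def e)
        also have "\<dots> = (\<Sum>i\<in>UNIV. (Y s $ i) *\<^sub>R d_transition c d (\<gamma> s) (axis i 1))"
          by (simp add: linear_sum[OF d_transition_linear[OF c d qs]] linear_scale[OF d_transition_linear[OF c d qs]])
        finally show ?thesis by (simp add: d_transition_def map[OF s01])
      qed
      have "((\<lambda>s. \<Sum>i\<in>UNIV. (Y s $ i) *\<^sub>R ?F (x + s *\<^sub>R h) (axis i 1)) has_vector_derivative
          (\<Sum>i\<in>UNIV. (Y t $ i) *\<^sub>R hess c d (x + t *\<^sub>R h) h (axis i 1)
            + ((- Gam c (x + t *\<^sub>R h) h (Y t)) $ i) *\<^sub>R ?P (axis i 1))) (at t within {l..r})"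
        by (intro has_vector_derivative_sum comp)
      then have D: "((\<lambda>s. coord_vector A c (\<gamma> s) (Y s) d) has_vector_derivative
          (\<Sum>i\<in>UNIV. (Y t $ i) *\<^sub>R hess c d (x + t *\<^sub>R h) h (axis i 1)
            + ((- Gam c (x + t *\<^sub>R h) h (Y t)) $ i) *\<^sub>R ?P (axis i 1))) (at t within {l..r})"
        by (rule has_vector_derivative_transform[OF t, rotated]) (simp add: expand)
      have hs: "hess c d (x + t *\<^sub>R h) h u = ?P (Gam c (x + t *\<^sub>R h) h u) - Gam d (chart_map d (\<gamma> t)) (?P h) (?P u)" for u
        using connection_transformation[OF c d q, of h u] by (simp add: map[OF t01])
      have be: "(\<Sum>i\<in>UNIV. (v $ i) *\<^sub>R axis i 1) = v" for v :: "(real, 'n) vec"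
        using basis_expansion[of v] by (simp add: scalar_mult_eq_scaleR)
      have exp: "(\<Sum>i\<in>UNIV. (v $ i) *\<^sub>R L (axis i 1)) = L v" if "linear L" for v :: "(real, 'n) vec" and L :: "(real, 'n) vec \<Rightarrow> (real, 'n) vec"
        unfolding linear_scale[OF that, symmetric] linear_sum[OF that, symmetric] be ..
      have lin: "linear (\<lambda>u. hess c d (x + t *\<^sub>R h) h u)"
        unfolding hs
        by (intro linear_compose_sub linear_compose[OF linear_conn_right LP, unfolded o_def]
            linear_compose[OF LP linear_conn_right, unfolded o_def])
      have "(\<Sum>i\<in>UNIV. (Y t $ i) *\<^sub>R hess c d (x + t *\<^sub>R h) h (axis i 1)
            + ((- Gam c (x + t *\<^sub>R h) h (Y t)) $ i) *\<^sub>R ?P (axis i 1))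
          = hess c d (x + t *\<^sub>R h) h (Y t) + ?P (- Gam c (x + t *\<^sub>R h) h (Y t))"
        by (simp only: sum.distrib exp[OF lin] exp[OF LP])
      also have "\<dots> = - Gam d (chart_map d (\<gamma> t)) w (coord_vector A c (\<gamma> t) (Y t) d)"
        using q d by (simp add: hs linear_neg[OF LP] wP coord_vector_def)
      finally show "((\<lambda>s. coord_vector A c (\<gamma> s) (Y s) d) has_vector_derivative
          - Gam d (chart_map d (\<gamma> t)) w (coord_vector A c (\<gamma> t) (Y t) d)) (at t within {l..r})"
        using D by simp
    qed
  qed
  then show "parallel_on (\<lambda>t. chart_inv c (x + t *\<^sub>R h)) (\<lambda>t. coord_vector A c (chart_inv c (x + t *\<^sub>R h)) (Y t)) 0 1"
    unfolding \<gamma>_def .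
qed

section \<open>Transport of frames\<close>

lemma frame_map_linear: "linear (\<lambda>v. frame_map E v c)"
  unfolding frame_map_def
  by (intro linearI) (simp_all add: scaleR_left_distrib sum.distrib scaleR_sum_right)

lemma frame_map_axis: "frame_map E (axis i 1) = E i"
proof
  fix c
  have "frame_map E (axis i 1) c = (\<Sum>j\<in>UNIV. if j = i then E j c else 0)"
    unfolding frame_map_def by (rule sum.cong) (auto simp: axis_def)
  then show "frame_map E (axis i 1) c = E i c" by simp
qed

lemma frame_map_columns: "frame_map (\<lambda>i. frame_map E (B *v axis i 1)) v = frame_map E (B *v v)"
proof
  fix c
  have "linear (\<lambda>v. frame_map E (B *v v) c)"
    using linear_compose[OF matrix_vector_mul_linear frame_map_linear] by (simp add: o_def)
  note L = this
  have "(\<Sum>i\<in>UNIV. (v $ i) *\<^sub>R axis i 1) = v"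
    using basis_expansion[of v] by (simp add: scalar_mult_eq_scaleR)
  then have "frame_map E (B *v v) c = frame_map E (B *v (\<Sum>i\<in>UNIV. (v $ i) *\<^sub>R axis i 1)) c" by simp
  also have "\<dots> = (\<Sum>i\<in>UNIV. (v $ i) *\<^sub>R frame_map E (B *v axis i 1) c)"
    unfolding linear_sum[OF L] linear_scale[OF L] ..
  finally show "frame_map (\<lambda>i. frame_map E (B *v axis i 1)) v c = frame_map E (B *v v) c"
    by (simp add: frame_map_def)
qed

lemma orthonormal_frame_tangent: "orthonormal_frame A g q E \<Longrightarrow> E i \<in> tangent_space A q"
  by (simp add: orthonormal_frame_def)

lemma g_frame_map:
  assumes q: "q \<in> M" and E: "orthonormal_frame A g q E"
  shows "g q (frame_map E u) (frame_map E v) = lorentz_form u v"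
proof -
  note T = orthonormal_frame_tangent[OF E]
  have 1: "g q (E i) (frame_map E v) = (\<Sum>j\<in>UNIV. lorentz_matrix $ i $ j * v $ j)" for i
    unfolding g_commute[OF q T frame_map_tangent[OF T]]
    unfolding frame_map_def g_sum_left[OF q T T]
    using E g_commute[OF q T T] by (simp add: orthonormal_frame_def mult.commute)
  show ?thesis
    unfolding frame_map_def[of E u] g_sum_left[OF q T frame_map_tangent[OF T]] 1
    by (simp add: lorentz_form_def inner_vec_def matrix_vector_mult_def)
qed

lemma frame_map_inj:
  assumes "q \<in> M" "orthonormal_frame A g q E" "frame_map E u = frame_map E v" shows "u = v"
proof (rule lorentz_form_nondegenerate)
  show "lorentz_form w u = lorentz_form w v" for w
    using g_frame_map[OF assms(1,2), of w] assms(3) by metis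
qed

lemma frame_coords_inj:
  assumes c: "c \<in> A" "q \<in> chart_dom c" and E: "orthonormal_frame A g q E"
  shows "inj (\<lambda>u. frame_map E u c)"
proof (rule injI)
  fix u v assume "frame_map E u c = frame_map E v c"
  then have "frame_map E u = frame_map E v"
    using tangent_eqI[OF frame_map_tangent frame_map_tangent c] orthonormal_frame_tangent[OF E] by blast
  then show "u = v" using frame_map_inj[OF chart_dom_M[OF c] E] by blast
qed

lemma frame_map_surj:
  assumes q: "q \<in> M" and E: "orthonormal_frame A g q E" and v: "v \<in> tangent_space A q"
  obtains u where "v = frame_map E u"
proof -
  obtain c where c: "c \<in> A" "q \<in> chart_dom c" using chart_around q by blast
  have "surj (\<lambda>u. frame_map E u c)"
    by (rule linear_inj_imp_surj[OF frame_map_linear frame_coords_inj[OF c E]])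
  then obtain u where "frame_map E u c = v c" by (metis surjD)
  then have "v = frame_map E u"
    using tangent_eqI[OF v frame_map_tangent c] orthonormal_frame_tangent[OF E] by metis
  then show thesis by (rule that)
qed

text \<open>A relation between points equipped with frames, rather than a map between tangent spaces: reversal
  and concatenation of curves make it symmetric and transitive.\<close>

definition frame_transport :: "'a \<Rightarrow> ('n \<Rightarrow> ('a, (real, 'n) vec) tangent_vector) \<Rightarrow> 'a
    \<Rightarrow> ('n \<Rightarrow> ('a, (real, 'n) vec) tangent_vector) \<Rightarrow> bool" where
  "frame_transport p E q E' \<longleftrightarrow> (\<exists>\<gamma> X. smooth_curve_on \<gamma> 0 1 \<and> \<gamma> 0 = p \<and> \<gamma> 1 = q \<and>
     (\<forall>i. parallel_on \<gamma> (X i) 0 1 \<and> X i 0 = E i \<and> X i 1 = E' i))"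

lemma frame_transport_sym:
  assumes "frame_transport p E q E'" shows "frame_transport q E' p E"
proof -
  obtain \<gamma> X where \<gamma>: "smooth_curve_on \<gamma> 0 1" "\<gamma> 0 = p" "\<gamma> 1 = q"
    and X: "\<And>i. parallel_on \<gamma> (X i) 0 1" "\<And>i. X i 0 = E i" "\<And>i. X i 1 = E' i"
    using assms unfolding frame_transport_def by blast
  have im: "(\<lambda>t. (-1) * t + 1) ` {0..1::real} = {0..1}"
    by (subst image_affinity_atLeastAtMost) simp
  show ?thesis unfolding frame_transport_def
    by (intro exI[of _ "\<lambda>t. \<gamma> ((-1) * t + 1)"] exI[of _ "\<lambda>i t. X i ((-1) * t + 1)"] conjI allI
        smooth_curve_on_affine[OF \<gamma>(1) _ im] parallel_on_affine[OF X(1) _ im])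
      (simp_all add: \<gamma>(2,3) X(2,3))
qed

lemma frame_transport_trans:
  assumes "frame_transport p E q E'" "frame_transport q E' r E''" shows "frame_transport p E r E''"
proof -
  obtain \<gamma> X where \<gamma>: "smooth_curve_on \<gamma> 0 1" "\<gamma> 0 = p" "\<gamma> 1 = q"
    and X: "\<And>i. parallel_on \<gamma> (X i) 0 1" "\<And>i. X i 0 = E i" "\<And>i. X i 1 = E' i"
    using assms(1) unfolding frame_transport_def by blast
  obtain \<delta> Y where \<delta>: "smooth_curve_on \<delta> 0 1" "\<delta> 0 = q" "\<delta> 1 = r"
    and Y: "\<And>i. parallel_on \<delta> (Y i) 0 1" "\<And>i. Y i 0 = E' i" "\<And>i. Y i 1 = E'' i"
    using assms(2) unfolding frame_transport_def by blast
  have im1: "(\<lambda>t. 2 * t + 0) ` {0..1/2::real} = {0..1}" and im2: "(\<lambda>t. 2 * t + (-1)) ` {1/2..1::real} = {0..1}"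
    by (subst image_affinity_atLeastAtMost; simp)+
  define \<epsilon> where "\<epsilon> t = (if t \<le> 1/2 then \<gamma> (2 * t + 0) else \<delta> (2 * t + (-1)))" for t
  define Z where "Z i t = (if t \<le> 1/2 then X i (2 * t + 0) else Y i (2 * t + (-1)))" for i t
  have e1: "\<gamma> (2 * t + 0) = \<epsilon> t" "X i (2 * t + 0) = Z i t" if "t \<in> {0..1/2}" for t i
    using that by (simp_all add: \<epsilon>_def Z_def)
  have e2: "\<delta> (2 * t + (-1)) = \<epsilon> t" "Y i (2 * t + (-1)) = Z i t" if "t \<in> {1/2..1}" for t i
  proof -
    have "\<delta> (2 * t + (-1)) = \<epsilon> t \<and> Y i (2 * t + (-1)) = Z i t"
    proof (cases "t \<le> 1/2")
      case True
      have "t = 1/2" using that True by simp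
      show ?thesis unfolding \<open>t = 1/2\<close> by (simp add: \<epsilon>_def Z_def \<gamma>(3) \<delta>(2) X(3) Y(2))
    qed (simp add: \<epsilon>_def Z_def)
    then show "\<delta> (2 * t + (-1)) = \<epsilon> t" "Y i (2 * t + (-1)) = Z i t" by blast+
  qed
  have "smooth_curve_on \<epsilon> 0 (1/2)"
    by (rule smooth_curve_on_cong[OF smooth_curve_on_affine[OF \<gamma>(1) _ im1]]) (simp, erule e1(1))
  moreover have "smooth_curve_on \<epsilon> (1/2) 1"
    by (rule smooth_curve_on_cong[OF smooth_curve_on_affine[OF \<delta>(1) _ im2]]) (simp, erule e2(1))
  ultimately have "smooth_curve_on \<epsilon> 0 1" by (rule smooth_curve_on_join[rotated 2]) simp_all
  moreover have "parallel_on \<epsilon> (Z i) 0 1" for i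
  proof (rule parallel_on_join)
    show "parallel_on \<epsilon> (Z i) 0 (1/2)"
      by (rule parallel_on_cong[OF parallel_on_affine[OF X(1) _ im1]]) (simp, erule e1(1), erule e1(2))
    show "parallel_on \<epsilon> (Z i) (1/2) 1"
      by (rule parallel_on_cong[OF parallel_on_affine[OF Y(1) _ im2]]) (simp, erule e2(1), erule e2(2))
  qed simp_all
  moreover have "\<epsilon> 0 = p" "\<epsilon> 1 = r" "Z i 0 = E i" "Z i 1 = E'' i" for i
    using \<gamma>(2) \<delta>(3) X(2) Y(3) by (simp_all add: \<epsilon>_def Z_def)
  ultimately show ?thesis unfolding frame_transport_def by blast
qed

lemma frame_transport_columns:
  assumes "frame_transport p E q E'"
  shows "frame_transport p (\<lambda>i. frame_map E (B *v axis i 1)) q (\<lambda>i. frame_map E' (B *v axis i 1))"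
proof -
  obtain \<gamma> X where \<gamma>: "smooth_curve_on \<gamma> 0 1" "\<gamma> 0 = p" "\<gamma> 1 = q"
    and X: "\<And>i. parallel_on \<gamma> (X i) 0 1" "\<And>i. X i 0 = E i" "\<And>i. X i 1 = E' i"
    using assms unfolding frame_transport_def by blast
  have "parallel_on \<gamma> (\<lambda>t. frame_map (\<lambda>i. X i t) (B *v axis j 1)) 0 1" for j
    unfolding frame_map_def by (rule parallel_on_sum) (rule X)
  then show ?thesis unfolding frame_transport_def
    by (intro exI[of _ \<gamma>] exI[of _ "\<lambda>j t. frame_map (\<lambda>i. X i t) (B *v axis j 1)"]) (simp add: \<gamma> X(2,3))
qed

lemma frame_transport_orthonormal:
  assumes "frame_transport p E q E'" "orthonormal_frame A g p E"
  shows "q \<in> M" "orthonormal_frame A g q E'"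
proof -
  obtain \<gamma> X where \<gamma>: "smooth_curve_on \<gamma> 0 1" "\<gamma> 0 = p" "\<gamma> 1 = q"
    and X: "\<And>i. parallel_on \<gamma> (X i) 0 1" "\<And>i. X i 0 = E i" "\<And>i. X i 1 = E' i"
    using assms(1) unfolding frame_transport_def by blast
  show "q \<in> M" using \<gamma> unfolding smooth_curve_on_def by force
  have "E' i \<in> tangent_space A q" for i
    using bspec[OF conjunct1[OF X(1)[unfolded parallel_on_def]], of 1] by (simp add: \<gamma>(3) X(3))
  moreover have "g q (E' i) (E' j) = g p (E i) (E j)" for i j
    using parallel_preserves_metric[OF \<gamma>(1) X(1)[of i] X(1)[of j], of 0 1] by (simp add: \<gamma>(2,3) X(2,3))
  ultimately show "orthonormal_frame A g q E'" using assms(2) by (simp add: orthonormal_frame_def)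
qed

text \<open>The first curve followed by the second one backwards is a loop at \<open>p\<close>. If \<open>B\<close> is the matrix with
  \<open>E' = E'' B\<close>, then by linearity the way back carries \<open>E'' B\<close> to \<open>E B\<close>, so the loop has holonomy \<open>B\<close>.\<close>

lemma frame_transport_holonomy:
  assumes p: "p \<in> M" "orthonormal_frame A g p E"
    and 1: "frame_transport p E q E'" and 2: "frame_transport p E q E''"
  obtains B where "B \<in> holonomy_group M A g p E" "\<And>v. frame_map E' v = frame_map E'' (B *v v)"
proof -
  note q = frame_transport_orthonormal(1)[OF 1 p(2)]
  note o1 = frame_transport_orthonormal(2)[OF 1 p(2)] and o2 = frame_transport_orthonormal(2)[OF 2 p(2)]
  have "\<exists>u. E' j = frame_map E'' u" for j
    using frame_map_surj[OF q o2 orthonormal_frame_tangent[OF o1]] by metis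
  then obtain b where b: "\<And>j. E' j = frame_map E'' (b j)" by metis
  define B :: "((real, 'n) vec, 'n) vec" where "B = (\<chi> a j. b j $ a)"
  have "B *v axis j 1 = b j" for j
    unfolding vec_eq_iff by (simp add: B_def matrix_vector_mul_component inner_axis)
  then have E': "E' = (\<lambda>j. frame_map E'' (B *v axis j 1))" using b by auto
  have "frame_transport q (\<lambda>j. frame_map E'' (B *v axis j 1)) p (\<lambda>j. frame_map E (B *v axis j 1))"
    by (rule frame_transport_columns[OF frame_transport_sym[OF 2]])
  from frame_transport_trans[OF 1 this[folded E']]
  obtain \<gamma> X where \<gamma>: "smooth_curve_on \<gamma> 0 1" "\<gamma> 0 = p" "\<gamma> 1 = p"
    and X: "\<And>i. parallel_on \<gamma> (X i) 0 1" "\<And>i. X i 0 = E i" "\<And>i. X i 1 = frame_map E (B *v axis i 1)"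
    unfolding frame_transport_def by blast
  have "parallel_transport A g \<gamma> (frame_map E v) (frame_map E (B *v v))" for v
    unfolding parallel_transport_def parallel_along_iff
  proof (intro exI[of _ "\<lambda>t. frame_map (\<lambda>i. X i t) v"] conjI)
    show "parallel_on \<gamma> (\<lambda>t. frame_map (\<lambda>i. X i t) v) 0 1"
      unfolding frame_map_def by (rule parallel_on_sum) (rule X)
    show "frame_map (\<lambda>i. X i 1) v = frame_map E (B *v v)" by (simp add: X(3) frame_map_columns)
  qed (simp add: X(2))
  then have "B \<in> holonomy_group M A g p E"
    unfolding holonomy_group_def piecewise_smooth_curve_iff using \<gamma> by blast
  moreover have "frame_map E' v = frame_map E'' (B *v v)" for v
    unfolding E' by (rule frame_map_columns)
  ultimately show thesis by (rule that)
qed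

text \<open>Transports along all initial pieces of a segment come from one solution \<open>Y\<close> of the transport
  equation. Thus a field defined by transport satisfies this equation along the segment.\<close>

lemma local_transport:
  assumes c: "c \<in> A" and x: "x \<in> img c"
  obtains r where "r > 0" "ball x r \<subseteq> img c"
    "\<And>y z E. y \<in> ball x r \<Longrightarrow> z \<in> ball x r \<Longrightarrow> (\<And>i. E i \<in> tangent_space A (chart_inv c y)) \<Longrightarrow>
      \<exists>Y. (\<forall>i. \<forall>t\<in>{0..1}. (Y i has_vector_derivative
          - Gam c (y + t *\<^sub>R (z - y)) (z - y) (Y i t)) (at t within {0..1})) \<and>
        (\<forall>t\<in>{0..1}. frame_transport (chart_inv c y) E (chart_inv c (y + t *\<^sub>R (z - y)))
          (\<lambda>i. coord_vector A c (chart_inv c (y + t *\<^sub>R (z - y))) (Y i t)))"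
proof -
  obtain r where r: "r > 0" "ball x r \<subseteq> img c"
    and sol: "\<And>y z v. y \<in> ball x r \<Longrightarrow> z \<in> ball x r \<Longrightarrow> \<exists>Y. Y 0 = v \<and> (\<forall>t\<in>{0..1}. (Y has_vector_derivative
        - Gam c (y + t *\<^sub>R (z - y)) (z - y) (Y t)) (at t within {0..1}))"
    using segment_equation_solvable[OF c x] by blast
  show thesis
  proof (rule that[OF r])
    fix y z E assume y: "y \<in> ball x r" and z: "z \<in> ball x r"
      and E: "\<And>i :: 'n. E i \<in> tangent_space A (chart_inv c y)"
    define h where "h = z - y"
    have line: "y + t *\<^sub>R h \<in> img c" if "t \<in> {0..1}" for t
    proof -
      have "(1 - t) *\<^sub>R y + t *\<^sub>R z \<in> ball x r"
        using convexD[OF convex_ball y z, of "1 - t" t] that by auto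
      then show ?thesis using r by (auto simp: h_def algebra_simps)
    qed
    have "\<exists>Y. Y 0 = E i c \<and> (\<forall>t\<in>{0..1}. (Y has_vector_derivative
        - Gam c (y + t *\<^sub>R h) h (Y t)) (at t within {0..1}))" for i
      unfolding h_def by (rule sol[OF y z])
    then obtain Y where Y0: "\<And>i. Y i 0 = E i c" and Y: "\<And>i t. t \<in> {0..1} \<Longrightarrow>
        (Y i has_vector_derivative - Gam c (y + t *\<^sub>R h) h (Y i t)) (at t within {0..1})"
      by metis
    have "frame_transport (chart_inv c y) E (chart_inv c (y + s *\<^sub>R h))
        (\<lambda>i. coord_vector A c (chart_inv c (y + s *\<^sub>R h)) (Y i s))" if s: "s \<in> {0..1}" for s
    proof -
      \<comment> \<open>The initial piece of the segment up to \<open>s\<close>, at unit time.\<close>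
      let ?h = "s *\<^sub>R h"
      have ss: "s * t \<in> {0..1}" if "t \<in> {0..1}" for t
        using s that by (auto intro: mult_le_one)
      have l: "y + t *\<^sub>R ?h \<in> img c" if "t \<in> {0..1}" for t
        using line[OF ss[OF that]] by (simp add: mult.commute)
      have d: "((\<lambda>t. Y i (s * t)) has_vector_derivative - Gam c (y + t *\<^sub>R ?h) ?h (Y i (s * t))) (at t within {0..1})"
        if t: "t \<in> {0..1}" for i t
      proof -
        have "(\<lambda>t. s * t + 0) ` {0..1} \<subseteq> {0..1}" by (rule image_subsetI) (use ss in simp)
        from has_vector_derivative_within_subset[OF Y[OF ss[OF t]] this]
        have "(Y i has_vector_derivative - Gam c (y + (s * t) *\<^sub>R h) h (Y i (s * t)))
            (at (s * t + 0) within (\<lambda>t. s * t + 0) ` {0..1})" by simp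
        from affine_chain[OF this] show ?thesis
          by (simp add: linear_scale[OF linear_conn_left] mult.commute)
      qed
      have "coord_vector A c (chart_inv c y) (E i c) = E i" for i
        by (rule coord_vector_of_tangent[OF c chart_inv_dom[OF c] E]) (use r y in auto)
      then show ?thesis unfolding frame_transport_def
        by (intro exI[of _ "\<lambda>t. chart_inv c (y + t *\<^sub>R ?h)"] conjI allI
            exI[of _ "\<lambda>i t. coord_vector A c (chart_inv c (y + t *\<^sub>R ?h)) (Y i (s * t))"]
            segment_parallel[OF c l d]) (simp_all add: Y0)
    qed
    then show "\<exists>Y. (\<forall>i. \<forall>t\<in>{0..1}. (Y i has_vector_derivative
          - Gam c (y + t *\<^sub>R (z - y)) (z - y) (Y i t)) (at t within {0..1})) \<and>
        (\<forall>t\<in>{0..1}. frame_transport (chart_inv c y) E (chart_inv c (y + t *\<^sub>R (z - y)))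
          (\<lambda>i. coord_vector A c (chart_inv c (y + t *\<^sub>R (z - y))) (Y i t)))"
      using Y unfolding h_def by blast
  qed
qed

text \<open>Being joined by transports in both directions is an equivalence relation on the points of \<open>M\<close>, and
  by transport along segments its classes are open.\<close>

lemma frame_transport_exists:
  assumes conn: "connected M" and pq: "p \<in> M" "q \<in> M" and E: "orthonormal_frame A g p E"
  obtains E' where "frame_transport p E q E'"
proof -
  define R where "R a b \<longleftrightarrow> (\<forall>E. orthonormal_frame A g a E \<longrightarrow> (\<exists>E'. frame_transport a E b E')) \<and>
    (\<forall>E. orthonormal_frame A g b E \<longrightarrow> (\<exists>E'. frame_transport b E a E'))" for a b
  have "R p q"
  proof (rule connected_equivalence_relation[OF conn pq])
    show "R b a" if "R a b" for a b using that unfolding R_def by blast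
    show "R a e" if "R a b" "R b e" for a b e
      using that frame_transport_trans frame_transport_orthonormal(2) unfolding R_def by meson
    fix a assume a: "a \<in> M"
    obtain c where c: "c \<in> A" "a \<in> chart_dom c" using chart_around a by blast
    have xa: "chart_map c a \<in> img c" using c by blast
    obtain r where r: "r > 0" "ball (chart_map c a) r \<subseteq> img c"
      and tr: "\<And>y z E. y \<in> ball (chart_map c a) r \<Longrightarrow> z \<in> ball (chart_map c a) r \<Longrightarrow>
        (\<And>i. E i \<in> tangent_space A (chart_inv c y)) \<Longrightarrow>
        \<exists>Y. (\<forall>i. \<forall>t\<in>{0..1}. (Y i has_vector_derivative
          - Gam c (y + t *\<^sub>R (z - y)) (z - y) (Y i t)) (at t within {0..1})) \<and>
        (\<forall>t\<in>{0..1}. frame_transport (chart_inv c y) E (chart_inv c (y + t *\<^sub>R (z - y)))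
          (\<lambda>i. coord_vector A c (chart_inv c (y + t *\<^sub>R (z - y))) (Y i t)))"
      using local_transport[OF c(1) xa] by blast
    have tr1: "\<exists>E'. frame_transport (chart_inv c y) E (chart_inv c z) E'"
      if yz: "y \<in> ball (chart_map c a) r" "z \<in> ball (chart_map c a) r" "orthonormal_frame A g (chart_inv c y) E" for y z E
    proof -
      obtain Y where "\<forall>t\<in>{0..1}. frame_transport (chart_inv c y) E (chart_inv c (y + t *\<^sub>R (z - y)))
          (\<lambda>i. coord_vector A c (chart_inv c (y + t *\<^sub>R (z - y))) (Y i t))"
        using tr[where E = E, OF yz(1,2) orthonormal_frame_tangent[OF yz(3)]] by blast
      from bspec[OF this, of 1] show ?thesis by auto
    qed
    define T where "T = chart_dom c \<inter> chart_map c -` ball (chart_map c a) r"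
    have "continuous_on (chart_dom c) (chart_map c)"
      using chart_homeomorphism[OF c(1)] homeomorphism_cont1 by blast
    then have "openin (top_of_set (chart_dom c)) T"
      unfolding T_def by (rule continuous_openin_preimage_gen) simp
    then have "openin (top_of_set M) T" using openin_chart_dom[OF c(1)] openin_trans by blast
    moreover have "a \<in> T" using c r by (simp add: T_def)
    moreover have "R a b" if "b \<in> T" for b
    proof -
      have b: "b \<in> chart_dom c" "chart_map c b \<in> ball (chart_map c a) r" using that by (auto simp: T_def)
      have a': "chart_map c a \<in> ball (chart_map c a) r" using r by simp
      show ?thesis unfolding R_def
        using tr1[OF a' b(2)] tr1[OF b(2) a'] c b(1) by simp
    qed
    ultimately show "\<exists>T. openin (top_of_set M) T \<and> a \<in> T \<and> (\<forall>b\<in>T. R a b)" by blast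
  qed
  then show thesis using E that unfolding R_def by blast
qed

section \<open>Holonomy-invariant vectors extend to parallel fields\<close>

text \<open>The value at \<open>q\<close> is the vector with components \<open>u\<close> in any frame transported to \<open>q\<close>. Two such frames
  differ by a holonomy matrix, which fixes \<open>u\<close>, so the value is independent of the curve. In a chart
  the field solves the transport equation along the segments from each point, so it is
  differentiable with vanishing covariant derivative, and then smooth.\<close>

lemma invariant_vector_extends:
  assumes conn: "connected M" and p: "p \<in> M" and E: "orthonormal_frame A g p E"
    and u: "\<And>B. B \<in> holonomy_group M A g p E \<Longrightarrow> B *v u = u"
  obtains V where "parallel_vector_field M A g V"
    "\<And>q E'. frame_transport p E q E' \<Longrightarrow> V q = frame_map E' u"
proof -
  define V where "V q = frame_map (SOME E'. frame_transport p E q E') u" for q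
  have V: "V q = frame_map E' u" if "frame_transport p E q E'" for q E'
  proof -
    have "frame_transport p E q (SOME E'. frame_transport p E q E')" using that by (rule someI[where P = "frame_transport p E q"])
    from frame_transport_holonomy[OF p E this that] show ?thesis
      unfolding V_def using u by metis
  qed
  have tangent: "V q \<in> tangent_space A q" if q: "q \<in> M" for q
  proof -
    obtain E' where E': "frame_transport p E q E'" using frame_transport_exists[OF conn p q E] .
    show ?thesis unfolding V[OF E']
      by (intro frame_map_tangent orthonormal_frame_tangent frame_transport_orthonormal(2)[OF E' E])
  qed
  have der: "(coord_rep c V has_derivative (\<lambda>h. - Gam c x h (coord_rep c V x))) (at x)"
    if c: "c \<in> A" and x: "x \<in> img c" for c x
  proof -
    obtain r where r: "r > 0" "ball x r \<subseteq> img c"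
      and tr: "\<And>y z E. y \<in> ball x r \<Longrightarrow> z \<in> ball x r \<Longrightarrow> (\<And>i. E i \<in> tangent_space A (chart_inv c y)) \<Longrightarrow>
      \<exists>Y. (\<forall>i. \<forall>t\<in>{0..1}. (Y i has_vector_derivative
          - Gam c (y + t *\<^sub>R (z - y)) (z - y) (Y i t)) (at t within {0..1})) \<and>
        (\<forall>t\<in>{0..1}. frame_transport (chart_inv c y) E (chart_inv c (y + t *\<^sub>R (z - y)))
          (\<lambda>i. coord_vector A c (chart_inv c (y + t *\<^sub>R (z - y))) (Y i t)))"
      using local_transport[OF c x] by blast
    have qM: "chart_inv c x \<in> M" using chart_dom_M[OF c chart_inv_dom[OF c x]] .
    obtain F where F: "frame_transport p E (chart_inv c x) F" using frame_transport_exists[OF conn p qM E] .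
    show ?thesis
    proof (rule has_derivative_of_parallel_rays[OF open_img[OF c] x christoffel_continuous[OF c] r])
      fix h :: "(real, 'n) vec" and t :: real
      assume h: "norm h < r" and t: "t \<in> {0..1}"
      have "x \<in> ball x r" "x + h \<in> ball x r" using r h by (simp_all add: dist_norm)
      from tr[where E = F, OF this orthonormal_frame_tangent[OF frame_transport_orthonormal(2)[OF F E]]]
      obtain Y where Y: "\<And>i t. t \<in> {0..1} \<Longrightarrow> (Y i has_vector_derivative
          - Gam c (x + t *\<^sub>R h) h (Y i t)) (at t within {0..1})"
        and FY: "\<And>t. t \<in> {0..1} \<Longrightarrow> frame_transport (chart_inv c x) F (chart_inv c (x + t *\<^sub>R h))
          (\<lambda>i. coord_vector A c (chart_inv c (x + t *\<^sub>R h)) (Y i t))"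
        by (simp only: add_diff_cancel_left') blast
      have val: "coord_rep c V (x + s *\<^sub>R h) = (\<Sum>i\<in>UNIV. (u $ i) *\<^sub>R Y i s)" if s: "s \<in> {0..1}" for s
      proof -
        have "dist x (x + s *\<^sub>R h) < r" using h s mult_right_mono[of s 1 "norm h"] by (auto simp: dist_norm)
        then have d: "chart_inv c (x + s *\<^sub>R h) \<in> chart_dom c" using chart_inv_dom[OF c] r by auto
        show ?thesis unfolding coord_rep_def V[OF frame_transport_trans[OF F FY[OF s]]] frame_map_def
          by (simp add: coord_vector_same[OF c d])
      qed
      have "((\<lambda>s. \<Sum>i\<in>UNIV. (u $ i) *\<^sub>R Y i s) has_vector_derivative
          (\<Sum>i\<in>UNIV. (u $ i) *\<^sub>R (- Gam c (x + t *\<^sub>R h) h (Y i t)))) (at t within {0..1})"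
        by (intro has_vector_derivative_sum Y[OF t]
            bounded_linear.has_vector_derivative[OF bounded_linear_scaleR_right])
      then have "((\<lambda>s. \<Sum>i\<in>UNIV. (u $ i) *\<^sub>R Y i s) has_vector_derivative
          - Gam c (x + t *\<^sub>R h) h (coord_rep c V (x + t *\<^sub>R h))) (at t within {0..1})"
        by (simp add: val[OF t] linear_sum[OF linear_conn_right] linear_scale[OF linear_conn_right] sum_negf)
      then show "((\<lambda>s. coord_rep c V (x + s *\<^sub>R h)) has_vector_derivative
          - Gam c (x + t *\<^sub>R h) h (coord_rep c V (x + t *\<^sub>R h))) (at t within {0..1})"
        by (rule has_vector_derivative_transform[OF t, rotated]) (simp add: val)
    qed
  qed
  have "parallel_vector_field M A g V"
    unfolding parallel_vector_field_def smooth_vector_field_on_def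
  proof (intro conjI ballI)
    fix c assume c: "c \<in> A"
    have "chart_dom c \<inter> M = chart_dom c" using chart_dom_M[OF c] by blast
    then show "smooth_on (chart_map c ` (chart_dom c \<inter> M)) (coord_rep c V)"
      using smooth_of_parallel[OF open_img[OF c] christoffel_smooth[OF c] der[OF c]] by simp
  next
    fix q w assume "q \<in> M" "w \<in> tangent_space A q"
    show "cov_deriv A g q w V = (\<lambda>c. 0)"
    proof
      fix c
      show "cov_deriv A g q w V c = 0"
      proof (cases "c \<in> A \<and> q \<in> chart_dom c")
        case True
        then have "frechet_derivative (coord_rep c V) (at (chart_map c q)) =
            (\<lambda>h. - Gam c (chart_map c q) h (coord_rep c V (chart_map c q)))"
          using frechet_derivative_at[OF der[of c "chart_map c q"]] by auto
        then show ?thesis using True by (simp add: cov_deriv_def christoffel_map_conn coord_rep_def)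
      qed (unfold cov_deriv_def, metis)
    qed
  qed (rule tangent)
  then show thesis using V by (rule that)
qed

section \<open>Parallel vector fields are fixed by the holonomy\<close>

lemma parallel_vector_field_along:
  assumes V: "parallel_vector_field M A g V" and \<gamma>: "smooth_curve_on \<gamma> 0 1"
  shows "parallel_on \<gamma> (\<lambda>t. V (\<gamma> t)) 0 1"
  unfolding parallel_on_def
proof (intro conjI ballI allI impI)
  have M: "\<gamma> t \<in> M" if "t \<in> {0..1}" for t using \<gamma> that unfolding smooth_curve_on_def by blast
  show T: "V (\<gamma> t) \<in> tangent_space A (\<gamma> t)" if "t \<in> {0..1}" for t
    using V M[OF that] unfolding parallel_vector_field_def smooth_vector_field_on_def by blast
  fix c l r
  assume c: "c \<in> A" and "0 \<le> l \<and> l < r \<and> r \<le> 1 \<and> \<gamma> ` {l..r} \<subseteq> chart_dom c \<and>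
        smooth_on_interval l r (chart_map c \<circ> \<gamma>)"
  then have dom: "\<gamma> s \<in> chart_dom c" if "s \<in> {l..r}" for s using that by blast
  show "solves_on c \<gamma> (\<lambda>t. V (\<gamma> t)) {l..r}"
    unfolding solves_on_def
  proof (intro ballI allI impI)
    fix t w
    assume t: "t \<in> {l..r}" and w: "((chart_map c \<circ> \<gamma>) has_vector_derivative w) (at t within {l..r})"
    have q: "\<gamma> t \<in> chart_dom c" using dom[OF t] .
    let ?x = "chart_map c (\<gamma> t)" and ?D = "frechet_derivative (coord_rep c V) (at (chart_map c (\<gamma> t)))"
    have "smooth_on (chart_map c ` (chart_dom c \<inter> M)) (coord_rep c V)"
      using V c unfolding parallel_vector_field_def smooth_vector_field_on_def by blast
    then have "coord_rep c V differentiable (at ?x)"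
      by (rule smooth_on_differentiable) (use q chart_dom_M[OF c] in blast)
    then have D: "(coord_rep c V has_derivative ?D) (at ?x)" by (simp add: frechet_derivative_works)
    have "cov_deriv A g (\<gamma> t) (coord_vector A c (\<gamma> t) w) V = (\<lambda>c. 0)"
      using V coord_vector_tangent[OF c q] chart_dom_M[OF c q] unfolding parallel_vector_field_def by blast
    then have "cov_deriv A g (\<gamma> t) (coord_vector A c (\<gamma> t) w) V c = 0" by simp
    then have Dw: "?D w = - Gam c ?x w (V (\<gamma> t) c)"
      using c q by (simp add: cov_deriv_def coord_vector_same christoffel_map_conn eq_neg_iff_add_eq_0)
    have "((\<lambda>s. coord_rep c V ((chart_map c \<circ> \<gamma>) s)) has_derivative (\<lambda>s. ?D (s *\<^sub>R w))) (at t within {l..r})"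
      by (rule has_derivative_compose[OF w[unfolded has_vector_derivative_def]]) (simp add: D)
    then have "((\<lambda>s. coord_rep c V ((chart_map c \<circ> \<gamma>) s)) has_vector_derivative - Gam c ?x w (V (\<gamma> t) c)) (at t within {l..r})"
      unfolding has_vector_derivative_def by (simp add: linear_scale[OF has_derivative_linear[OF D]] Dw)
    then show "((\<lambda>s. V (\<gamma> s) c) has_vector_derivative - Gam c ?x w (V (\<gamma> t) c)) (at t within {l..r})"
      by (rule has_vector_derivative_transform[OF t, rotated])
        (use dom c in \<open>simp add: coord_rep_def\<close>)
  qed
qed

lemma holonomy_lorentz:
  assumes p: "p \<in> M" "orthonormal_frame A g p E" and B: "B \<in> holonomy_group M A g p E"
  shows "B \<in> lorentz_group"
proof -
  obtain \<gamma> where \<gamma>: "smooth_curve_on \<gamma> 0 1" "\<gamma> 0 = p" "\<gamma> 1 = p"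
    and tr: "\<And>v. parallel_transport A g \<gamma> (frame_map E v) (frame_map E (B *v v))"
    using B unfolding holonomy_group_def piecewise_smooth_curve_iff by blast
  have "lorentz_form (B *v u) (B *v v) = lorentz_form u v" for u v
  proof -
    obtain X Y where "parallel_on \<gamma> X 0 1" "X 0 = frame_map E u" "X 1 = frame_map E (B *v u)"
      "parallel_on \<gamma> Y 0 1" "Y 0 = frame_map E v" "Y 1 = frame_map E (B *v v)"
      using tr unfolding parallel_transport_def parallel_along_iff by meson
    then show ?thesis
      using parallel_preserves_metric[OF \<gamma>(1), of X Y 0 1] g_frame_map[OF p] by (simp add: \<gamma>(2,3))
  qed
  then show ?thesis by (simp add: lorentz_group_iff)
qed

text \<open>The product of the parallel field with a transported vector is constant along the loop. Hence \<open>v\<close>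
  and \<open>B v\<close> have the same Lorentz product with each vector \<open>B u\<close>, that is, with all vectors.\<close>

lemma holonomy_fixes_parallel_field:
  assumes p: "p \<in> M" "orthonormal_frame A g p E" and B: "B \<in> holonomy_group M A g p E"
    and V: "parallel_vector_field M A g V" and v: "V p = frame_map E v"
  shows "B *v v = v"
proof -
  obtain \<gamma> where \<gamma>: "smooth_curve_on \<gamma> 0 1" "\<gamma> 0 = p" "\<gamma> 1 = p"
    and tr: "\<And>v. parallel_transport A g \<gamma> (frame_map E v) (frame_map E (B *v v))"
    using B unfolding holonomy_group_def piecewise_smooth_curve_iff by blast
  have BL: "B \<in> lorentz_group" by (rule holonomy_lorentz[OF p B])
  have eq: "lorentz_form (B *v u) v = lorentz_form (B *v u) (B *v v)" for u
  proof -
    obtain X where X: "parallel_on \<gamma> X 0 1" "X 0 = frame_map E u" "X 1 = frame_map E (B *v u)"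
      using tr unfolding parallel_transport_def parallel_along_iff by meson
    have "lorentz_form (B *v u) v = lorentz_form u v"
      using parallel_preserves_metric[OF \<gamma>(1) X(1) parallel_vector_field_along[OF V \<gamma>(1)], of 0 1]
        g_frame_map[OF p] by (simp add: \<gamma>(2,3) X(2,3) v)
    also have "\<dots> = lorentz_form (B *v u) (B *v v)" using BL by (simp add: lorentz_group_iff)
    finally show ?thesis .
  qed
  show ?thesis
  proof (rule lorentz_form_nondegenerate)
    fix w
    have "B *v (matrix_inv B *v w) = w"
      by (simp add: matrix_vector_mul_assoc matrix_inv_inverse lorentz_group_invertible[OF BL])
    then show "lorentz_form w (B *v v) = lorentz_form w v" using eq[of "matrix_inv B *v w"] by simp
  qed
qed

section \<open>Transport along loops preserves the orientation\<close>

definition frame_det :: "('a, (real, 'n) vec) chart \<Rightarrow> ('n \<Rightarrow> ('a, (real, 'n) vec) tangent_vector) \<Rightarrow> real" where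
  "frame_det c E = det (\<chi> a j. E j c $ a)"

lemma frame_matrix_mult: "(\<chi> a j. E j c $ a) *v u = frame_map E u c"
  by (simp add: vec_eq_iff frame_map_def matrix_vector_mult_def mult.commute)

lemma frame_det_nonzero:
  assumes "c \<in> A" "q \<in> chart_dom c" "orthonormal_frame A g q E"
  shows "frame_det c E \<noteq> 0"
proof -
  have "inj ((*v) (\<chi> a j. E j c $ a))"
    unfolding frame_matrix_mult using frame_coords_inj[OF assms] .
  then show ?thesis
    unfolding frame_det_def by (metis invertible_det_nz invertible_left_inverse matrix_left_invertible_injective)
qed

lemma frame_det_columns: "frame_det c (\<lambda>i. frame_map E (B *v axis i 1)) = frame_det c E * det B"
proof -
  have "(\<chi> a j. frame_map E (B *v axis j 1) c $ a) *v u = ((\<chi> a j. E j c $ a) ** B) *v u" for u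
    using frame_matrix_mult[of "\<lambda>i. frame_map E (B *v axis i 1)" c u]
    by (simp add: frame_matrix_mult[of E] frame_map_columns matrix_vector_mul_assoc[symmetric])
  then have "(\<chi> a j. frame_map E (B *v axis j 1) c $ a) = (\<chi> a j. E j c $ a) ** B"
    by (simp add: matrix_eq)
  then show ?thesis unfolding frame_det_def by (simp add: det_mul)
qed

lemma frame_det_transition:
  assumes or: "oriented_atlas A" and c: "c \<in> A" "q \<in> chart_dom c" and d: "d \<in> A" "q \<in> chart_dom d"
    and E: "orthonormal_frame A g q E"
  shows "frame_det c E * frame_det d E > 0"
proof -
  let ?P = "d_transition c d q"
  note T = orthonormal_frame_tangent[OF E]
  note LP = d_transition_linear[OF c(1) d(1) c(2) d(2)]
  have "(\<chi> a j. E j d $ a) *v u = (matrix ?P ** (\<chi> a j. E j c $ a)) *v u" for u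
    using tangent_transition[OF frame_map_tangent[of E q u, OF T] c(1) d(1) c(2) d(2)]
    by (simp add: frame_matrix_mult[of E] matrix_vector_mul_assoc[symmetric] matrix_works[OF LP[folded linear_matrix_vector_mul_eq]])
  then have "(\<chi> a j. E j d $ a) = matrix ?P ** (\<chi> a j. E j c $ a)" by (simp add: matrix_eq)
  then have 1: "frame_det d E = det (matrix ?P) * frame_det c E" unfolding frame_det_def by (simp add: det_mul)
  have "det (matrix ?P) > 0" using or c d unfolding oriented_atlas_def by blast
  moreover have "frame_det c E * frame_det c E > 0"
    using frame_det_nonzero[OF c E] by (metis not_real_square_gt_zero)
  ultimately show ?thesis unfolding 1 by (metis mult.left_commute mult_pos_pos)
qed

lemma same_sign_trans: "x * y > 0 \<Longrightarrow> y * z > 0 \<Longrightarrow> x * z > (0 :: real)"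
  by (auto simp: zero_less_mult_iff)

text \<open>Along a piece of the curve in one chart the coordinate determinant of the transported frame is
  continuous and has no zero, and an oriented change of charts multiplies it by a positive number.\<close>

lemma frame_transport_orientation:
  assumes or: "oriented_atlas A" and tr: "frame_transport p E q E'" and E: "orthonormal_frame A g p E"
    and c: "c \<in> A" "p \<in> chart_dom c" and d: "d \<in> A" "q \<in> chart_dom d"
  shows "frame_det c E * frame_det d E' > 0"
proof -
  obtain \<gamma> X where \<gamma>: "smooth_curve_on \<gamma> 0 1" "\<gamma> 0 = p" "\<gamma> 1 = q"
    and X: "\<And>i. parallel_on \<gamma> (X i) 0 1" "\<And>i. X i 0 = E i" "\<And>i. X i 1 = E' i"
    using tr unfolding frame_transport_def by blast
  have on: "orthonormal_frame A g (\<gamma> t) (\<lambda>i. X i t)" if t: "t \<in> {0..1}" for t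
  proof -
    have "X i t \<in> tangent_space A (\<gamma> t)" for i using X(1)[of i] t unfolding parallel_on_def by blast
    moreover have "g (\<gamma> t) (X i t) (X j t) = g p (E i) (E j)" for i j
      using parallel_preserves_metric[OF \<gamma>(1) X(1)[of i] X(1)[of j], of 0 t] t by (simp add: \<gamma>(2) X(2))
    ultimately show ?thesis using E by (simp add: orthonormal_frame_def)
  qed
  define F where "F c t = frame_det c (\<lambda>i. X i t)" for c t
  have chart: "\<exists>c\<in>A. \<gamma> t \<in> chart_dom c" if "t \<in> {0..1}" for t
    using \<gamma>(1) that chart_around unfolding smooth_curve_on_def by blast
  have change: "F c t * F d t > 0" if "t \<in> {0..1}" "c \<in> A" "\<gamma> t \<in> chart_dom c" "d \<in> A" "\<gamma> t \<in> chart_dom d" for c d t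
    unfolding F_def by (rule frame_det_transition[OF or that(2-5) on[OF that(1)]])
  define R where "R s t \<longleftrightarrow> (\<forall>c\<in>A. \<forall>d\<in>A. \<gamma> s \<in> chart_dom c \<longrightarrow> \<gamma> t \<in> chart_dom d \<longrightarrow> F c s * F d t > 0)" for s t
  have "R 0 1"
  proof (rule along_smooth_curve[OF \<gamma>(1)])
    show "R t t" if "t \<in> {0..1}" for t unfolding R_def using change[OF that] by blast
    show "R t s" if "R s t" for s t using that unfolding R_def by (metis mult.commute)
    show "R s u" if st: "R s t" "R t u" and t: "t \<in> {0..1}" for s t u
    proof -
      obtain e where "e \<in> A" "\<gamma> t \<in> chart_dom e" using chart[OF t] by blast
      then show ?thesis using st unfolding R_def by (metis same_sign_trans)
    qed
    fix c l r
    assume c: "c \<in> A" and lr: "0 \<le> l" "l < r" "r \<le> 1" and dom: "\<gamma> ` {l..r} \<subseteq> chart_dom c"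
      and sm: "smooth_on_interval l r (chart_map c \<circ> \<gamma>)"
    have "continuous_on {l..r} (\<lambda>t. X i t c)" for i
    proof (rule continuous_on_vector_derivative)
      fix t assume t: "t \<in> {l..r}"
      obtain w where w: "((chart_map c \<circ> \<gamma>) has_vector_derivative w) (at t within {l..r})"
        using smooth_on_interval_derivative[OF sm t] by blast
      show "((\<lambda>t. X i t c) has_vector_derivative
          - Gam c (chart_map c (\<gamma> t)) (vector_derivative (chart_map c \<circ> \<gamma>) (at t within {l..r})) (X i t c)) (at t within {l..r})"
        using X(1)[of i] c lr dom sm t vector_derivative_works[THEN iffD1, OF differentiableI_vector[OF w]]
        unfolding parallel_on_def solves_on_def by blast
    qed
    then have cont: "continuous_on {l..r} (F c)"
      unfolding F_def frame_det_def det_def by (auto intro!: continuous_intros)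
    have nz: "F c t \<noteq> 0" if "t \<in> {l..r}" for t
      unfolding F_def by (rule frame_det_nonzero[OF c _ on]) (use dom that lr in auto)
    have "F c l * F c r > 0"
    proof (rule ccontr)
      assume "\<not> F c l * F c r > 0"
      then consider "F c l \<le> 0" "0 \<le> F c r" | "F c r \<le> 0" "0 \<le> F c l"
        by (metis linorder_le_cases mult_neg_neg mult_pos_pos not_less nz order_less_le lr(2) atLeastAtMost_iff order_refl less_imp_le)
      then obtain t where "t \<in> {l..r}" "F c t = 0"
      proof cases
        case 1
        then show thesis using IVT'[of "F c" l 0 r] lr cont that by auto
      next
        case 2
        then show thesis using IVT2'[of "F c" r 0 l] lr cont that by auto
      qed
      then show False using nz by blast
    qed
    moreover have "l \<in> {0..1}" "r \<in> {0..1}" "\<gamma> l \<in> chart_dom c" "\<gamma> r \<in> chart_dom c" using lr dom by auto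
    ultimately show "R l r" unfolding R_def using change c by (metis same_sign_trans)
  qed auto
  then show ?thesis unfolding R_def F_def using c d by (simp add: \<gamma>(2,3) X(2,3))
qed

lemma holonomy_det:
  assumes or: "oriented_atlas A" and p: "p \<in> M" "orthonormal_frame A g p E"
    and B: "B \<in> holonomy_group M A g p E"
  shows "det B = 1"
proof -
  obtain \<gamma> where \<gamma>: "smooth_curve_on \<gamma> 0 1" "\<gamma> 0 = p" "\<gamma> 1 = p"
    and tr: "\<And>v. parallel_transport A g \<gamma> (frame_map E v) (frame_map E (B *v v))"
    using B unfolding holonomy_group_def piecewise_smooth_curve_iff by blast
  have "\<exists>X. parallel_on \<gamma> X 0 1 \<and> X 0 = E i \<and> X 1 = frame_map E (B *v axis i 1)" for i
    using tr[of "axis i 1"] unfolding parallel_transport_def parallel_along_iff frame_map_axis .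
  then obtain X where "\<And>i. parallel_on \<gamma> (X i) 0 1 \<and> X i 0 = E i \<and> X i 1 = frame_map E (B *v axis i 1)"
    by metis
  then have T: "frame_transport p E p (\<lambda>i. frame_map E (B *v axis i 1))"
    unfolding frame_transport_def using \<gamma> by blast
  obtain c where c: "c \<in> A" "p \<in> chart_dom c" using chart_around p(1) by blast
  have "frame_det c E * (frame_det c E * det B) > 0"
    using frame_transport_orientation[OF or T p(2) c c] by (simp add: frame_det_columns)
  then have "det B > 0"
    by (metis mult.assoc mult_less_0_iff not_less_iff_gr_or_eq zero_less_mult_iff)
  moreover have "det B * det B = 1" by (rule lorentz_group_det[OF holonomy_lorentz[OF p B]])
  ultimately show ?thesis by (metis abs_of_pos abs_mult_self_eq mult_cancel_left mult_1_right power2_eq_1_iff power2_eq_square less_asym neg_less_0_iff_less zero_less_one)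
qed

section \<open>Holonomy and systems of parallel fields\<close>

text \<open>If \<open>C\<close> conjugates the holonomy into the stabiliser of the first \<open>k\<close> basis vectors, then the holonomy
  itself fixes the images of these vectors under the inverse of \<open>C\<close>.\<close>

lemma parallel_system_of_holonomy:
  assumes conn: "connected M" and k: "k \<in> {1..CARD('n)}" and p: "p \<in> M" "orthonormal_frame A g p E"
    and H: "conj_included (holonomy_group M A g p E) (SO_stab k)"
  obtains V where "\<And>i. i \<in> {1..k} \<Longrightarrow> parallel_vector_field M A g (V i)" "orthonormal_system M g k V"
proof -
  obtain C where C: "C \<in> lorentz_group"
    and HC: "\<And>B. B \<in> holonomy_group M A g p E \<Longrightarrow> C ** B ** matrix_inv C \<in> SO_stab k"
    using H unfolding conj_included_def by blast
  note invC = matrix_inv_inverse[OF lorentz_group_invertible[OF C]]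
  \<comment> \<open>The fields are numbered from \<open>1\<close>, the basis vectors from \<open>0\<close>.\<close>
  define ix where "ix = inv_into UNIV (idx :: 'n \<Rightarrow> nat)"
  have ix: "idx (ix i) = i" if "i < CARD('n)" for i
    using bij_betw_inv_into_right[OF idx_bij[where 'n = 'n], of i] that by (simp add: ix_def)
  define u where "u i = matrix_inv C *v axis (ix (i - 1)) 1" for i
  have fixed: "B *v u i = u i" if B: "B \<in> holonomy_group M A g p E" and i: "i \<in> {1..k}" for B i
  proof -
    have "idx (ix (i - 1)) < k" using ix[of "i - 1"] i k by auto
    then have "(C ** B ** matrix_inv C) *v axis (ix (i - 1)) 1 = axis (ix (i - 1)) 1"
      using HC[OF B] unfolding SO_stab_def Let_def by blast
    then have "C *v (B *v u i) = axis (ix (i - 1)) 1"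
      by (simp add: u_def matrix_vector_mul_assoc matrix_mul_assoc)
    then have "matrix_inv C *v (C *v (B *v u i)) = u i" by (simp add: u_def)
    then show ?thesis by (simp add: matrix_vector_mul_assoc matrix_mul_assoc invC)
  qed
  have "\<exists>V. i \<in> {1..k} \<longrightarrow> parallel_vector_field M A g V \<and>
      (\<forall>q E'. frame_transport p E q E' \<longrightarrow> V q = frame_map E' (u i))" for i
    using invariant_vector_extends[OF conn p, of "u i"] fixed by metis
  then obtain V where V: "\<And>i. i \<in> {1..k} \<Longrightarrow> parallel_vector_field M A g (V i)"
    and Vu: "\<And>i q E'. i \<in> {1..k} \<Longrightarrow> frame_transport p E q E' \<Longrightarrow> V i q = frame_map E' (u i)"
    by metis
  have "orthonormal_system M g k V"
    unfolding orthonormal_system_def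
  proof (intro ballI)
    fix q i j assume q: "q \<in> M" and ij: "i \<in> {1..k}" "j \<in> {1..k}"
    obtain E' where E': "frame_transport p E q E'" using frame_transport_exists[OF conn p(1) q p(2)] .
    have "g q (V i q) (V j q) = lorentz_form (u i) (u j)"
      unfolding Vu[OF ij(1) E'] Vu[OF ij(2) E']
      by (rule g_frame_map[OF q frame_transport_orthonormal(2)[OF E' p(2)]])
    also have "\<dots> = lorentz_form (axis (ix (i - 1)) 1) (axis (ix (j - 1)) 1)"
      unfolding u_def using lorentz_group_inv[OF C] by (simp add: lorentz_group_iff)
    also have "\<dots> = (if i \<noteq> j then 0 else if i = 1 then -1 else 1)"
    proof -
      have "idx (ix (i - 1)) = i - 1" "idx (ix (j - 1)) = j - 1" using ij k by (auto intro!: ix)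
      moreover from this have "ix (i - 1) = ix (j - 1) \<longleftrightarrow> i - 1 = j - 1" by (metis idx_inj)
      ultimately show ?thesis
        using ij by (auto simp: lorentz_form_axis_axis lorentz_matrix_def)
    qed
    finally show "g q (V i q) (V j q) = (if i \<noteq> j then 0 else if i = 1 then -1 else 1)" .
  qed
  with V show thesis by (rule that)
qed

text \<open>The values of the fields at \<open>p\<close> are completed to a Lorentz basis, the columns of \<open>P\<close>. Conjugation by
  the inverse of \<open>P\<close> carries the vectors fixed by the holonomy to the first \<open>k\<close> basis vectors.\<close>

lemma holonomy_of_parallel_system:
  assumes or: "oriented_atlas A" and k: "k \<in> {1..CARD('n)}" and p: "p \<in> M" "orthonormal_frame A g p E"
    and V: "\<And>i. i \<in> {1..k} \<Longrightarrow> parallel_vector_field M A g (V i)" and on: "orthonormal_system M g k V"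
  shows "conj_included (holonomy_group M A g p E) (SO_stab k)"
proof -
  have "\<exists>v. V (Suc i) p = frame_map E v" if "i < k" for i
  proof -
    have "V (Suc i) p \<in> tangent_space A p"
      using V[of "Suc i"] p(1) that unfolding parallel_vector_field_def smooth_vector_field_on_def by auto
    then show ?thesis using frame_map_surj[OF p] by metis
  qed
  then obtain v where v: "\<And>i. i < k \<Longrightarrow> V (Suc i) p = frame_map E (v i)" by metis
  have "lorentz_form (v i) (v j) = (if i \<noteq> j then 0 else if i = 0 then -1 else 1)" if "i < k" "j < k" for i j
  proof -
    have "Suc i \<in> {1..k}" "Suc j \<in> {1..k}" using that by auto
    then have "g p (V (Suc i) p) (V (Suc j) p) = (if Suc i \<noteq> Suc j then 0 else if Suc i = 1 then -1 else 1)"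
      using on p(1) unfolding orthonormal_system_def by blast
    then show ?thesis using v that g_frame_map[OF p] by simp
  qed
  then obtain P :: "((real, 'n) vec, 'n) vec" where P: "P \<in> lorentz_group"
    and Pv: "\<And>j. idx j < k \<Longrightarrow> P *v axis j 1 = v (idx j)"
    using lorentz_system_as_columns[of k v] k by auto
  note invP = matrix_inv_inverse[OF lorentz_group_invertible[OF P]]
  let ?C = "matrix_inv P"
  have "?C ** B ** matrix_inv ?C \<in> SO_stab k" if B: "B \<in> holonomy_group M A g p E" for B
  proof -
    have CB: "?C ** B ** matrix_inv ?C = ?C ** B ** P"
      using matrix_inv_inv[OF lorentz_group_invertible[OF P]] by simp
    have BL: "B \<in> lorentz_group" by (rule holonomy_lorentz[OF p B])
    have "?C ** B ** P \<in> SO_stab k"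
    proof (rule SO_stabI)
      show "?C ** B ** P \<in> lorentz_group" by (intro lorentz_group_mult lorentz_group_inv P BL)
      have "det ?C * det P = 1" using invP(1) by (metis det_I det_mul)
      then show "det (?C ** B ** P) = 1" by (simp add: det_mul holonomy_det[OF or p B])
      show "(?C ** B ** P) *v axis j 1 = axis j 1" if j: "idx j < k" for j
      proof -
        have "B *v v (idx j) = v (idx j)"
          by (rule holonomy_fixes_parallel_field[OF p B V v]) (use j in auto)
        then have "(?C ** B ** P) *v axis j 1 = ?C *v (P *v axis j 1)"
          by (simp add: matrix_vector_mul_assoc[symmetric] Pv[OF j])
        then show ?thesis by (simp add: matrix_vector_mul_assoc invP)
      qed
    qed (use k in simp)
    then show ?thesis by (simp only: CB)
  qed
  then show ?thesis unfolding conj_included_def using lorentz_group_inv[OF P] by blast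
qed

end

theorem theorem7:
  fixes M :: "'a::{t2_space,second_countable_topology} set"
    and A :: "('a, (real, 'n::{finite,linorder}) vec) chart set"
    and g :: "('a, (real, 'n) vec) metric"
    and \<tau> :: "'a \<Rightarrow> ('a, (real, 'n) vec) tangent_vector set"
    and p :: 'a
    and E :: "'n \<Rightarrow> ('a, (real, 'n) vec) tangent_vector"
    and k :: nat
  assumes "smooth_atlas M A"
    and "connected M"
    and "oriented_atlas A"
    and "lorentzian_metric M A g"
    and "time_orientation M A g \<tau>"
    and "k \<in> {1..CARD('n)}"
    and "p \<in> M"
    and "orthonormal_frame A g p E"
  shows "conj_included (holonomy_group M A g p E) (SO_stab k) \<longleftrightarrow>
    (\<exists>V :: nat \<Rightarrow> 'a \<Rightarrow> ('a, (real, 'n) vec) tangent_vector.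
       (\<forall>i\<in>{1..k}. parallel_vector_field M A g (V i)) \<and> orthonormal_system M g k V)"
proof -
  interpret lorentz_manifold M A g by unfold_locales (fact assms)+
  show ?thesis
  proof
    assume "conj_included (holonomy_group M A g p E) (SO_stab k)"
    from parallel_system_of_holonomy[OF assms(2,6,7,8) this]
    show "\<exists>V. (\<forall>i\<in>{1..k}. parallel_vector_field M A g (V i)) \<and> orthonormal_system M g k V" by metis
  next
    assume "\<exists>V. (\<forall>i\<in>{1..k}. parallel_vector_field M A g (V i)) \<and> orthonormal_system M g k V"
    then show "conj_included (holonomy_group M A g p E) (SO_stab k)"
      using holonomy_of_parallel_system[OF assms(3,6,7,8)] by blast
  qed
qed

end
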